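(* Let $\Bbbk$ be a field, $V$ a finite set, $R=\Bbbk[V]$, and let $I\subseteq R$ be a nonzero proper squarefree monomial ideal which has an admissible regular sequence $a_1,\dots,a_d$ (so $d=d(I)$). Put $\mathfrak a=\langle a_1,\dots,a_d\rangle$ and $W=\bigcup_{i=1}^d\operatorname{supp}(a_i)$, let $C$ be the clutter on $V$ with $I=I(C)$, and let $C^c_{|W}$ be the $d$-partite $d$-uniform clutter with vertex set $W$ and edge set $$E(C^c_{|W})=\{\{v_1,\dots,v_d\}\mid v_j\in\operatorname{supp}(a_j)\text{ for all }j\}\setminus E(C).$$ Fix a total order $\prec$ on $V$. Then the first linear strand of the minimal free resolution of $I$ is isomorphic to the complex $\mathcal L_\bullet\big(I(C^c_{|W})^A/\mathfrak a\big)[d]$ (formed over $\Bbbk[W]$ and extended to $R$ by $-\otimes_{\Bbbk[W]}R$). Explicitly, this complex has terms $$F_i=\bigoplus_{\substack{D\subseteq W\text{ a vertex cover of }C^c_{|W},\\ |D|=|W|-i-d,\\ m_D\notin\mathfrak a}}R\,e_D ,$$ where the free generator $e_D$ has multidegree $W\setminus D$, and differentials $F_i\to F_{i-1}$ given by $$e_D\longmapsto\sum_{\substack{v\in W\setminus D\\ m_{D\cup\{v\}}\notin\mathfrak a}}(-1)^{\alpha(v,D)}\,v\,e_{D\cup\{v\}},\qquad \alpha(v,D)=|\{w\in D\mid w\prec v\}| .$$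
   Context: Elements of $V$ are the variables of $R=\Bbbk[V]$; $R$ is $\mathbb Z^V$-graded, and a subset of $V$ is identified with its indicator vector in $\mathbb Z^V$. For $D\subseteq V$, $m_D=\prod_{v\in D}v$; $\operatorname{supp}(m)$ is the set of variables dividing the monomial $m$. A clutter $C$ on a vertex set is a collection $E(C)$ of nonempty subsets (edges), none contained in another. Its edge ideal is $I(C)=\langle m_e\mid e\in E(C)\rangle$; this gives a bijection between clutters on $V$ and proper squarefree monomial ideals of $\Bbbk[V]$. A vertex cover of a clutter is a subset of its vertex set meeting every edge. The Alexander dual $I^A$ of a squarefree monomial ideal $I$ is the ideal generated by all monomials having a nontrivial common divisor with every monomial in $I$; thus $I(C)^A$ is generated by the $m_D$ with $D$ a vertex cover of $C$ (and $0^A$ is the whole ring). $d(I)$ is the smallest degree of a minimal generator of $I$. An admissible regular sequence for $I$ is a sequence $a_1,\dots,a_d$ of squarefree monomials, $a_j\ne1$, pairwise coprime (equivalently, a regular sequence), with $d=d(I)$ and $a_1,\dots,a_d\in I^A$. First linear strand: let $F_\bullet$ be the minimal $\mathbb Z^V$-graded free resolution of $I$ (with $F_0\to I$ surjective), $F_i=\bigoplus_{\mathbf a}R(-\mathbf a)^{\beta_{i,\mathbf a}}$. The $r$-th linear strand is the complex $F^{<r>}_\bullet$ with $F^{<r>}_i=\bigoplus_{|\mathbf a|=i+r}R(-\mathbf a)^{\beta_{i,\mathbf a}}$ and the induced differentials. The first linear strand is the one with the smallest $r$ for which it is nonzero, i.e. $r=d(I)$. Isomorphisms are of complexes of $\mathbb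 Z^V$-graded $R$-modules. The complex $\mathcal L_\bullet$: let $S=\Bbbk[W]$. A finitely generated $\mathbb N^W$-graded $S$-module $M$ is squarefree if multiplication by $w$ from $M_{\mathbf a}$ to $M_{\mathbf a+\epsilon_w}$ is an isomorphism whenever $a_w\ge1$ (here $\epsilon_w$ is the unit vector of $w$). For such $M$, $\mathcal L_i(M)=\bigoplus_{D\subseteq W,\ |W\setminus D|=i}M_D^\circ\otimes_\Bbbk S$, where $M_D^\circ$ is the vector space $M_D$ placed in multidegree $W\setminus D$; the differential $\mathcal L_i(M)\to\mathcal L_{i-1}(M)$ sends $m^\circ\otimes s$ (with $m\in M_D$) to $\sum_{v\in W\setminus D}(-1)^{\alpha(v,D)}(vm)^\circ\otimes vs$. The shift is $(\mathcal L_\bullet(M)[d])_i=\mathcal L_{i+d}(M)$. Here $\mathfrak a$ and $I(C^c_{|W})^A$ are regarded as ideals of $\Bbbk[W]$ when forming the quotient module $I(C^c_{|W})^A/\mathfrak a$. *)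

theory Defs
  imports
    "HOL-Library.Poly_Mapping"
    "HOL-Algebra.Ideal"
    "HOL-Algebra.Module"
    "HOL-Algebra.AbelCoset"
begin

section \<open>Polynomial rings and monomials\<close>

text \<open>
  A monomial is identified with its exponent vector, so polynomials over the field 'k in variables
  of type 'v are finitely supported functions on exponent vectors, and products come from the
  convolution product of \<^theory>\<open>HOL-Library.Poly_Mapping\<close>.
  For a finite set V of variables, the ring k[V] is carved out as a carrier.
\<close>

type_synonym 'v monom = "'v \<Rightarrow>\<^sub>0 nat"
type_synonym ('v, 'k) mpoly = "('v \<Rightarrow>\<^sub>0 nat) \<Rightarrow>\<^sub>0 'k"

abbreviation expo :: "'v monom \<Rightarrow> 'v \<Rightarrow> nat" where
  "expo t v \<equiv> Poly_Mapping.lookup t v"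

abbreviation supp :: "'v monom \<Rightarrow> 'v set" where
  "supp t \<equiv> Poly_Mapping.keys t"

definition monomial :: "'v monom \<Rightarrow> ('v, 'k::field) mpoly" where
  "monomial t = Poly_Mapping.single t 1"

definition var :: "'v \<Rightarrow> ('v, 'k::field) mpoly" where
  "var v = monomial (Poly_Mapping.single v 1)"

definition vars_prod :: "'v set \<Rightarrow> ('v, 'k::field) mpoly" where
  "vars_prod D = (\<Prod>v\<in>D. var v)"

definition poly_ring :: "'v set \<Rightarrow> ('v, 'k::field) mpoly ring" where
  "poly_ring V = \<lparr>carrier = {p. \<forall>t\<in>Poly_Mapping.keys p. supp t \<subseteq> V},
                  mult = (*), one = 1, zero = 0, add = (+)\<rparr>"

definition mdegree :: "'v monom \<Rightarrow> nat" where
  "mdegree t = (\<Sum>v\<in>supp t. expo t v)"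

definition mdivides :: "'v monom \<Rightarrow> 'v monom \<Rightarrow> bool" where
  "mdivides s t \<longleftrightarrow> (\<forall>v. expo s v \<le> expo t v)"

definition squarefree_monom :: "'v monom \<Rightarrow> bool" where
  "squarefree_monom t \<longleftrightarrow> (\<forall>v. expo t v \<le> 1)"

definition coprime_monom :: "'v monom \<Rightarrow> 'v monom \<Rightarrow> bool" where
  "coprime_monom s t \<longleftrightarrow> (\<forall>c. mdivides c s \<and> mdivides c t \<longrightarrow> c = 0)"

text \<open>Restriction of an exponent vector to the variables in U.\<close>

definition mrestrict :: "'v set \<Rightarrow> 'v monom \<Rightarrow> 'v monom" where
  "mrestrict U t = Poly_Mapping.mapp (\<lambda>v n. if v \<in> U then n else 0) t"

section \<open>Squarefree monomial ideals, clutters and Alexander duality\<close>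

definition squarefree_monomial_ideal :: "'v set \<Rightarrow> ('v, 'k::field) mpoly set \<Rightarrow> bool" where
  "squarefree_monomial_ideal V I \<longleftrightarrow>
     (\<exists>T. (\<forall>t\<in>T. squarefree_monom t \<and> supp t \<subseteq> V) \<and> I = genideal (poly_ring V) (monomial ` T))"

definition clutter :: "'v set \<Rightarrow> 'v set set \<Rightarrow> bool" where
  "clutter V E \<longleftrightarrow> E \<subseteq> Pow V \<and> {} \<notin> E \<and> (\<forall>e\<in>E. \<forall>e'\<in>E. e \<subseteq> e' \<longrightarrow> e = e')"

definition edge_ideal :: "'v set \<Rightarrow> 'v set set \<Rightarrow> ('v, 'k::field) mpoly set" where
  "edge_ideal V E = genideal (poly_ring V) (vars_prod ` E)"

definition vertex_cover :: "'v set \<Rightarrow> 'v set set \<Rightarrow> 'v set \<Rightarrow> bool" where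
  "vertex_cover V E D \<longleftrightarrow> D \<subseteq> V \<and> (\<forall>e\<in>E. e \<inter> D \<noteq> {})"

definition alexander_dual :: "'v set \<Rightarrow> ('v, 'k::field) mpoly set \<Rightarrow> ('v, 'k) mpoly set" where
  "alexander_dual V I = genideal (poly_ring V)
     (monomial ` {t. supp t \<subseteq> V \<and>
        (\<forall>s. (monomial s :: ('v, 'k) mpoly) \<in> I \<longrightarrow> \<not> coprime_monom s t)})"

text \<open>The minimal generators of a monomial ideal are its divisibility-minimal monomials.\<close>

definition minimal_generators :: "('v, 'k::field) mpoly set \<Rightarrow> 'v monom set" where
  "minimal_generators I = {t. (monomial t :: ('v, 'k) mpoly) \<in> I \<and>
     (\<forall>s. (monomial s :: ('v, 'k) mpoly) \<in> I \<and> mdivides s t \<longrightarrow> s = t)}"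

definition initial_degree :: "('v, 'k::field) mpoly set \<Rightarrow> nat" where
  "initial_degree I = (LEAST n. \<exists>t\<in>minimal_generators I. mdegree t = n)"

definition admissible_regular_sequence ::
  "'v set \<Rightarrow> ('v, 'k::field) mpoly set \<Rightarrow> 'v monom list \<Rightarrow> bool" where
  "admissible_regular_sequence V I a \<longleftrightarrow>
     length a = initial_degree I \<and>
     (\<forall>t\<in>set a. squarefree_monom t \<and> t \<noteq> 0 \<and> supp t \<subseteq> V \<and> monomial t \<in> alexander_dual V I) \<and>
     (\<forall>i j. i < j \<and> j < length a \<longrightarrow> coprime_monom (a ! i) (a ! j))"

text \<open>The d-element transversals of the supports of the regular sequence that are not edges in E.\<close>

definition complement_edges :: "'v monom list \<Rightarrow> 'v set set \<Rightarrow> 'v set set" where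
  "complement_edges a E =
     {f ` {..<length a} | f. \<forall>j<length a. f j \<in> supp (a ! j)} - E"

section \<open>Multigraded modules\<close>

text \<open>
  The \<^emph>\<open>mult\<close> and \<^emph>\<open>one\<close> fields that the library's module record inherits play no role for modules.
  Degrees are functions on all of 'v. In all the modules constructed below, the components of
  degrees not supported on the relevant set of variables vanish.
\<close>

record ('r, 'm, 'v) gmodule = "('r, 'm) module" +
  grd :: "('v \<Rightarrow> int) \<Rightarrow> 'm set"

definition mdeg :: "'v monom \<Rightarrow> 'v \<Rightarrow> int" where
  "mdeg t = (\<lambda>v. int (expo t v))"

definition ind :: "'v set \<Rightarrow> 'v \<Rightarrow> int" where
  "ind D = (\<lambda>v. if v \<in> D then 1 else 0)"

definition degrees :: "'v set \<Rightarrow> ('v \<Rightarrow> int) set" where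
  "degrees V = {c. \<forall>v. v \<notin> V \<longrightarrow> c v = 0}"

definition total_degree :: "'v set \<Rightarrow> ('v \<Rightarrow> int) \<Rightarrow> int" where
  "total_degree V c = (\<Sum>v\<in>V. c v)"

definition homogeneous :: "'v set \<Rightarrow> ('v \<Rightarrow> int) \<Rightarrow> ('v, 'k::field) mpoly set" where
  "homogeneous V c = {p \<in> carrier (poly_ring V). \<forall>t\<in>Poly_Mapping.keys p. mdeg t = c}"

definition graded_module ::
  "'v set \<Rightarrow> (('v, 'k::field) mpoly, 'm, 'v) gmodule \<Rightarrow> bool" where
  "graded_module V M \<longleftrightarrow>
     module (poly_ring V) M \<and>
     (\<forall>c. additive_subgroup (grd M c) M) \<and>
     (\<forall>c. c \<notin> degrees V \<longrightarrow> grd M c = {\<zero>\<^bsub>M\<^esub>}) \<and>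
     (\<forall>b c p m. p \<in> homogeneous V b \<and> m \<in> grd M c \<longrightarrow> p \<odot>\<^bsub>M\<^esub> m \<in> grd M (\<lambda>v. b v + c v)) \<and>
     (\<forall>m\<in>carrier M. \<exists>!f. (\<forall>c. f c \<in> grd M c) \<and> finite {c. f c \<noteq> \<zero>\<^bsub>M\<^esub>} \<and>
        m = finsum M f {c. f c \<noteq> \<zero>\<^bsub>M\<^esub>})"

definition finitely_generated ::
  "'v set \<Rightarrow> (('v, 'k::field) mpoly, 'm, 'v) gmodule \<Rightarrow> bool" where
  "finitely_generated V M \<longleftrightarrow>
     (\<exists>G. finite G \<and> G \<subseteq> carrier M \<and>
       (\<forall>m\<in>carrier M. \<exists>c. (\<forall>g\<in>G. c g \<in> carrier (poly_ring V)) \<and>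
          m = finsum M (\<lambda>g. c g \<odot>\<^bsub>M\<^esub> g) G))"

definition squarefree_module ::
  "'v set \<Rightarrow> (('v, 'k::field) mpoly, 'm, 'v) gmodule \<Rightarrow> bool" where
  "squarefree_module W M \<longleftrightarrow>
     graded_module W M \<and> finitely_generated W M \<and>
     (\<forall>c. (\<exists>v. c v < 0) \<longrightarrow> grd M c = {\<zero>\<^bsub>M\<^esub>}) \<and>
     (\<forall>c\<in>degrees W. (\<forall>v. 0 \<le> c v) \<longrightarrow>
        (\<forall>w\<in>W. 1 \<le> c w \<longrightarrow>
           bij_betw (\<lambda>m. var w \<odot>\<^bsub>M\<^esub> m) (grd M c) (grd M (\<lambda>v. c v + ind {w} v))))"

definition graded_hom ::
  "'v set \<Rightarrow> (('v, 'k::field) mpoly, 'm, 'v) gmodule \<Rightarrow> (('v, 'k) mpoly, 'n, 'v) gmodule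
    \<Rightarrow> ('m \<Rightarrow> 'n) \<Rightarrow> bool" where
  "graded_hom V M N f \<longleftrightarrow>
     f \<in> carrier M \<rightarrow> carrier N \<and>
     (\<forall>x\<in>carrier M. \<forall>y\<in>carrier M. f (x \<oplus>\<^bsub>M\<^esub> y) = f x \<oplus>\<^bsub>N\<^esub> f y) \<and>
     (\<forall>p\<in>carrier (poly_ring V). \<forall>x\<in>carrier M. f (p \<odot>\<^bsub>M\<^esub> x) = p \<odot>\<^bsub>N\<^esub> f x) \<and>
     (\<forall>c. f ` grd M c \<subseteq> grd N c)"

definition graded_iso ::
  "'v set \<Rightarrow> (('v, 'k::field) mpoly, 'm, 'v) gmodule \<Rightarrow> (('v, 'k) mpoly, 'n, 'v) gmodule
    \<Rightarrow> ('m \<Rightarrow> 'n) \<Rightarrow> bool" where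
  "graded_iso V M N f \<longleftrightarrow>
     graded_hom V M N f \<and> bij_betw f (carrier M) (carrier N) \<and> (\<forall>c. f ` grd M c = grd N c)"

definition ideal_module ::
  "'v set \<Rightarrow> ('v, 'k::field) mpoly set \<Rightarrow> (('v, 'k) mpoly, ('v, 'k) mpoly, 'v) gmodule" where
  "ideal_module V J = \<lparr>carrier = J, mult = undefined, one = undefined, zero = 0, add = (+),
     smult = (*), grd = (\<lambda>c. J \<inter> homogeneous V c)\<rparr>"

definition quotient_module ::
  "('r, 'm, 'v) gmodule \<Rightarrow> 'm set \<Rightarrow> ('r, 'm set, 'v) gmodule" where
  "quotient_module M P = \<lparr>carrier = a_rcosets\<^bsub>M\<^esub> P, mult = undefined, one = undefined,
     zero = P, add = (\<lambda>X Y. X <+>\<^bsub>M\<^esub> Y),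
     smult = (\<lambda>p X. \<Union>x\<in>X. P +>\<^bsub>M\<^esub> (p \<odot>\<^bsub>M\<^esub> x)),
     grd = (\<lambda>c. (\<lambda>x. P +>\<^bsub>M\<^esub> x) ` grd M c)\<rparr>"

text \<open>The direct sum of a family of modules, whose elements are extensional functions on A.\<close>

definition direct_sum ::
  "'i set \<Rightarrow> ('i \<Rightarrow> ('r, 'm, 'v) gmodule) \<Rightarrow> ('r, 'i \<Rightarrow> 'm, 'v) gmodule" where
  "direct_sum A N = (let X = {f \<in> (\<Pi>\<^sub>E i\<in>A. carrier (N i)). finite {i\<in>A. f i \<noteq> \<zero>\<^bsub>N i\<^esub>}} in
     \<lparr>carrier = X, mult = undefined, one = undefined,
      zero = (\<lambda>i\<in>A. \<zero>\<^bsub>N i\<^esub>),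
      add = (\<lambda>f g. \<lambda>i\<in>A. f i \<oplus>\<^bsub>N i\<^esub> g i),
      smult = (\<lambda>p f. \<lambda>i\<in>A. p \<odot>\<^bsub>N i\<^esub> f i),
      grd = (\<lambda>c. {f \<in> X. \<forall>i\<in>A. f i \<in> grd (N i) c})\<rparr>)"

text \<open>The shifted ring R(-a) for R = k[V].\<close>

definition shifted_ring ::
  "'v set \<Rightarrow> ('v \<Rightarrow> int) \<Rightarrow> (('v, 'k::field) mpoly, ('v, 'k) mpoly, 'v) gmodule" where
  "shifted_ring V a = \<lparr>carrier = carrier (poly_ring V), mult = undefined, one = undefined,
     zero = 0, add = (+), smult = (*), grd = (\<lambda>c. homogeneous V (\<lambda>v. c v - a v))\<rparr>"

text \<open>
  Extension of scalars from k[U] to k[V], where U is a subset of V. As k[V] is free over k[U] on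
  the monomials u in V - U, the tensor product of N with k[V] over k[U] is the direct sum of copies
  of N indexed by these monomials; f stands for the sum over u of f(u) \<^emph>\<open>tensor\<close> u.
  A monomial t in V splits as the product of its restrictions to U and V - U; the first acts on
  N, the second multiplies u. For U empty, k[U] is the field itself and this is the tensor
  product of a vector space with k[V].
\<close>

definition extend_scalars ::
  "'v set \<Rightarrow> 'v set \<Rightarrow> (('v, 'k::field) mpoly, 'n, 'v) gmodule
    \<Rightarrow> (('v, 'k) mpoly, 'v monom \<Rightarrow> 'n, 'v) gmodule" where
  "extend_scalars U V N = (let X = {f. (\<forall>u. f u \<in> carrier N) \<and> finite {u. f u \<noteq> \<zero>\<^bsub>N\<^esub>} \<and>
                                       (\<forall>u. f u \<noteq> \<zero>\<^bsub>N\<^esub> \<longrightarrow> supp u \<subseteq> V - U)} in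
     \<lparr>carrier = X, mult = undefined, one = undefined,
      zero = (\<lambda>u. \<zero>\<^bsub>N\<^esub>),
      add = (\<lambda>f g u. f u \<oplus>\<^bsub>N\<^esub> g u),
      smult = (\<lambda>p f u. finsum N
        (\<lambda>t. Poly_Mapping.single (mrestrict U t) (Poly_Mapping.lookup p t)
               \<odot>\<^bsub>N\<^esub> f (u - mrestrict (V - U) t))
        {t \<in> Poly_Mapping.keys p. mdivides (mrestrict (V - U) t) u}),
      grd = (\<lambda>c. {f \<in> X. \<forall>u. f u \<in> grd N (\<lambda>v. c v - mdeg u v)})\<rparr>)"

section \<open>Complexes\<close>

text \<open>Complexes are indexed by the integers; \<^emph>\<open>diff C i\<close> maps \<^emph>\<open>obj C i\<close> to \<^emph>\<open>obj C (i - 1)\<close>.\<close>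

record ('r, 'm, 'v) gcomplex =
  obj :: "int \<Rightarrow> ('r, 'm, 'v) gmodule"
  diff :: "int \<Rightarrow> 'm \<Rightarrow> 'm"

definition complex_iso ::
  "'v set \<Rightarrow> (('v, 'k::field) mpoly, 'm, 'v) gcomplex \<Rightarrow> (('v, 'k) mpoly, 'n, 'v) gcomplex \<Rightarrow> bool"
  where
  "complex_iso V C C' \<longleftrightarrow>
     (\<exists>\<phi>. \<forall>i. graded_iso V (obj C i) (obj C' i) (\<phi> i) \<and>
        (\<forall>x\<in>carrier (obj C i). \<phi> (i - 1) (diff C i x) = diff C' i (\<phi> i x)))"

definition shift_complex :: "int \<Rightarrow> ('r, 'm, 'v) gcomplex \<Rightarrow> ('r, 'm, 'v) gcomplex" where
  "shift_complex d C = \<lparr>obj = (\<lambda>i. obj C (i + d)), diff = (\<lambda>i. diff C (i + d))\<rparr>"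

definition extend_complex ::
  "'v set \<Rightarrow> 'v set \<Rightarrow> (('v, 'k::field) mpoly, 'n, 'v) gcomplex
    \<Rightarrow> (('v, 'k) mpoly, 'v monom \<Rightarrow> 'n, 'v) gcomplex" where
  "extend_complex U V C = \<lparr>obj = (\<lambda>i. extend_scalars U V (obj C i)),
                           diff = (\<lambda>i f u. diff C i (f u))\<rparr>"

section \<open>Minimal free resolutions and linear strands\<close>

text \<open>
  A complex of graded free modules of finite rank, with chosen decompositions into shifted rings
  indexed by \<^emph>\<open>gens F i\<close>, the generator b having degree \<^emph>\<open>gdeg F i b\<close>.
\<close>

record ('r, 'b, 'v) free_complex =
  gens :: "int \<Rightarrow> 'b set"
  gdeg :: "int \<Rightarrow> 'b \<Rightarrow> 'v \<Rightarrow> int"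
  fdiff :: "int \<Rightarrow> ('b \<Rightarrow> 'r) \<Rightarrow> 'b \<Rightarrow> 'r"

definition free_obj ::
  "'v set \<Rightarrow> (('v, 'k::field) mpoly, 'b, 'v) free_complex \<Rightarrow> int
    \<Rightarrow> (('v, 'k) mpoly, 'b \<Rightarrow> ('v, 'k) mpoly, 'v) gmodule" where
  "free_obj V F i = direct_sum (gens F i) (\<lambda>b. shifted_ring V (gdeg F i b))"

definition underlying_complex ::
  "'v set \<Rightarrow> (('v, 'k::field) mpoly, 'b, 'v) free_complex
    \<Rightarrow> (('v, 'k) mpoly, 'b \<Rightarrow> ('v, 'k) mpoly, 'v) gcomplex" where
  "underlying_complex V F = \<lparr>obj = free_obj V F, diff = fdiff F\<rparr>"

definition minimal_free_resolution ::
  "'v set \<Rightarrow> ('v, 'k::field) mpoly set \<Rightarrow> (('v, 'k) mpoly, 'b, 'v) free_complex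
    \<Rightarrow> (('b \<Rightarrow> ('v, 'k) mpoly) \<Rightarrow> ('v, 'k) mpoly) \<Rightarrow> bool" where
  "minimal_free_resolution V I F aug \<longleftrightarrow>
     (\<forall>i. finite (gens F i) \<and> (\<forall>b\<in>gens F i. gdeg F i b \<in> degrees V)) \<and>
     (\<forall>i<0. gens F i = {}) \<and>
     (\<forall>i. graded_hom V (free_obj V F i) (free_obj V F (i - 1)) (fdiff F i)) \<and>
     graded_hom V (free_obj V F 0) (ideal_module V I) aug \<and>
     aug ` carrier (free_obj V F 0) = I \<and>
     {x \<in> carrier (free_obj V F 0). aug x = 0} = fdiff F 1 ` carrier (free_obj V F 1) \<and>
     (\<forall>i\<ge>1. {x \<in> carrier (free_obj V F i). fdiff F i x = \<zero>\<^bsub>free_obj V F (i - 1)\<^esub>}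
              = fdiff F (i + 1) ` carrier (free_obj V F (i + 1))) \<and>
     (\<forall>i. \<forall>x\<in>carrier (free_obj V F i). \<forall>b\<in>gens F (i - 1).
        fdiff F i x b \<in> genideal (poly_ring V) (var ` V))"

text \<open>
  The r-th linear strand; its differential is the one of F composed with the inclusion (extension
  by zero) of and the projection (restriction) onto the respective direct summands.
\<close>

definition strand_gens :: "'v set \<Rightarrow> ('r, 'b, 'v) free_complex \<Rightarrow> int \<Rightarrow> int \<Rightarrow> 'b set" where
  "strand_gens V F r i = {b \<in> gens F i. total_degree V (gdeg F i b) = i + r}"

definition linear_strand ::
  "'v set \<Rightarrow> (('v, 'k::field) mpoly, 'b, 'v) free_complex \<Rightarrow> int \<Rightarrow> (('v, 'k) mpoly, 'b, 'v) free_complex" where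
  "linear_strand V F r = \<lparr>
     gens = strand_gens V F r,
     gdeg = gdeg F,
     fdiff = (\<lambda>i x. restrict
       (fdiff F i (\<lambda>b\<in>gens F i. if b \<in> strand_gens V F r i then x b else 0))
       (strand_gens V F r (i - 1)))\<rparr>"

definition first_linear_strand ::
  "'v set \<Rightarrow> (('v, 'k::field) mpoly, 'b, 'v) free_complex \<Rightarrow> (('v, 'k) mpoly, 'b, 'v) free_complex" where
  "first_linear_strand V F = linear_strand V F (LEAST r. \<exists>i. strand_gens V F r i \<noteq> {})"

section \<open>The complex of a squarefree module\<close>

definition alpha :: "('v \<times> 'v) set \<Rightarrow> 'v \<Rightarrow> 'v set \<Rightarrow> nat" where
  "alpha r v D = card {w \<in> D. (w, v) \<in> r}"

text \<open>The component of degree D of M as a vector space (a module over k[{}]), placed in degree W - D.\<close>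

definition degree_part ::
  "'v set \<Rightarrow> (('v, 'k::field) mpoly, 'm, 'v) gmodule \<Rightarrow> 'v set
    \<Rightarrow> (('v, 'k) mpoly, 'm, 'v) gmodule" where
  "degree_part W M D = M\<lparr>carrier := grd M (ind D),
     grd := (\<lambda>c. if c = ind (W - D) then grd M (ind D) else {\<zero>\<^bsub>M\<^esub>})\<rparr>"

text \<open>
  The map sending m \<^emph>\<open>tensor\<close> s to vm \<^emph>\<open>tensor\<close> vs, in terms of coefficients of monomials.
\<close>

definition mult_both ::
  "(('v, 'k::field) mpoly, 'm, 'v) gmodule \<Rightarrow> 'v \<Rightarrow> ('v monom \<Rightarrow> 'm) \<Rightarrow> 'v monom \<Rightarrow> 'm" where
  "mult_both M v f u =
     (if 1 \<le> expo u v then var v \<odot>\<^bsub>M\<^esub> f (u - Poly_Mapping.single v 1) else \<zero>\<^bsub>M\<^esub>)"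

text \<open>
  The component at D' of the differential collects the contributions of the pairs (D, v) with
  v in W - D and D' = D together with v, that is, v in D' and D = D' - {v}.
\<close>

definition L_complex ::
  "('v \<times> 'v) set \<Rightarrow> 'v set \<Rightarrow> (('v, 'k::field) mpoly, 'm, 'v) gmodule
    \<Rightarrow> (('v, 'k) mpoly, 'v set \<Rightarrow> 'v monom \<Rightarrow> 'm, 'v) gcomplex" where
  "L_complex r W M = \<lparr>
     obj = (\<lambda>i. direct_sum {D. D \<subseteq> W \<and> int (card (W - D)) = i}
                  (\<lambda>D. extend_scalars {} W (degree_part W M D))),
     diff = (\<lambda>i x. \<lambda>D'\<in>{D. D \<subseteq> W \<and> int (card (W - D)) = i - 1}. \<lambda>u.
       finsum M (\<lambda>v. (- 1) ^ alpha r v (D' - {v}) \<odot>\<^bsub>M\<^esub> mult_both M v (x (D' - {v})) u) D')\<rparr>"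

section \<open>The explicit complex\<close>

text \<open>
  Here K is the edge set of the clutter on W whose vertex covers are considered, A is the ideal
  generated by the regular sequence, and d is the length of the latter.
  A family x stands for the sum of the x(D) times the free generators \<^emph>\<open>e\<close>(D).
\<close>

definition explicit_complex ::
  "('v \<times> 'v) set \<Rightarrow> 'v set \<Rightarrow> 'v set set \<Rightarrow> ('v, 'k::field) mpoly set \<Rightarrow> nat
    \<Rightarrow> (('v, 'k) mpoly, 'v set, 'v) free_complex" where
  "explicit_complex r W K A d = (let
     G = (\<lambda>i::int. {D. vertex_cover W K D \<and> int (card D) = int (card W) - i - int d \<and>
                       vars_prod D \<notin> A});
     e = (\<lambda>D D'. if D' = D then 1 else 0)
   in \<lparr>
     gens = G,
     gdeg = (\<lambda>i D. ind (W - D)),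
     fdiff = (\<lambda>i x. \<lambda>D'\<in>G (i - 1). \<Sum>D\<in>G i. x D *
       (\<Sum>v | v \<in> W - D \<and> vars_prod (insert v D) \<notin> A.
          (- 1) ^ alpha r v D * var v * e (insert v D) D'))\<rparr>)"

end

theory Submission
  imports Defs
begin

text \<open>
  A generator of the explicit complex has degree U = W - D, where U meets the support of every member
  of the regular sequence and all transversals contained in U are edges of C. The combinatorial core
  is that a homogeneous cycle of degree c on the generators with d + n elements, where c has total
  degree d + n + 1, vanishes unless c is the indicator of such a set with d + n + 1 elements,
  and then it is a multiple of the boundary of that generator.

  In a minimal multigraded resolution of I the generators in homological degree n have total degree
  at least d + n, because the differential strictly lowers degrees, and those of total degree d + n
  are matched with the cycles of total degree d + n in the previous step of the linear strand. By
  induction the first linear strand and the explicit complex have the same generators, and their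
  differentials agree after rescaling the generators.

  The component of degree D of the quotient of the dual ideal is one-dimensional if D is a vertex
  cover with no support of the sequence inside, and zero otherwise; this
  identifies the explicit complex with the complex of the squarefree module.
\<close>

section \<open>Transversal vertex sets and their linear syzygies\<close>

text \<open>Split into its \<open>d\<close> parts, a set \<open>U\<close> meeting every support is a
  cell of dimension \<open>|U| - d\<close> of a product of \<open>d\<close> simplices: the
  transversals are the vertices, and deleting an element without emptying a part gives a facet. Up
  to signs \<open>ldiff\<close> is the cellular boundary, and the generators of the explicit complex
  are the cells all of whose vertices are edges of C. That a cycle on the facets of a cell is a
  multiple of its boundary reflects that this boundary is a sphere; it is shown by hand, passing
  coefficients between facets with a common face. The cells with vertices in C need not form an
  acyclic complex; hence the comparison is confined to cycles one total degree above the generators.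
  The prescribed signs refer to the complement \<open>W - U\<close> and ignore the parts. At the
  bottom, where the map to I takes the place of the differential, a correcting sign for transversals
  is therefore required. The resolution being arbitrary, its differentials are known only up to
  scalars, which are chosen inductively together with the correspondence of cycles.\<close>

text \<open>
  The set D of vertices indexing a generator of the explicit complex is replaced by its complement
  U = W - D, which is the degree of the generator. The function pt maps a vertex to the
  position of the member of the regular sequence that it divides.
\<close>

locale transversal_clutter =
  fixes V W :: "'v set" and d :: nat and pt :: "'v \<Rightarrow> nat" and Q :: "'v set set"
    and r :: "('v \<times> 'v) set"
  assumes finV: "finite V" and WV: "W \<subseteq> V"
    and pt_less: "v \<in> W \<Longrightarrow> pt v < d"
    and irrefl_r: "v \<in> V \<Longrightarrow> (v, v) \<notin> r"
    and asym_r: "(u, v) \<in> r \<Longrightarrow> (v, u) \<notin> r"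
    and total_r: "u \<in> V \<Longrightarrow> v \<in> V \<Longrightarrow> u \<noteq> v \<Longrightarrow> (u, v) \<in> r \<or> (v, u) \<in> r"
begin

definition hits :: "'v set \<Rightarrow> bool" where
  "hits U \<longleftrightarrow> U \<subseteq> W \<and> (\<forall>j<d. \<exists>u\<in>U. pt u = j)"

definition adm :: "'v set \<Rightarrow> bool" where
  "adm U \<longleftrightarrow> hits U \<and> (\<forall>T\<subseteq>U. hits T \<and> card T = d \<longrightarrow> T \<in> Q)"

definition lgens :: "nat \<Rightarrow> 'v set set" where
  "lgens n = {U. adm U \<and> card U = n + d}"

text \<open>With \<open>D = W - U\<close> this is the sign of the theorem: putting \<open>v\<close>
  into \<open>D\<close> is removing it from \<open>U\<close>.\<close>

definition sg :: "'v \<Rightarrow> 'v set \<Rightarrow> 'k::field" where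
  "sg v U = (- 1) ^ alpha r v (W - U)"

text \<open>The coefficient at U' of the differential of the generator U.\<close>

definition ldiff :: "'v set \<Rightarrow> 'v set \<Rightarrow> 'k::field" where
  "ldiff U U' = (\<Sum>v\<in>U. if U' = U - {v} then sg v U else 0)"

text \<open>The first summand adds up the positions of the elements of \<open>T\<close> in
  \<open>W\<close>; it turns counts in the complement, as in \<open>sg\<close>, into counts in the
  set itself. The second counts the inversions between the order of the parts and the order
  \<open>r\<close>, comparing the two resulting orientations.\<close>

definition transversal_exponent :: "'v set \<Rightarrow> nat" where
  "transversal_exponent T =
     (\<Sum>t\<in>T. card {z\<in>W. (z, t) \<in> r} + card {x\<in>T. pt x < pt t \<and> (t, x) \<in> r})"

text \<open>
  The signs for which sending the generator of a transversal T to the corresponding multiple of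
  its monomial kills all boundaries.
\<close>

definition transversal_sign :: "'v set \<Rightarrow> 'k::field" where
  "transversal_sign T = (- 1) ^ transversal_exponent T"

text \<open>At \<open>n = 0\<close> the map to the ideal replaces the differential; in a fixed
  multidegree it is a single scalar equation.\<close>

definition lcycle :: "nat \<Rightarrow> ('v set \<Rightarrow> 'k::field) \<Rightarrow> bool" where
  "lcycle n \<kappa> = (case n of 0 \<Rightarrow> (\<Sum>U\<in>lgens 0. \<kappa> U * transversal_sign U) = 0
     | Suc m \<Rightarrow> \<forall>U'\<in>lgens m. (\<Sum>U\<in>lgens (Suc m). \<kappa> U * ldiff U U') = 0)"

lemma finW: "finite W"
  using finV WV finite_subset by blast

lemma hits_subset: "hits U \<Longrightarrow> U \<subseteq> W"
  by (simp add: hits_def)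

lemma hits_finite: "hits U \<Longrightarrow> finite U"
  using finW finite_subset hits_subset by blast

lemma hits_mono: "hits U \<Longrightarrow> U \<subseteq> U' \<Longrightarrow> U' \<subseteq> W \<Longrightarrow> hits U'"
  unfolding hits_def by blast

lemma adm_hits: "adm U \<Longrightarrow> hits U"
  by (simp add: adm_def)

lemma adm_subset: "adm U \<Longrightarrow> U' \<subseteq> U \<Longrightarrow> hits U' \<Longrightarrow> adm U'"
  unfolding adm_def by blast

lemma lgens_D:
  assumes "U \<in> lgens n"
  shows "adm U" "hits U" "U \<subseteq> W" "finite U" "card U = n + d"
  using assms adm_hits hits_subset hits_finite by (auto simp: lgens_def)

lemma finite_lgens: "finite (lgens n)"
  by (rule finite_subset[of _ "Pow W"]) (auto simp: finW dest: lgens_D)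

lemma hits_image: "hits U \<Longrightarrow> pt ` U = {..<d}"
  using pt_less by (force simp: hits_def)

lemma hits_collision:
  assumes "hits U" "card U > d"
  obtains x x' where "x \<in> U" "x' \<in> U" "x \<noteq> x'" "pt x = pt x'"
proof -
  have "\<not> inj_on pt U"
    using card_image[of pt U] assms hits_image[OF assms(1)] by auto
  then show ?thesis
    using that by (auto simp: inj_on_def)
qed

lemma hits_inj:
  assumes "hits U" "card U = d"
  shows "inj_on pt U"
  using assms hits_image[OF assms(1)] hits_finite[OF assms(1)] by (simp add: eq_card_imp_inj_on)

lemma hits_remove:
  assumes "hits U" "x \<in> U" "x' \<in> U" "x \<noteq> x'" "pt x = pt x'"
  shows "hits (U - {x})"
  unfolding hits_def
proof (intro conjI allI impI)
  show "U - {x} \<subseteq> W" using assms(1) by (auto simp: hits_def)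
  fix j assume "j < d"
  then obtain u where "u \<in> U" "pt u = j" using assms(1) by (auto simp: hits_def)
  then show "\<exists>u\<in>U - {x}. pt u = j"
    using assms by (cases "u = x") auto
qed

lemma hits_remove_partner:
  assumes "hits (U - {v})" "v \<in> U" "v \<in> W"
  obtains x where "x \<in> U" "x \<noteq> v" "pt x = pt v"
  using assms pt_less[of v] by (auto simp: hits_def)

lemma sg_nonzero: "sg v U \<noteq> (0::'k::field)"
  by (simp add: sg_def)

lemma sg_square: "sg v U * sg v U = (1::'k::field)"
  by (simp add: sg_def flip: power_mult_distrib)

lemma transversal_sign_nonzero: "transversal_sign T \<noteq> (0::'k::field)"
  by (simp add: transversal_sign_def)

lemma ldiff_remove: "finite U \<Longrightarrow> v \<in> U \<Longrightarrow> ldiff U (U - {v}) = sg v U"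
proof -
  assume "finite U" "v \<in> U"
  have "ldiff U (U - {v}) = (\<Sum>x\<in>U. if x = v then sg x U else 0)"
    unfolding ldiff_def using \<open>v \<in> U\<close> by (intro sum.cong) auto
  then show ?thesis using \<open>finite U\<close> \<open>v \<in> U\<close> by simp
qed

lemma ldiff_nonzero:
  assumes "ldiff U U' \<noteq> (0::'k::field)"
  obtains v where "v \<in> U" "U' = U - {v}"
proof -
  have "\<exists>v\<in>U. U' = U - {v}"
    using assms by (rule contrapos_np) (simp add: ldiff_def)
  then show ?thesis using that by blast
qed

lemma alpha_remove:
  assumes "U \<subseteq> W" "v \<in> U" "x \<in> U" "x \<noteq> v"
  shows "alpha r x (W - (U - {v})) = alpha r x (W - U) + (if (v, x) \<in> r then 1 else 0)"
proof -
  have "{w \<in> W - (U - {v}). (w, x) \<in> r} = {w \<in> W - U. (w, x) \<in> r} \<union> (if (v, x) \<in> r then {v} else {})"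
    using assms by auto
  then show ?thesis
    unfolding alpha_def using assms finW by (auto simp: card_insert_if)
qed

text \<open>Moving \<open>v\<close> into the complement raises \<open>alpha\<close> at
  \<open>x\<close> exactly when \<open>v\<close> precedes \<open>x\<close>, so exactly one of the
  two products changes sign. This is why two successive differentials cancel.\<close>

lemma sg_anticommute:
  assumes "U \<subseteq> W" "v \<in> U" "x \<in> U" "x \<noteq> v"
  shows "sg v U * sg x (U - {v}) + sg x U * sg v (U - {x}) = (0::'k::field)"
proof -
  have "(v, x) \<in> r \<and> (x, v) \<notin> r \<or> (x, v) \<in> r \<and> (v, x) \<notin> r"
    using total_r[of x v] asym_r assms WV by blast
  then show ?thesis
    using alpha_remove[OF assms] alpha_remove[of U x v] assms
    by (auto simp: sg_def power_add)
qed

text \<open>Here \<open>v'\<close> is meant to be a second vertex in the part of \<open>v\<close>.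
  Modulo 2 the left side sees \<open>v\<close> only through its order relative to \<open>v'\<close>
  and its part: inversions of \<open>v\<close> with later parts are counted twice, once in the
  position of \<open>v\<close> and once as inversions, and an element of an earlier part counts once
  whichever side of \<open>v\<close> it is on.\<close>

lemma transversal_exponent_insert:
  assumes "finite S" "v \<notin> S" "S \<subseteq> W" "v \<in> W" "\<forall>x\<in>S. pt x \<noteq> pt v"
    and "v' \<in> W" "v' \<notin> S" "v' \<noteq> v"
  obtains m where "transversal_exponent (insert v S) + alpha r v (W - insert v' (insert v S)) =
    2 * m + (if (v', v) \<in> r then 1 else 0) + card {x\<in>S. pt x < pt v} + transversal_exponent S"
proof -
  let ?c2 = "card {t\<in>S. pt v < pt t \<and> (t, v) \<in> r}"
  have "(\<Sum>t\<in>S. card {z\<in>W. (z, t) \<in> r} + card {x\<in>insert v S. pt x < pt t \<and> (t, x) \<in> r}) =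
    (\<Sum>t\<in>S. (card {z\<in>W. (z, t) \<in> r} + card {x\<in>S. pt x < pt t \<and> (t, x) \<in> r})
       + (if pt v < pt t \<and> (t, v) \<in> r then 1 else 0))"
  proof (rule sum.cong)
    fix t
    have "{x\<in>insert v S. pt x < pt t \<and> (t, x) \<in> r} =
      {x\<in>S. pt x < pt t \<and> (t, x) \<in> r} \<union> (if pt v < pt t \<and> (t, v) \<in> r then {v} else {})"
      by auto
    then have "card {x\<in>insert v S. pt x < pt t \<and> (t, x) \<in> r} =
      card {x\<in>S. pt x < pt t \<and> (t, x) \<in> r} + (if pt v < pt t \<and> (t, v) \<in> r then 1 else 0)"
      using assms by (auto simp: card_insert_if)
    then show "card {z\<in>W. (z, t) \<in> r} + card {x\<in>insert v S. pt x < pt t \<and> (t, x) \<in> r} =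
      (card {z\<in>W. (z, t) \<in> r} + card {x\<in>S. pt x < pt t \<and> (t, x) \<in> r})
       + (if pt v < pt t \<and> (t, v) \<in> r then 1 else 0)" by simp
  qed simp
  also have "\<dots> = transversal_exponent S + ?c2"
    using assms(1) by (simp add: transversal_exponent_def sum.distrib sum.If_cases Int_def)
  finally have 1: "transversal_exponent (insert v S) =
    card {z\<in>W. (z, v) \<in> r} + card {x\<in>insert v S. pt x < pt v \<and> (v, x) \<in> r} + transversal_exponent S + ?c2"
    using assms by (simp add: transversal_exponent_def)
  \<comment> \<open>The predecessors of \<open>v\<close> fall into four disjoint pieces: outside the
    cell, in earlier parts of \<open>S\<close>, in later parts of \<open>S\<close>, and
    \<open>v'\<close>; no element of \<open>S\<close> lies in the part of \<open>v\<close>.\<close>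
  have 2: "card {z\<in>W. (z, v) \<in> r} = alpha r v (W - insert v' (insert v S))
    + card {z\<in>S. pt z < pt v \<and> (z, v) \<in> r} + ?c2 + (if (v', v) \<in> r then 1 else 0)"
  proof -
    have "{z\<in>W. (z, v) \<in> r} = {w \<in> W - insert v' (insert v S). (w, v) \<in> r} \<union>
      ({z\<in>S. pt z < pt v \<and> (z, v) \<in> r} \<union> ({t\<in>S. pt v < pt t \<and> (t, v) \<in> r} \<union>
        (if (v', v) \<in> r then {v'} else {})))" (is "_ = ?A \<union> (?B \<union> (?C \<union> ?D))")
      using assms irrefl_r WV by (auto simp: not_less_iff_gr_or_eq)
    moreover have "card (?A \<union> (?B \<union> (?C \<union> ?D))) = card ?A + card (?B \<union> (?C \<union> ?D))"
      using assms finW by (intro card_Un_disjoint) auto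
    moreover have "card (?B \<union> (?C \<union> ?D)) = card ?B + card (?C \<union> ?D)"
      using assms finW by (intro card_Un_disjoint) auto
    moreover have "card (?C \<union> ?D) = card ?C + card ?D"
      using assms finW by (intro card_Un_disjoint) auto
    ultimately show ?thesis by (simp add: alpha_def)
  qed
  have "{x\<in>insert v S. pt x < pt v \<and> (v, x) \<in> r} = {x\<in>S. pt x < pt v \<and> (v, x) \<in> r}"
    by auto
  moreover have "card {z\<in>S. pt z < pt v \<and> (z, v) \<in> r} + card {x\<in>S. pt x < pt v \<and> (v, x) \<in> r}
    = card {x\<in>S. pt x < pt v}"
  proof -
    have "{x\<in>S. pt x < pt v} = {z\<in>S. pt z < pt v \<and> (z, v) \<in> r} \<union> {x\<in>S. pt x < pt v \<and> (v, x) \<in> r}"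
      using total_r assms WV by blast
    moreover have "{z\<in>S. pt z < pt v \<and> (z, v) \<in> r} \<inter> {x\<in>S. pt x < pt v \<and> (v, x) \<in> r} = {}"
      using asym_r by blast
    ultimately show ?thesis
      using assms(1) by (simp add: card_Un_disjoint)
  qed
  ultimately show ?thesis
    using 1 2 that[of "alpha r v (W - insert v' (insert v S)) + ?c2"] by simp
qed

text \<open>\<open>U\<close> is a one-dimensional cell with end points \<open>U - {v}\<close> and
  \<open>U - {x}\<close>, and the signed augmentation kills its boundary. Exchanging
  \<open>v\<close> and \<open>x\<close> within their part alters the parity of the exponents by
  exactly one.\<close>

lemma transversal_sign_compat:
  assumes "U \<subseteq> W" "v \<in> U" "x \<in> U" "x \<noteq> v" "pt x = pt v" "inj_on pt (U - {v})"
  shows "transversal_sign (U - {v}) * sg v U + transversal_sign (U - {x}) * sg x U = (0::'k::field)"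
proof -
  define S where "S = U - {v} - {x}"
  have U: "U - {v} = insert x S" "U - {x} = insert v S" "U = insert x (insert v S)"
    using assms by (auto simp: S_def)
  have fin: "finite S" using assms finW finite_subset by (auto simp: S_def)
  have S: "\<forall>y\<in>S. pt y \<noteq> pt v" "\<forall>y\<in>S. pt y \<noteq> pt x"
    using assms by (auto simp: S_def inj_on_def)
  have mem: "v \<in> W" "x \<in> W" "v \<notin> S" "x \<notin> S" "S \<subseteq> W" using assms by (auto simp: S_def)
  have U': "W - insert x (insert v S) = W - U" "W - insert v (insert x S) = W - U"
    using U(3) by auto
  obtain m where m: "transversal_exponent (insert v S) + alpha r v (W - U) =
    2 * m + (if (x, v) \<in> r then 1 else 0) + card {y\<in>S. pt y < pt v} + transversal_exponent S"
    using transversal_exponent_insert[OF fin mem(3,5,1) S(1) mem(2,4) assms(4)]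
    unfolding U' by blast
  obtain k where k: "transversal_exponent (insert x S) + alpha r x (W - U) =
    2 * k + (if (v, x) \<in> r then 1 else 0) + card {y\<in>S. pt y < pt x} + transversal_exponent S"
    using transversal_exponent_insert[OF fin mem(4,5,2) S(2) mem(1,3) assms(4)[symmetric]]
    unfolding U' by blast
  have ord: "(v, x) \<in> r \<and> (x, v) \<notin> r \<or> (x, v) \<in> r \<and> (v, x) \<notin> r"
    using total_r[of x v] asym_r assms WV by blast
  \<comment> \<open>Removing \<open>v\<close> leaves \<open>insert x S\<close>, so the exponent for
    \<open>x\<close> meets the \<open>alpha\<close> of \<open>v\<close> and conversely. The terms
    \<open>c\<close> and \<open>e\<close> agree in both equations because \<open>v\<close> and
    \<open>x\<close> share a part.\<close>
  have parity: "odd (b + a' + (a + b'))" if "a + a' = 2 * m + i + c + e" "b + b' = 2 * k + j + c + e"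
    "i + j = 1" for a a' b b' c e i j m k :: nat
  proof -
    have "b + a' + (a + b') = (a + a') + (b + b')"
      by simp
    also have "\<dots> = 2 * (m + k + c + e) + (i + j)"
      unfolding that(1,2) by simp
    finally have "b + a' + (a + b') = 2 * (m + k + c + e) + 1"
      using that(3) by simp
    then show ?thesis by simp
  qed
  have "(if (x, v) \<in> r then 1 else 0) + (if (v, x) \<in> r then 1 else 0) = (1::nat)"
    using ord by auto
  then have "odd ((transversal_exponent (insert x S) + alpha r v (W - U)) +
    (transversal_exponent (insert v S) + alpha r x (W - U)))"
    using parity[OF m k[unfolded assms(5)]] by simp
  then have "(- 1 :: 'k) ^ (transversal_exponent (insert x S) + alpha r v (W - U)) +
    (- 1) ^ (transversal_exponent (insert v S) + alpha r x (W - U)) = 0"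
    by (cases "even (transversal_exponent (insert x S) + alpha r v (W - U))") simp_all
  then show ?thesis
    unfolding transversal_sign_def sg_def U(1,2) power_add .
qed

text \<open>Removing one vertex of a colliding pair leaves a transversal. A third vertex cannot be
  removed, since its part contains no second vertex.\<close>

lemma exactly_one_part_doubled:
  assumes "hits U" "card U = Suc d"
  obtains x x' where "x \<in> U" "x' \<in> U" "x \<noteq> x'" "pt x = pt x'" "inj_on pt (U - {x})"
    "hits (U - {x})" "hits (U - {x'})" "\<And>v. v \<in> U \<Longrightarrow> hits (U - {v}) \<Longrightarrow> v = x \<or> v = x'"
proof -
  obtain x x' where x: "x \<in> U" "x' \<in> U" "x \<noteq> x'" "pt x = pt x'"
    using hits_collision[OF assms(1)] assms(2) by auto
  have h: "hits (U - {x})" "hits (U - {x'})"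
    using hits_remove[OF assms(1)] x by metis+
  have i: "inj_on pt (U - {x})"
    using hits_inj[OF h(1)] x assms hits_finite[OF assms(1)] by simp
  have "v = x \<or> v = x'" if v: "v \<in> U" "hits (U - {v})" for v
  proof (rule ccontr)
    assume n: "\<not> (v = x \<or> v = x')"
    obtain y where y: "y \<in> U" "y \<noteq> v" "pt y = pt v"
      using hits_remove_partner[OF v(2) v(1)] assms v hits_subset by blast
    then have "y = x" using i v n y by (auto simp: inj_on_def)
    then have "pt v = pt x'" using y x by simp
    then show False using i v n x by (auto simp: inj_on_def)
  qed
  then show ?thesis using that x h i by blast
qed

lemma lgens_SucD:
  assumes "U \<in> lgens (Suc n)" "v \<in> U" "hits (U - {v})"
  shows "U - {v} \<in> lgens n"
  using adm_subset[of U "U - {v}"] lgens_D[OF assms(1)] assms by (auto simp: lgens_def)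

text \<open>This makes the boundary of a generator in positive homological degree nonzero.\<close>

lemma lgens_Suc_removable:
  assumes "U \<in> lgens (Suc n)"
  obtains v where "v \<in> U" "U - {v} \<in> lgens n"
proof -
  obtain x x' where "x \<in> U" "x' \<in> U" "x \<noteq> x'" "pt x = pt x'"
    using hits_collision[of U] lgens_D[OF assms] by auto
  then show ?thesis
    using that[of x] lgens_SucD[OF assms] hits_remove[of U] lgens_D[OF assms] by blast
qed

text \<open>For \<open>n = 0\<close> a one-dimensional cell has just two end points. Otherwise a
  face of codimension two lies in exactly two facets of \<open>U\<close>, whose contributions cancel
  by \<open>sg_anticommute\<close>.\<close>

lemma lcycle_ldiff:
  assumes "U \<in> lgens (Suc n)"
  shows "lcycle n (ldiff U :: 'v set \<Rightarrow> 'k::field)"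
proof (cases n)
  case 0
  obtain x x' where x: "x \<in> U" "x' \<in> U" "x \<noteq> x'" "pt x = pt x'" "inj_on pt (U - {x})"
    "hits (U - {x})" "hits (U - {x'})" and u: "\<And>v. v \<in> U \<Longrightarrow> hits (U - {v}) \<Longrightarrow> v = x \<or> v = x'"
    using exactly_one_part_doubled[of U] lgens_D[OF assms] 0 by auto
  have "(\<Sum>T\<in>lgens 0. (ldiff U T :: 'k) * transversal_sign T) =
    (\<Sum>T\<in>{U - {x}, U - {x'}}. ldiff U T * transversal_sign T)"
  proof (rule sum.mono_neutral_right)
    show "{U - {x}, U - {x'}} \<subseteq> lgens 0"
      using lgens_SucD[OF assms] x 0 by auto
    show "\<forall>T\<in>lgens 0 - {U - {x}, U - {x'}}. (ldiff U T :: 'k) * transversal_sign T = 0"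
    proof
      fix T assume T: "T \<in> lgens 0 - {U - {x}, U - {x'}}"
      have "(ldiff U T :: 'k) = 0"
      proof (rule ccontr)
        assume "(ldiff U T :: 'k) \<noteq> 0"
        then obtain v where "v \<in> U" "T = U - {v}" by (rule ldiff_nonzero)
        then show False using u[of v] T lgens_D(2)[of T 0] by auto
      qed
      then show "(ldiff U T :: 'k) * transversal_sign T = 0" by simp
    qed
  qed (rule finite_lgens)
  also have "\<dots> = ldiff U (U - {x}) * transversal_sign (U - {x})
    + ldiff U (U - {x'}) * transversal_sign (U - {x'})"
    using x by (subst sum.insert) auto
  also have "\<dots> = 0"
    using transversal_sign_compat[of U x x'] x lgens_D[OF assms] by (simp add: ldiff_remove mult.commute)
  finally show ?thesis using 0 by (simp add: lcycle_def)
next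
  case (Suc m)
  have "(\<Sum>T\<in>lgens n. (ldiff U T :: 'k) * ldiff T U') = 0" if U': "U' \<in> lgens m" for U'
  proof (cases "\<exists>v\<in>U. \<exists>x\<in>U. v \<noteq> x \<and> U' = U - {v} - {x}")
    case True
    then obtain v x where vx: "v \<in> U" "x \<in> U" "v \<noteq> x" "U' = U - {v} - {x}" by blast
    have "(\<Sum>T\<in>lgens n. (ldiff U T :: 'k) * ldiff T U') = (\<Sum>T\<in>{U - {v}, U - {x}}. ldiff U T * ldiff T U')"
    proof (rule sum.mono_neutral_right)
      \<comment> \<open>Both facets meet all parts because the smaller set \<open>U'\<close> already
        does.\<close>
      have "hits (U - {v})" "hits (U - {x})"
        using hits_mono[of U'] lgens_D[OF U'] lgens_D[OF assms] vx by auto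
      then show "{U - {v}, U - {x}} \<subseteq> lgens n"
        using lgens_SucD[OF assms] vx by auto
      show "\<forall>T\<in>lgens n - {U - {v}, U - {x}}. (ldiff U T :: 'k) * ldiff T U' = 0"
      proof
        fix T assume T: "T \<in> lgens n - {U - {v}, U - {x}}"
        show "(ldiff U T :: 'k) * ldiff T U' = 0"
        proof (rule ccontr)
          assume "(ldiff U T :: 'k) * ldiff T U' \<noteq> 0"
          then have "(ldiff U T :: 'k) \<noteq> 0" "(ldiff T U' :: 'k) \<noteq> 0" by auto
          then obtain y z where "y \<in> U" "T = U - {y}" "z \<in> T" "U' = T - {z}"
            by (metis ldiff_nonzero)
          then show False using T vx by auto
        qed
      qed
    qed (rule finite_lgens)
    also have "\<dots> = ldiff U (U - {v}) * ldiff (U - {v}) U' + ldiff U (U - {x}) * ldiff (U - {x}) U'"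
      using vx by (subst sum.insert) auto
    also have "\<dots> = sg v U * sg x (U - {v}) + sg x U * sg v (U - {x})"
    proof -
      have "U' = U - {x} - {v}" using vx by auto
      then have "(ldiff (U - {x}) U' :: 'k) = sg v (U - {x})"
        using ldiff_remove[of "U - {x}" v] lgens_D[OF assms] vx by auto
      moreover have "(ldiff (U - {v}) U' :: 'k) = sg x (U - {v})"
        using ldiff_remove[of "U - {v}" x] lgens_D[OF assms] vx by auto
      ultimately show ?thesis
        using lgens_D[OF assms] vx by (simp add: ldiff_remove)
    qed
    also have "\<dots> = 0" using sg_anticommute[of U v x] lgens_D[OF assms] vx by auto
    finally show ?thesis .
  next
    case False
    show ?thesis
    proof (rule sum.neutral, rule ballI, rule ccontr)
      fix T assume "(ldiff U T :: 'k) * ldiff T U' \<noteq> 0"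
      then have "(ldiff U T :: 'k) \<noteq> 0" "(ldiff T U' :: 'k) \<noteq> 0" by auto
      then obtain y z where "y \<in> U" "T = U - {y}" "z \<in> T" "U' = T - {z}"
        by (metis ldiff_nonzero)
      then show False using False by auto
    qed
  qed
  then show ?thesis using Suc by (simp add: lcycle_def)
qed

end

section \<open>Total degrees and indicator degrees\<close>

lemma total_degree_mono: "c \<le> c' \<Longrightarrow> total_degree V c \<le> total_degree V c'"
  by (simp add: total_degree_def le_fun_def sum_mono)

lemma total_degree_eqD:
  assumes "finite V" "c \<in> degrees V" "c' \<in> degrees V" "c \<le> c'" "total_degree V c' \<le> total_degree V c"
  shows "c = c'"
proof -
  have le: "0 \<le> c' v - c v" for v
    using assms(4) by (simp add: le_fun_def)
  have "(\<Sum>v\<in>V. c' v - c v) = 0"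
    using assms(5) total_degree_mono[OF assms(4), of V] by (simp add: total_degree_def sum_subtractf)
  then have "\<forall>v\<in>V. c' v - c v = 0"
    using sum_nonneg_eq_0_iff[OF assms(1), of "\<lambda>v. c' v - c v"] le by simp
  then have "c v = c' v" for v
    using assms(2,3) by (cases "v \<in> V") (auto simp: degrees_def)
  then show ?thesis by blast
qed

lemma ind_degrees: "U \<subseteq> V \<Longrightarrow> ind U \<in> degrees V"
  by (auto simp: ind_def degrees_def)

lemma total_degree_ind: "finite V \<Longrightarrow> U \<subseteq> V \<Longrightarrow> total_degree V (ind U) = int (card U)"
  by (simp add: total_degree_def ind_def sum.If_cases Int_absorb1)

lemma ind_inject [simp]: "ind U = ind U' \<longleftrightarrow> U = U'"
  by (auto simp: ind_def fun_eq_iff split: if_splits)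

lemma ind_le_iff: "ind U \<le> ind U' \<longleftrightarrow> U \<subseteq> U'"
  by (auto simp: ind_def le_fun_def)

text \<open>The extra variable \<open>w\<close> may lie in \<open>U\<close> or outside
  \<open>W\<close>, so \<open>c\<close> need not be the indicator of a subset of \<open>W\<close>;
  in \<open>linear_syzygy\<close> the presence of a second generator excludes both cases.\<close>

lemma total_degree_Suc_ind:
  assumes V: "finite V" and c: "c \<in> degrees V" "ind U \<le> c" and U: "U \<subseteq> V"
    and td: "total_degree V c = int (card U) + 1"
  obtains w where "w \<in> V" "c = (\<lambda>v. ind U v + ind {w} v)"
proof -
  let ?e = "\<lambda>v. c v - ind U v"
  have nn: "0 \<le> ?e v" for v using c by (simp add: le_fun_def)
  have sum: "(\<Sum>v\<in>V. ?e v) = 1"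
    using td total_degree_ind[OF V U] by (simp add: total_degree_def sum_subtractf)
  have "\<exists>w\<in>V. ?e w \<noteq> 0"
  proof (rule ccontr)
    assume "\<not> ?thesis"
    then have "(\<Sum>v\<in>V. ?e v) = 0" by (intro sum.neutral) auto
    then show False using sum by simp
  qed
  then obtain w where w: "w \<in> V" "?e w \<noteq> 0" by blast
  have "?e w + (\<Sum>v\<in>V - {w}. ?e v) = 1"
    using sum sum.remove[OF V w(1), of ?e] by simp
  moreover have "0 \<le> (\<Sum>v\<in>V - {w}. ?e v)" using nn by (simp add: sum_nonneg)
  ultimately have 1: "?e w = 1" "(\<Sum>v\<in>V - {w}. ?e v) = 0"
    using w nn[of w] by linarith+
  have "\<forall>v\<in>V - {w}. ?e v = 0"
    using sum_nonneg_eq_0_iff[of "V - {w}" ?e] nn V 1(2) by simp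
  moreover have "?e v = 0" if "v \<notin> V" for v
    using c(1) that U by (auto simp: degrees_def ind_def)
  ultimately have "?e v = ind {w} v" for v
    using 1(1) by (cases "v = w"; cases "v \<in> V") (auto simp: ind_def)
  then have "c = (\<lambda>v. ind U v + ind {w} v)"
    by (auto simp: fun_eq_iff algebra_simps)
  then show ?thesis using that w by blast
qed

context transversal_clutter
begin

text \<open>Two facets of \<open>Up\<close> with a common face are tied together by the cycle
  equation at that face (for \<open>n = 0\<close> by the equation of the augmentation), and the sign
  rules make the tie agree with \<open>ldiff Up\<close>. All facets are connected in this way, so
  one nonzero coefficient forces every facet to be a generator, hence every transversal inside
  \<open>Up\<close> into \<open>Q\<close>, and it determines the cycle up to
  \<open>\<mu>\<close>.\<close>

lemma linear_syzygy:
  fixes \<kappa> :: "'v set \<Rightarrow> 'k::field"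
  assumes c: "c \<in> degrees V" "total_degree V c = int (Suc n + d)"
    and le: "\<And>U. U \<in> lgens n \<Longrightarrow> \<kappa> U \<noteq> 0 \<Longrightarrow> ind U \<le> c"
    and cyc: "lcycle n \<kappa>" and U0: "U0 \<in> lgens n" "\<kappa> U0 \<noteq> 0"
  obtains U \<mu> where "U \<in> lgens (Suc n)" "c = ind U" "\<And>T. T \<in> lgens n \<Longrightarrow> \<kappa> T = \<mu> * ldiff U T"
proof -
  note U0' = lgens_D[OF U0(1)]
  obtain w where w: "w \<in> V" and cw: "c = (\<lambda>v. ind U0 v + ind {w} v)"
    using total_degree_Suc_ind[OF finV c(1) le[OF U0]] c(2) U0' WV by auto
  txt \<open>A cycle of this degree cannot be supported on a single generator.\<close>
  have nunique: "\<exists>T\<in>lgens n. \<kappa> T \<noteq> 0 \<and> T \<noteq> U0"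
  proof (rule ccontr)
    assume "\<not> ?thesis"
    then have z: "\<kappa> T = 0" if "T \<in> lgens n - {U0}" for T using that by blast
    show False
    proof (cases n)
      case 0
      have "(\<Sum>U\<in>lgens 0. \<kappa> U * transversal_sign U) = (\<Sum>U\<in>{U0}. \<kappa> U * transversal_sign U)"
        using z U0 0 by (intro sum.mono_neutral_right) (auto simp: finite_lgens)
      then show False using cyc 0 U0 by (simp add: lcycle_def transversal_sign_nonzero)
    next
      case (Suc m)
      obtain v where v: "v \<in> U0" "U0 - {v} \<in> lgens m"
        using lgens_Suc_removable[of U0 m] U0 Suc by blast
      have "(\<Sum>U\<in>lgens n. \<kappa> U * ldiff U (U0 - {v})) = (\<Sum>U\<in>{U0}. \<kappa> U * ldiff U (U0 - {v}))"
        using z U0 by (intro sum.mono_neutral_right) (auto simp: finite_lgens)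
      then show False
        using cyc Suc U0 U0' v by (auto simp: lcycle_def ldiff_remove sg_nonzero)
    qed
  qed
  then obtain T where T: "T \<in> lgens n" "\<kappa> T \<noteq> 0" "T \<noteq> U0" by blast
  have leT: "ind T \<le> c" and T': "T \<subseteq> W" "finite T" "card T = n + d"
    using le T lgens_D[OF T(1)] by auto
  have sub: "U \<subseteq> insert w U0" if "U \<in> lgens n" "\<kappa> U \<noteq> 0" for U
    using le[OF that] cw by (force simp: le_fun_def ind_def split: if_splits)
  \<comment> \<open>All generators in the support have as many elements as \<open>U0\<close> and lie
    in \<open>insert w U0\<close>; a second one can exist only if \<open>w\<close> is a new vertex,
    and one in \<open>W\<close>.\<close>
  have wU0: "w \<notin> U0"
  proof
    assume "w \<in> U0"
    then have "T \<subseteq> U0" using sub[OF T(1,2)] by auto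
    then show False using T T' U0' by (metis card_subset_eq)
  qed
  have wW: "w \<in> W"
  proof (rule ccontr)
    assume "w \<notin> W"
    then have "T \<subseteq> U0" using sub[OF T(1,2)] T' by auto
    then show False using T T' U0' by (metis card_subset_eq)
  qed
  txt \<open>
    It remains to treat the degree of a subset Up of W. The cycle condition at Up - {v, x} links
    the coefficients of Up - {v} and Up - {x} whenever that set still meets all parts. Otherwise
    v and x form a part with two elements, and they are linked through a vertex of another part.
  \<close>
  define Up where "Up = insert w U0"
  have Up: "Up \<subseteq> W" "finite Up" "card Up = Suc (n + d)" "w \<in> Up" "Up - {w} = U0"
    using wW wU0 U0' by (auto simp: Up_def)
  have hUp: "hits Up" using hits_mono[OF U0'(2)] Up by blast
  have cUp: "c = ind Up" using cw wU0 by (auto simp: ind_def Up_def fun_eq_iff)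
  have form: "\<exists>v\<in>Up. U = Up - {v}" if "U \<in> lgens n" "\<kappa> U \<noteq> 0" for U
  proof -
    have "U \<subseteq> Up" using sub[OF that] by (simp add: Up_def)
    then have "card (Up - U) = 1"
      using lgens_D[OF that(1)] Up by (simp add: card_Diff_subset)
    then obtain v where "Up - U = {v}" by (auto simp: card_1_singleton_iff)
    then have "v \<in> Up" "U = Up - {v}" using \<open>U \<subseteq> Up\<close> by auto
    then show ?thesis by blast
  qed
  \<comment> \<open>As signs square to one, the goal \<open>\<kappa> T = \<mu> * ldiff Up T\<close>
    amounts to \<open>\<kappa> (Up - {x}) * sg x Up\<close> being independent of \<open>x\<close>.
    This is the passage from one facet to another.\<close>
  have transfer: "Up - {x} \<in> lgens n \<and> \<kappa> (Up - {x}) * sg x Up = \<kappa> (Up - {v}) * sg v Up"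
    if v: "v \<in> Up" "Up - {v} \<in> lgens n" "\<kappa> (Up - {v}) \<noteq> 0" and x: "x \<in> Up" "x \<noteq> v"
      and h: "n = 0 \<and> hits (Up - {x}) \<or> hits (Up - {v} - {x})" for v x
  proof (cases n)
    case 0
    have cardUp: "card Up = Suc d" using Up 0 by simp
    obtain y y' where y: "y \<in> Up" "y' \<in> Up" "y \<noteq> y'" "pt y = pt y'" "inj_on pt (Up - {y})"
      and u: "\<And>v. v \<in> Up \<Longrightarrow> hits (Up - {v}) \<Longrightarrow> v = y \<or> v = y'"
      by (rule exactly_one_part_doubled[OF hUp cardUp]) blast
    have hx: "hits (Up - {x})"
    proof (cases "hits (Up - {x})")
      case False
      then have "hits (Up - {v} - {x})" using h by blast
      then show ?thesis by (rule hits_mono) (use Up in auto)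
    qed
    have yvx: "{v, x} = {y, y'}"
      using u[OF v(1)] u[OF x(1) hx] lgens_D[OF v(2)] x by auto
    have compat: "transversal_sign (Up - {v}) * sg v Up + transversal_sign (Up - {x}) * sg x Up = (0::'k)"
      using transversal_sign_compat[of Up y y'] Up y yvx x by (auto simp: doubleton_eq_iff add.commute)
    have "0 = (\<Sum>U\<in>lgens 0. \<kappa> U * transversal_sign U)"
      using cyc 0 by (simp add: lcycle_def)
    also have "\<dots> = (\<Sum>U\<in>lgens 0 \<inter> {Up - {v}, Up - {x}}. \<kappa> U * transversal_sign U)"
    proof (intro sum.mono_neutral_right ballI)
      fix U assume U: "U \<in> lgens 0 - lgens 0 \<inter> {Up - {v}, Up - {x}}"
      have "\<kappa> U = 0"
      proof (rule ccontr)
        assume "\<kappa> U \<noteq> 0"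
        then obtain z where z: "z \<in> Up" "U = Up - {z}" using form[of U] U 0 by auto
        then have "hits (Up - {z})" using U lgens_D(2)[of U 0] by simp
        then have "z \<in> {v, x}" using u[OF z(1)] unfolding yvx by simp
        then show False using U z by auto
      qed
      then show "\<kappa> U * transversal_sign U = 0" by simp
    qed (auto simp: finite_lgens)
    finally have eq: "(\<Sum>U\<in>lgens 0 \<inter> {Up - {v}, Up - {x}}. \<kappa> U * transversal_sign U) = 0" by simp
    have ne: "Up - {v} \<noteq> Up - {x}" using v x by blast
    \<comment> \<open>Otherwise the equation would consist of the nonzero term at
      \<open>Up - {v}\<close> alone; the same argument recurs for positive \<open>n\<close>.\<close>
    have inl: "Up - {x} \<in> lgens n"
    proof (rule ccontr)
      assume "Up - {x} \<notin> lgens n"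
      then have *: "lgens 0 \<inter> {Up - {v}, Up - {x}} = {Up - {v}}" using v 0 by auto
      show False using eq[unfolded *] v by (simp add: transversal_sign_nonzero)
    qed
    then have *: "lgens 0 \<inter> {Up - {v}, Up - {x}} = {Up - {v}, Up - {x}}" using v 0 by auto
    have e: "\<kappa> (Up - {v}) * transversal_sign (Up - {v}) + \<kappa> (Up - {x}) * transversal_sign (Up - {x}) = 0"
      using eq[unfolded *] ne by simp
    \<comment> \<open>The difference to be annihilated, times a nonzero sign, is written in terms of
      the relations \<open>e\<close> and \<open>compat\<close> and of squares of signs minus one,
      all of which vanish.\<close>
    have "(\<kappa> (Up - {x}) * sg x Up - \<kappa> (Up - {v}) * sg v Up) * transversal_sign (Up - {x}) =
      sg x Up * (\<kappa> (Up - {v}) * transversal_sign (Up - {v}) + \<kappa> (Up - {x}) * transversal_sign (Up - {x}))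
       - \<kappa> (Up - {v}) * (sg x Up * sg v Up) * (transversal_sign (Up - {v}) * sg v Up + transversal_sign (Up - {x}) * sg x Up)
       + \<kappa> (Up - {v}) * (sg v Up * sg v Up - 1) * sg x Up * transversal_sign (Up - {v})
       + \<kappa> (Up - {v}) * (sg x Up * sg x Up - 1) * sg v Up * transversal_sign (Up - {x})"
      by (simp add: algebra_simps)
    also have "\<dots> = 0" using e compat by (simp add: sg_square)
    finally show ?thesis using inl by (simp add: transversal_sign_nonzero)
  next
    case (Suc m)
    let ?U' = "Up - {v} - {x}"
    have h': "hits ?U'" using h Suc by blast
    have comm: "Up - {x} - {v} = ?U'" by auto
    have U': "?U' \<in> lgens m"
      using lgens_SucD[of "Up - {v}" m x] v x h' Suc by auto
    have "0 = (\<Sum>U\<in>lgens n. \<kappa> U * ldiff U ?U')"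
      using cyc Suc U' by (simp add: lcycle_def)
    also have "\<dots> = (\<Sum>U\<in>lgens n \<inter> {Up - {v}, Up - {x}}. \<kappa> U * ldiff U ?U')"
    proof (intro sum.mono_neutral_right ballI)
      fix U assume U: "U \<in> lgens n - lgens n \<inter> {Up - {v}, Up - {x}}"
      show "\<kappa> U * ldiff U ?U' = 0"
      proof (rule ccontr)
        assume "\<kappa> U * ldiff U ?U' \<noteq> 0"
        then have nz: "\<kappa> U \<noteq> 0" "(ldiff U ?U' :: 'k) \<noteq> 0" by auto
        then obtain z where "z \<in> Up" "U = Up - {z}" using form U by blast
        moreover obtain y where "y \<in> U" "?U' = U - {y}" using nz(2) by (rule ldiff_nonzero)
        ultimately show False using U by auto
      qed
    qed (auto simp: finite_lgens)
    finally have eq: "(\<Sum>U\<in>lgens n \<inter> {Up - {v}, Up - {x}}. \<kappa> U * ldiff U ?U') = 0" by simp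
    have ne: "Up - {v} \<noteq> Up - {x}" using v x by blast
    have l: "(ldiff (Up - {v}) ?U' :: 'k) = sg x (Up - {v})" "(ldiff (Up - {x}) ?U' :: 'k) = sg v (Up - {x})"
      using ldiff_remove[of "Up - {v}" x] ldiff_remove[of "Up - {x}" v] comm Up v x by auto
    have inl: "Up - {x} \<in> lgens n"
    proof (rule ccontr)
      assume "Up - {x} \<notin> lgens n"
      then have *: "lgens n \<inter> {Up - {v}, Up - {x}} = {Up - {v}}" using v by auto
      show False using eq[unfolded *] v l by (simp add: sg_nonzero)
    qed
    then have *: "lgens n \<inter> {Up - {v}, Up - {x}} = {Up - {v}, Up - {x}}" using v by auto
    have e: "\<kappa> (Up - {v}) * sg x (Up - {v}) + \<kappa> (Up - {x}) * sg v (Up - {x}) = 0"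
      using eq[unfolded *] ne l by simp
    have anti: "sg v Up * sg x (Up - {v}) + sg x Up * sg v (Up - {x}) = (0::'k)"
      using sg_anticommute[of Up v x] Up v x by auto
    have "(\<kappa> (Up - {x}) * sg x Up - \<kappa> (Up - {v}) * sg v Up) * sg v (Up - {x}) =
      sg x Up * (\<kappa> (Up - {v}) * sg x (Up - {v}) + \<kappa> (Up - {x}) * sg v (Up - {x}))
       - \<kappa> (Up - {v}) * (sg x Up * sg v Up) * (sg v Up * sg x (Up - {v}) + sg x Up * sg v (Up - {x}))
       + \<kappa> (Up - {v}) * (sg v Up * sg v Up - 1) * sg x Up * sg x (Up - {v})
       + \<kappa> (Up - {v}) * (sg x Up * sg x Up - 1) * sg v Up * sg v (Up - {x})"
      by (simp add: algebra_simps)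
    also have "\<dots> = 0" using e anti by (simp add: sg_square)
    finally show ?thesis using inl by (simp add: sg_nonzero)
  qed
  define \<mu> where "\<mu> = \<kappa> U0 * sg w Up"
  have all: "Up - {x} \<in> lgens n \<and> \<kappa> (Up - {x}) * sg x Up = \<mu>"
    if x: "x \<in> Up" "hits (Up - {x})" for x
  proof (cases "x = w")
    case True
    then show ?thesis using U0 Up by (simp add: \<mu>_def)
  next
    case xw: False
    have W0: "w \<in> Up" "Up - {w} \<in> lgens n" "\<kappa> (Up - {w}) \<noteq> 0" using U0 Up by auto
    show ?thesis
    proof (cases "n = 0 \<or> hits (Up - {w} - {x})")
      case True
      then show ?thesis using transfer[OF W0 x(1) xw] x Up by (auto simp: \<mu>_def)
    next
      case False
      \<comment> \<open>Now \<open>n > 0\<close>, so some part of \<open>U0\<close> is doubled, by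
        \<open>y\<close> and \<open>y'\<close>; it does not contain \<open>x\<close>, since
        \<open>x\<close> cannot be removed from \<open>U0\<close>. Removing \<open>y\<close> empties
        no part, so \<open>w\<close> and \<open>x\<close> are linked through
        \<open>y\<close>.\<close>
      have "card U0 > d" using False U0' by auto
      then obtain y y' where y: "y \<in> U0" "y' \<in> U0" "y \<noteq> y'" "pt y = pt y'"
        using hits_collision[OF U0'(2)] by blast
      have hy: "hits (U0 - {y})" "hits (U0 - {y'})"
        using hits_remove[OF U0'(2)] y by metis+
      have yx: "y \<noteq> x" "y' \<noteq> x" using hy False Up by auto
      have yw: "y \<noteq> w" "y' \<noteq> w" using y wU0 by auto
      have 1: "Up - {y} \<in> lgens n \<and> \<kappa> (Up - {y}) * sg y Up = \<mu>"
        using transfer[OF W0, of y] y yw hy Up by (auto simp: \<mu>_def)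
      have "hits (Up - {x} - {y})"
        using hits_remove[OF x(2), of y y'] y yx Up by auto
      then have h2: "hits (Up - {y} - {x})" by (simp add: Diff_insert2[symmetric] insert_commute)
      have "\<kappa> (Up - {y}) \<noteq> 0"
        using 1 U0 by (auto simp: \<mu>_def sg_nonzero)
      then show ?thesis using transfer[of y x] 1 h2 x yx y Up by auto
    qed
  qed
  \<comment> \<open>A transversal inside \<open>Up\<close> misses some vertex \<open>v\<close>, so
    it lies in the facet \<open>Up - {v}\<close>, which is a generator by
    \<open>all\<close>.\<close>
  have "adm Up" unfolding adm_def
  proof (intro conjI allI impI hUp)
    fix T assume T: "T \<subseteq> Up" "hits T \<and> card T = d"
    then have "card T < card Up" using Up by simp
    then obtain v where v: "v \<in> Up" "v \<notin> T"
      using T by (metis less_irrefl subsetI subset_antisym)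
    have "T \<subseteq> Up - {v}" "Up - {v} \<subseteq> W" using T v Up by auto
    then have "hits (Up - {v})" using hits_mono T by blast
    then have "adm (Up - {v})" using all[OF v(1)] lgens_D by blast
    then show "T \<in> Q" using T v unfolding adm_def by blast
  qed
  then have UpL: "Up \<in> lgens (Suc n)" using Up by (simp add: lgens_def)
  have "\<kappa> T = \<mu> * ldiff Up T" if T: "T \<in> lgens n" for T
  proof (cases "\<exists>v\<in>Up. T = Up - {v}")
    case True
    then obtain v where v: "v \<in> Up" "T = Up - {v}" by blast
    have "\<mu> * ldiff Up T = \<kappa> T * (sg v Up * sg v Up)"
      using all[OF v(1)] v lgens_D(2)[OF T] Up by (auto simp: ldiff_remove)
    then show ?thesis by (simp add: sg_square)
  next
    case False
    then have "\<kappa> T = 0" "(ldiff Up T :: 'k) = 0"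
      using form[OF T] ldiff_nonzero by blast+
    then show ?thesis by simp
  qed
  then show ?thesis using that UpL cUp by blast
qed

end

section \<open>Multigraded resolutions as families of scalar matrices\<close>

text \<open>
  A homogeneous map between multigraded free modules is a matrix of scalars (the monomials
  in its entries are determined by the degrees), and a homogeneous element of degree c is a vector
  of scalars supported on the generators of degree at most c.
\<close>

definition supp_le :: "'b set \<Rightarrow> ('b \<Rightarrow> 'v \<Rightarrow> int) \<Rightarrow> ('v \<Rightarrow> int) \<Rightarrow> ('b \<Rightarrow> 'k::zero) \<Rightarrow> bool" where
  "supp_le S g c \<kappa> \<longleftrightarrow> (\<forall>b\<in>S. \<kappa> b \<noteq> 0 \<longrightarrow> g b \<le> c)"

definition scycle ::
  "(nat \<Rightarrow> 'b set) \<Rightarrow> (nat \<Rightarrow> 'b \<Rightarrow> 'b \<Rightarrow> 'k::field) \<Rightarrow> ('b \<Rightarrow> 'k) \<Rightarrow> nat \<Rightarrow> ('b \<Rightarrow> 'k) \<Rightarrow> bool" where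
  "scycle B mt ag n \<kappa> = (case n of 0 \<Rightarrow> (\<Sum>b\<in>B 0. \<kappa> b * ag b) = 0
     | Suc m \<Rightarrow> \<forall>b'\<in>B m. (\<Sum>b\<in>B (Suc m). \<kappa> b * mt m b b') = 0)"

lemma scycle_0: "scycle B mt ag 0 \<kappa> \<longleftrightarrow> (\<Sum>b\<in>B 0. \<kappa> b * ag b) = 0"
  by (simp add: scycle_def)

lemma scycle_Suc:
  "scycle B mt ag (Suc m) \<kappa> \<longleftrightarrow> (\<forall>b'\<in>B m. (\<Sum>b\<in>B (Suc m). \<kappa> b * mt m b b') = 0)"
  by (simp add: scycle_def)

text \<open>\<open>II\<close> stands for the multidegrees of the monomials in the ideal. Strictness
  in \<open>mt_le\<close> encodes minimality: a nonzero scalar between generators of equal degree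
  would be a unit entry of the differential.\<close>

locale scalar_resolution =
  fixes V :: "'v set" and B :: "nat \<Rightarrow> 'b set" and dg :: "nat \<Rightarrow> 'b \<Rightarrow> 'v \<Rightarrow> int"
    and mt :: "nat \<Rightarrow> 'b \<Rightarrow> 'b \<Rightarrow> 'k::field" and ag :: "'b \<Rightarrow> 'k" and II :: "('v \<Rightarrow> int) set"
  assumes finV: "finite V"
    and finB: "finite (B n)"
    and dg_degrees: "b \<in> B n \<Longrightarrow> dg n b \<in> degrees V"
    and mt_le: "b \<in> B (Suc n) \<Longrightarrow> b' \<in> B n \<Longrightarrow> mt n b b' \<noteq> 0 \<Longrightarrow>
      dg n b' \<le> dg (Suc n) b \<and> dg n b' \<noteq> dg (Suc n) b"
    and ag_II: "b \<in> B 0 \<Longrightarrow> ag b \<noteq> 0 \<Longrightarrow> dg 0 b \<in> II"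
    and surj: "c \<in> II \<Longrightarrow> \<exists>\<kappa>. supp_le (B 0) (dg 0) c \<kappa> \<and> (\<Sum>b\<in>B 0. \<kappa> b * ag b) = 1"
    and complex: "b \<in> B (Suc n) \<Longrightarrow> scycle B mt ag n (mt n b)"
    and exact: "c \<in> degrees V \<Longrightarrow> supp_le (B n) (dg n) c \<kappa> \<Longrightarrow> scycle B mt ag n \<kappa> \<Longrightarrow>
      \<exists>\<kappa>'. supp_le (B (Suc n)) (dg (Suc n)) c \<kappa>' \<and> (\<forall>b\<in>B n. \<kappa> b = (\<Sum>b'\<in>B (Suc n). \<kappa>' b' * mt n b' b))"
begin

text \<open>By exactness the cycle is a combination of boundaries of generators of degree at most
  \<open>c\<close>, and a boundary involves only strictly smaller degrees than its generator. A
  cycle therefore never involves a generator of its own degree.\<close>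

lemma cycle_below:
  assumes "c \<in> degrees V" "supp_le (B n) (dg n) c \<kappa>" "scycle B mt ag n \<kappa>" "b \<in> B n" "\<kappa> b \<noteq> 0"
  shows "dg n b \<le> c \<and> dg n b \<noteq> c"
proof -
  obtain \<kappa>' where \<kappa>': "supp_le (B (Suc n)) (dg (Suc n)) c \<kappa>'"
    and eq: "\<forall>b\<in>B n. \<kappa> b = (\<Sum>b'\<in>B (Suc n). \<kappa>' b' * mt n b' b)"
    using exact[OF assms(1-3)] by blast
  have "(\<Sum>b'\<in>B (Suc n). \<kappa>' b' * mt n b' b) \<noteq> 0" using eq assms by auto
  then obtain b' where b': "b' \<in> B (Suc n)" "\<kappa>' b' * mt n b' b \<noteq> 0"
    by (rule sum.not_neutral_contains_not_neutral)
  then have "dg n b \<le> dg (Suc n) b'" "dg n b \<noteq> dg (Suc n) b'" "dg (Suc n) b' \<le> c"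
    using mt_le[OF b'(1) assms(4)] \<kappa>' by (auto simp: supp_le_def)
  then show ?thesis by (metis order.trans order.antisym)
qed

lemma sum_two:
  fixes h :: "'b \<Rightarrow> 'k"
  assumes "finite S" "b1 \<in> S" "b2 \<in> S" "b1 \<noteq> b2"
  shows "(\<Sum>b\<in>S. (if b = b1 then x else if b = b2 then y else 0) * h b) = x * h b1 + y * h b2"
proof -
  have "(\<Sum>b\<in>S. (if b = b1 then x else if b = b2 then y else 0) * h b) =
    (\<Sum>b\<in>{b1, b2}. (if b = b1 then x else if b = b2 then y else 0) * h b)"
    using assms by (intro sum.mono_neutral_right) auto
  then show ?thesis using assms by simp
qed

lemma no_unit_cycle:
  assumes "b \<in> B n"
  shows "\<not> scycle B mt ag n (\<lambda>b'. if b' = b then 1 else 0)"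
proof -
  have "supp_le (B n) (dg n) (dg n b) (\<lambda>b'. if b' = b then (1::'k) else 0)"
    by (auto simp: supp_le_def)
  then show ?thesis
    using cycle_below[OF dg_degrees[OF assms], of n "\<lambda>b'. if b' = b then 1 else 0" b] assms by auto
qed

text \<open>Two generators of equal degree with proportional images would produce such a cycle;
  uniqueness of the generator in a given degree rests on this.\<close>

lemma no_cycle_in_own_degree:
  assumes "b1 \<in> B n" "b2 \<in> B n" "b1 \<noteq> b2" "dg n b1 = dg n b2" "x \<noteq> 0"
  shows "\<not> scycle B mt ag n (\<lambda>b. if b = b1 then x else if b = b2 then y else 0)"
proof -
  have "supp_le (B n) (dg n) (dg n b1) (\<lambda>b. if b = b1 then x else if b = b2 then y else 0)"
    using assms(4) by (auto simp: supp_le_def)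
  then show ?thesis
    using cycle_below[OF dg_degrees[OF assms(1)], of n "\<lambda>b. if b = b1 then x else if b = b2 then y else 0" b1]
      assms by auto
qed

lemma boundary_nonzero:
  assumes "b \<in> B (Suc n)"
  shows "\<exists>b'\<in>B n. mt n b b' \<noteq> 0"
proof (rule ccontr)
  assume "\<not> ?thesis"
  then have "scycle B mt ag (Suc n) (\<lambda>b'. if b' = b then 1 else 0)"
    using finB assms by (auto simp: scycle_Suc if_distrib[of "\<lambda>x. x * _"] sum.delta cong: if_cong)
  then show False using no_unit_cycle[OF assms] by blast
qed

lemma augmentation_nonzero:
  assumes "b \<in> B 0"
  shows "ag b \<noteq> 0"
proof
  assume "ag b = 0"
  then have "scycle B mt ag 0 (\<lambda>b'. if b' = b then 1 else 0)"
    using finB assms by (auto simp: scycle_0 if_distrib[of "\<lambda>x. x * _"] sum.delta cong: if_cong)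
  then show False using no_unit_cycle[OF assms] by blast
qed

end

section \<open>Matching the linear part of a resolution with the transversal complex\<close>

locale linear_resolution = scalar_resolution V B dg mt ag II + transversal_clutter V W d pt Q r
  for V :: "'v set" and B :: "nat \<Rightarrow> 'b set" and dg :: "nat \<Rightarrow> 'b \<Rightarrow> 'v \<Rightarrow> int"
    and mt :: "nat \<Rightarrow> 'b \<Rightarrow> 'b \<Rightarrow> 'k::field" and ag :: "'b \<Rightarrow> 'k" and II :: "('v \<Rightarrow> int) set"
    and W :: "'v set" and d :: nat and pt :: "'v \<Rightarrow> nat" and Q :: "'v set set"
    and r :: "('v \<times> 'v) set" +
  assumes II_ge: "c \<in> II \<Longrightarrow> total_degree V c \<ge> int d"
    and II_eq: "c \<in> II \<Longrightarrow> total_degree V c = int d \<Longrightarrow> \<exists>U\<in>lgens 0. c = ind U"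
    and lgens_II: "U \<in> lgens 0 \<Longrightarrow> ind U \<in> II"
begin

lemma total_degree_lgens: "U \<in> lgens n \<Longrightarrow> total_degree V (ind U) = int (n + d)"
  using total_degree_ind[OF finV, of U] lgens_D[of U n] WV by auto

lemma lgens_degrees: "U \<in> lgens n \<Longrightarrow> ind U \<in> degrees V"
  using ind_degrees[of U V] lgens_D[of U n] WV by auto

lemma total_degree_ge: "b \<in> B n \<Longrightarrow> total_degree V (dg n b) \<ge> int (n + d)"
proof (induction n arbitrary: b)
  case 0
  then show ?case using II_ge ag_II augmentation_nonzero by auto
next
  case (Suc n)
  obtain b' where b': "b' \<in> B n" "mt n b b' \<noteq> 0" using boundary_nonzero[OF Suc.prems] by blast
  have "dg n b' \<le> dg (Suc n) b" "dg n b' \<noteq> dg (Suc n) b"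
    using mt_le[OF Suc.prems b'] by auto
  then have "total_degree V (dg n b') < total_degree V (dg (Suc n) b)"
    using total_degree_eqD[OF finV dg_degrees[OF b'(1)] dg_degrees[OF Suc.prems]] by fastforce
  then show ?case using Suc.IH[OF b'(1)] by simp
qed

lemma dg_eq_of_le:
  assumes "b \<in> B n" "c \<in> degrees V" "total_degree V c = int (n + d)" "dg n b \<le> c"
  shows "dg n b = c"
  using total_degree_eqD[OF finV dg_degrees[OF assms(1)] assms(2,4)] assms total_degree_ge[OF assms(1)]
  by simp

definition linear_part :: "nat \<Rightarrow> 'b set" where
  "linear_part n = {b \<in> B n. total_degree V (dg n b) = int (n + d)}"

text \<open>Meaningful under \<open>gens_matched n\<close>, which supplies existence and uniqueness;
  \<open>set_at n\<close> is then its inverse on \<open>linear_part n\<close>.\<close>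

definition gen_at :: "nat \<Rightarrow> 'v set \<Rightarrow> 'b" where
  "gen_at n U = (THE b. b \<in> B n \<and> dg n b = ind U)"

definition set_at :: "nat \<Rightarrow> 'b \<Rightarrow> 'v set" where
  "set_at n b = {v. dg n b v = 1}"

definition gens_matched :: "nat \<Rightarrow> bool" where
  "gens_matched n \<longleftrightarrow> (\<forall>U\<in>lgens n. \<exists>!b. b \<in> B n \<and> dg n b = ind U) \<and>
     (\<forall>b\<in>linear_part n. \<exists>U\<in>lgens n. dg n b = ind U)"

text \<open>The comparison map in coordinates: the generator \<open>U\<close> goes to
  \<open>lam U\<close> times the generator matched with it.\<close>

definition push :: "nat \<Rightarrow> ('v set \<Rightarrow> 'k) \<Rightarrow> ('v set \<Rightarrow> 'k) \<Rightarrow> 'b \<Rightarrow> 'k" where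
  "push n lam \<kappa> b = (if b \<in> linear_part n then \<kappa> (set_at n b) * lam (set_at n b) else 0)"

text \<open>The induction invariant. Knowing that cycles correspond under \<open>push\<close> is
  what allows \<open>linear_syzygy\<close> to be applied in the next step.\<close>

definition matched :: "nat \<Rightarrow> ('v set \<Rightarrow> 'k) \<Rightarrow> bool" where
  "matched n lam \<longleftrightarrow> gens_matched n \<and> (\<forall>U\<in>lgens n. lam U \<noteq> 0) \<and>
     (\<forall>\<kappa>. scycle B mt ag n (push n lam \<kappa>) \<longleftrightarrow> lcycle n \<kappa>)"

text \<open>Compatibility of the scalings with the differentials: \<open>lam' U\<close> times the
  generator matched with \<open>U\<close> has the pushed boundary of \<open>U\<close> as its
  boundary.\<close>

definition step_matched :: "nat \<Rightarrow> ('v set \<Rightarrow> 'k) \<Rightarrow> ('v set \<Rightarrow> 'k) \<Rightarrow> bool" where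
  "step_matched n lam lam' \<longleftrightarrow> (\<forall>U\<in>lgens (Suc n). \<forall>b\<in>B n.
     lam' U * mt n (gen_at (Suc n) U) b = push n lam (ldiff U) b)"

lemma gen_at:
  assumes "gens_matched n" "U \<in> lgens n"
  shows "gen_at n U \<in> B n" "dg n (gen_at n U) = ind U" "gen_at n U \<in> linear_part n"
proof -
  have "\<exists>!b. b \<in> B n \<and> dg n b = ind U"
    using assms by (auto simp: gens_matched_def)
  then have *: "gen_at n U \<in> B n \<and> dg n (gen_at n U) = ind U"
    unfolding gen_at_def by (rule theI')
  then show "gen_at n U \<in> B n" "dg n (gen_at n U) = ind U" by auto
  then show "gen_at n U \<in> linear_part n"
    using total_degree_lgens[OF assms(2)] by (simp add: linear_part_def)
qed

lemma gen_at_unique: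
  assumes "gens_matched n" "U \<in> lgens n" "b \<in> B n" "dg n b = ind U"
  shows "gen_at n U = b"
proof -
  have "\<exists>!b. b \<in> B n \<and> dg n b = ind U"
    using assms by (auto simp: gens_matched_def)
  then show ?thesis using gen_at(1,2)[OF assms(1,2)] assms(3,4) by auto
qed

lemma set_at_ind: "dg n b = ind U \<Longrightarrow> set_at n b = U"
  by (auto simp: set_at_def ind_def)

lemma set_at_gen_at: "gens_matched n \<Longrightarrow> U \<in> lgens n \<Longrightarrow> set_at n (gen_at n U) = U"
  by (simp add: set_at_ind gen_at)

lemma linear_partD:
  assumes "gens_matched n" "b \<in> linear_part n"
  shows "set_at n b \<in> lgens n" "gen_at n (set_at n b) = b" "dg n b = ind (set_at n b)"
proof -
  obtain U where U: "U \<in> lgens n" "dg n b = ind U"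
    using assms by (auto simp: gens_matched_def)
  then show "set_at n b \<in> lgens n" "dg n b = ind (set_at n b)" by (simp_all add: set_at_ind)
  then show "gen_at n (set_at n b) = b"
    using gen_at_unique assms by (simp add: linear_part_def)
qed

lemma bij_gen_at: "gens_matched n \<Longrightarrow> bij_betw (gen_at n) (lgens n) (linear_part n)"
  by (rule bij_betwI[where g = "set_at n"]) (auto simp: gen_at linear_partD set_at_gen_at)

lemma sum_push:
  assumes "gens_matched n"
  shows "(\<Sum>b\<in>B n. push n lam \<kappa> b * h b) = (\<Sum>U\<in>lgens n. \<kappa> U * (lam U * h (gen_at n U)))"
proof -
  have "(\<Sum>b\<in>B n. push n lam \<kappa> b * h b) = (\<Sum>b\<in>linear_part n. push n lam \<kappa> b * h b)"
    using finB by (intro sum.mono_neutral_right) (auto simp: linear_part_def push_def)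
  also have "\<dots> = (\<Sum>U\<in>lgens n. push n lam \<kappa> (gen_at n U) * h (gen_at n U))"
    by (rule sum.reindex_bij_betw[OF bij_gen_at[OF assms], symmetric])
  also have "\<dots> = (\<Sum>U\<in>lgens n. \<kappa> U * (lam U * h (gen_at n U)))"
    using assms by (intro sum.cong) (auto simp: push_def gen_at set_at_gen_at)
  finally show ?thesis .
qed

lemma push_eq_0_iff:
  assumes "gens_matched n" "\<forall>U\<in>lgens n. lam U \<noteq> 0"
  shows "(\<forall>b\<in>B n. push n lam \<kappa> b = 0) \<longleftrightarrow> (\<forall>U\<in>lgens n. \<kappa> U = 0)"
proof
  assume z: "\<forall>b\<in>B n. push n lam \<kappa> b = 0"
  show "\<forall>U\<in>lgens n. \<kappa> U = 0"
  proof
    fix U assume U: "U \<in> lgens n"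
    then have "push n lam \<kappa> (gen_at n U) = 0" using z gen_at[OF assms(1)] by blast
    then show "\<kappa> U = 0" using assms U by (simp add: push_def gen_at set_at_gen_at)
  qed
next
  assume "\<forall>U\<in>lgens n. \<kappa> U = 0"
  then show "\<forall>b\<in>B n. push n lam \<kappa> b = 0"
    using linear_partD(1)[OF assms(1)] by (simp add: push_def)
qed

text \<open>Surjectivity in degree \<open>ind U\<close> yields a generator of degree at most
  \<open>ind U\<close>, and the lower bound on total degrees makes the two equal. Conversely a
  generator of total degree \<open>d\<close> has nonzero augmentation, so its degree is that of a
  monomial of the ideal.\<close>

lemma matched_0: "\<exists>lam. matched 0 lam"
proof -
  have ex: "\<exists>b\<in>B 0. dg 0 b = ind U" if U: "U \<in> lgens 0" for U
  proof -
    obtain \<kappa> where \<kappa>: "supp_le (B 0) (dg 0) (ind U) \<kappa>" "(\<Sum>b\<in>B 0. \<kappa> b * ag b) = 1"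
      using surj[OF lgens_II[OF U]] by blast
    then have "(\<Sum>b\<in>B 0. \<kappa> b * ag b) \<noteq> 0" by simp
    then obtain b where b: "b \<in> B 0" "\<kappa> b * ag b \<noteq> 0"
      by (rule sum.not_neutral_contains_not_neutral)
    then have "dg 0 b \<le> ind U" using \<kappa> by (auto simp: supp_le_def)
    then show ?thesis
      using dg_eq_of_le[OF b(1) lgens_degrees[OF U] total_degree_lgens[OF U]] b by blast
  qed
  have unique: "b = b'" if "b \<in> B 0" "b' \<in> B 0" "dg 0 b = dg 0 b'" for b b'
  proof (rule ccontr)
    assume ne: "b \<noteq> b'"
    \<comment> \<open>The coefficients are crossed so that the two augmentations cancel.\<close>
    have "scycle B mt ag 0 (\<lambda>x. if x = b then ag b' else if x = b' then - ag b else 0)"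
      using sum_two[OF finB that(1,2) ne, of "ag b'" "- ag b" ag] by (simp add: scycle_0)
    then show False
      using no_cycle_in_own_degree[OF that(1,2) ne that(3)] augmentation_nonzero[OF that(2)] by blast
  qed
  have gm: "gens_matched 0" unfolding gens_matched_def
  proof (intro conjI ballI)
    fix U assume U: "U \<in> lgens 0"
    then obtain b where b: "b \<in> B 0" "dg 0 b = ind U" using ex by blast
    show "\<exists>!b. b \<in> B 0 \<and> dg 0 b = ind U"
      by (rule ex1I[of _ b]) (use b unique in auto)
  next
    fix b assume "b \<in> linear_part 0"
    then show "\<exists>U\<in>lgens 0. dg 0 b = ind U"
      using II_eq ag_II augmentation_nonzero by (auto simp: linear_part_def)
  qed
  \<comment> \<open>With this scaling the generator for \<open>U\<close> maps to
    \<open>transversal_sign U\<close> times its monomial, the normalisation built into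
    \<open>lcycle\<close> at \<open>0\<close>.\<close>
  define lam where "lam = (\<lambda>U. transversal_sign U / ag (gen_at 0 U))"
  have nz: "ag (gen_at 0 U) \<noteq> 0" if "U \<in> lgens 0" for U
    using augmentation_nonzero gen_at(1)[OF gm that] by blast
  have "(\<Sum>b\<in>B 0. push 0 lam \<kappa> b * ag b) = (\<Sum>U\<in>lgens 0. \<kappa> U * transversal_sign U)" for \<kappa>
    unfolding sum_push[OF gm] by (intro sum.cong) (auto simp: lam_def nz)
  then have "matched 0 lam"
    using gm nz by (auto simp: matched_def scycle_0 lcycle_def lam_def transversal_sign_nonzero)
  then show ?thesis by blast
qed

text \<open>The boundary of a generator on the strand stays on the strand: its terms have smaller
  total degree, and the lower bound leaves only one value. Pulled back along \<open>push\<close> the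
  boundary is an \<open>lcycle\<close>, so \<open>linear_syzygy\<close> applies.\<close>

lemma boundary_eq_push:
  assumes m: "matched n lam" and b: "b \<in> B (Suc n)"
    and td: "total_degree V (dg (Suc n) b) = int (Suc n + d)"
  obtains U \<mu> where "U \<in> lgens (Suc n)" "dg (Suc n) b = ind U"
    "\<And>b'. b' \<in> B n \<Longrightarrow> mt n b b' = \<mu> * push n lam (ldiff U) b'"
proof -
  have gm: "gens_matched n" and nz: "\<forall>U\<in>lgens n. lam U \<noteq> 0"
    and cyc: "\<And>\<kappa>. scycle B mt ag n (push n lam \<kappa>) \<longleftrightarrow> lcycle n \<kappa>"
    using m by (auto simp: matched_def)
  have lin: "b' \<in> linear_part n" if b': "b' \<in> B n" "mt n b b' \<noteq> 0" for b'
  proof -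
    have "dg n b' \<le> dg (Suc n) b" "dg n b' \<noteq> dg (Suc n) b"
      using mt_le[OF b b'] by auto
    then have "total_degree V (dg n b') < total_degree V (dg (Suc n) b)"
      using total_degree_eqD[OF finV dg_degrees[OF b'(1)] dg_degrees[OF b]] by fastforce
    then show ?thesis using td total_degree_ge[OF b'(1)] b' by (simp add: linear_part_def)
  qed
  \<comment> \<open>Division by \<open>lam\<close> inverts \<open>push\<close> on the linear
    part.\<close>
  define \<kappa> where "\<kappa> = (\<lambda>U. mt n b (gen_at n U) / lam U)"
  have eq: "push n lam \<kappa> b' = mt n b b'" if "b' \<in> B n" for b'
    using lin[OF that] nz linear_partD[OF gm] by (auto simp: push_def \<kappa>_def)
  have "scycle B mt ag n (push n lam \<kappa>) \<longleftrightarrow> scycle B mt ag n (mt n b)"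
    using eq by (auto simp: scycle_def split: nat.splits intro!: sum.cong)
  then have "lcycle n \<kappa>" using cyc complex[OF b] by blast
  moreover have "ind U \<le> dg (Suc n) b" if "U \<in> lgens n" "\<kappa> U \<noteq> 0" for U
    using mt_le[OF b gen_at(1)[OF gm that(1)]] that gen_at(2)[OF gm that(1)] by (auto simp: \<kappa>_def)
  moreover obtain U0 where "U0 \<in> lgens n" "\<kappa> U0 \<noteq> 0"
    using boundary_nonzero[OF b] push_eq_0_iff[OF gm nz, of \<kappa>] eq by auto
  ultimately obtain U \<mu> where "U \<in> lgens (Suc n)" "dg (Suc n) b = ind U"
    and U: "\<And>T. T \<in> lgens n \<Longrightarrow> \<kappa> T = \<mu> * ldiff U T"
    using linear_syzygy[OF dg_degrees[OF b] td, of \<kappa> U0] by blast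
  moreover have "mt n b b' = \<mu> * push n lam (ldiff U) b'" if "b' \<in> B n" for b'
    using eq[OF that] U linear_partD(1)[OF gm] by (auto simp: push_def mult.assoc)
  ultimately show ?thesis using that by blast
qed

text \<open>Uniqueness: the boundaries of two generators of one degree are multiples of the same
  vector, so a combination would be a cycle in its own degree. Existence: the pushed boundary of
  \<open>U\<close> is a cycle, hence comes from generators of degree at most \<open>ind U\<close>,
  and the lower bound on total degrees makes their degree exactly \<open>ind U\<close>.\<close>

lemma matched_Suc:
  assumes m: "matched n lam"
  shows "\<exists>lam'. matched (Suc n) lam' \<and> step_matched n lam lam'"
proof -
  have gm: "gens_matched n" and nz: "\<forall>U\<in>lgens n. lam U \<noteq> 0"
    and cyc: "\<And>\<kappa>. scycle B mt ag n (push n lam \<kappa>) \<longleftrightarrow> lcycle n \<kappa>"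
    using m by (auto simp: matched_def)
  have unique: "b = b'" if b: "b \<in> B (Suc n)" "dg (Suc n) b = ind U"
    and b': "b' \<in> B (Suc n)" "dg (Suc n) b' = ind U" and U: "U \<in> lgens (Suc n)" for b b' U
  proof (rule ccontr)
    assume ne: "b \<noteq> b'"
    obtain \<mu> where \<mu>: "\<And>x. x \<in> B n \<Longrightarrow> mt n b x = \<mu> * push n lam (ldiff U) x"
      using boundary_eq_push[OF m b(1)] b(2) total_degree_lgens[OF U] by (metis ind_inject)
    obtain \<mu>' where \<mu>': "\<And>x. x \<in> B n \<Longrightarrow> mt n b' x = \<mu>' * push n lam (ldiff U) x"
      using boundary_eq_push[OF m b'(1)] b'(2) total_degree_lgens[OF U] by (metis ind_inject)
    have "\<mu>' \<noteq> 0" using boundary_nonzero[OF b'(1)] \<mu>' by auto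
    moreover have "scycle B mt ag (Suc n) (\<lambda>x. if x = b then \<mu>' else if x = b' then - \<mu> else 0)"
      using sum_two[OF finB b(1) b'(1) ne] by (simp add: scycle_Suc \<mu> \<mu>')
    ultimately show False
      using no_cycle_in_own_degree[OF b(1) b'(1) ne] b b' by auto
  qed
  have ex: "\<exists>b l. b \<in> B (Suc n) \<and> dg (Suc n) b = ind U \<and> l \<noteq> 0 \<and>
      (\<forall>b'\<in>B n. l * mt n b b' = push n lam (ldiff U) b')" if U: "U \<in> lgens (Suc n)" for U
  proof -
    have "supp_le (B n) (dg n) (ind U) (push n lam (ldiff U))"
      unfolding supp_le_def
    proof (intro ballI impI)
      fix b assume b: "b \<in> B n" "push n lam (ldiff U) b \<noteq> 0"
      then have "b \<in> linear_part n" "(ldiff U (set_at n b) :: 'k) \<noteq> 0"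
        by (auto simp: push_def split: if_splits)
      moreover from this(2) have "set_at n b \<subseteq> U" by (rule ldiff_nonzero) auto
      ultimately show "dg n b \<le> ind U" using linear_partD(3)[OF gm] by (metis ind_le_iff)
    qed
    moreover have "scycle B mt ag n (push n lam (ldiff U))"
      using lcycle_ldiff[OF U] cyc by blast
    ultimately obtain \<kappa>' where \<kappa>': "supp_le (B (Suc n)) (dg (Suc n)) (ind U) \<kappa>'"
      and eq: "\<forall>b\<in>B n. push n lam (ldiff U) b = (\<Sum>b'\<in>B (Suc n). \<kappa>' b' * mt n b' b)"
      using exact[OF lgens_degrees[OF U]] by blast
    have dgU: "dg (Suc n) b = ind U" if "b \<in> B (Suc n)" "\<kappa>' b \<noteq> 0" for b
      using dg_eq_of_le[OF that(1) lgens_degrees[OF U] total_degree_lgens[OF U]] \<kappa>' that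
      by (auto simp: supp_le_def)
    obtain v where v: "v \<in> U" "U - {v} \<in> lgens n" using lgens_Suc_removable[OF U] by blast
    then have "(ldiff U (U - {v}) :: 'k) \<noteq> 0"
      using lgens_D(4)[OF U] by (simp add: ldiff_remove sg_nonzero)
    then obtain b0 where b0: "b0 \<in> B n" "push n lam (ldiff U) b0 \<noteq> 0"
      using push_eq_0_iff[OF gm nz, of "ldiff U"] v by blast
    then have "(\<Sum>b'\<in>B (Suc n). \<kappa>' b' * mt n b' b0) \<noteq> 0" using eq by auto
    then obtain b where b: "b \<in> B (Suc n)" "\<kappa>' b * mt n b b0 \<noteq> 0"
      by (rule sum.not_neutral_contains_not_neutral)
    have "\<kappa>' b * mt n b b' = push n lam (ldiff U) b'" if b': "b' \<in> B n" for b'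
    proof -
      \<comment> \<open>Only generators of degree \<open>ind U\<close> contribute and
        \<open>b\<close> is the only one, so the preimage is a multiple of \<open>b\<close>; the
        factor is the new scalar.\<close>
      have z: "\<kappa>' x = 0" if "x \<in> B (Suc n)" "x \<noteq> b" for x
        using unique[OF that(1) _ b(1) _ U] dgU that b by auto
      have "(\<Sum>x\<in>B (Suc n). \<kappa>' x * mt n x b') = (\<Sum>x\<in>{b}. \<kappa>' x * mt n x b')"
        using b z finB by (intro sum.mono_neutral_right) auto
      then show ?thesis using eq b' by simp
    qed
    then show ?thesis using b dgU[OF b(1)] by auto
  qed
  have gm': "gens_matched (Suc n)" unfolding gens_matched_def
  proof (intro conjI ballI)
    fix U assume U: "U \<in> lgens (Suc n)"
    then obtain b where "b \<in> B (Suc n)" "dg (Suc n) b = ind U" using ex by blast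
    then show "\<exists>!b. b \<in> B (Suc n) \<and> dg (Suc n) b = ind U"
      using unique[OF _ _ _ _ U] by (intro ex1I[of _ b]) auto
  next
    fix b assume b: "b \<in> linear_part (Suc n)"
    show "\<exists>U\<in>lgens (Suc n). dg (Suc n) b = ind U"
      by (rule boundary_eq_push[OF m, of b]) (use b in \<open>auto simp: linear_part_def\<close>)
  qed
  have "\<forall>U\<in>lgens (Suc n). \<exists>l. l \<noteq> 0 \<and> (\<forall>b'\<in>B n. l * mt n (gen_at (Suc n) U) b' = push n lam (ldiff U) b')"
    using ex gen_at_unique[OF gm'] by metis
  then obtain lam' where lam': "\<forall>U\<in>lgens (Suc n). lam' U \<noteq> 0 \<and>
      (\<forall>b'\<in>B n. lam' U * mt n (gen_at (Suc n) U) b' = push n lam (ldiff U) b')"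
    by metis
  have "scycle B mt ag (Suc n) (push (Suc n) lam' \<kappa>) \<longleftrightarrow> lcycle (Suc n) \<kappa>" for \<kappa>
  proof -
    \<comment> \<open>\<open>push\<close> commutes with the differentials, so its injectivity turns
      one cycle condition into the other.\<close>
    have "(\<Sum>b\<in>B (Suc n). push (Suc n) lam' \<kappa> b * mt n b b') =
      push n lam (\<lambda>U'. \<Sum>U\<in>lgens (Suc n). \<kappa> U * ldiff U U') b'" if b': "b' \<in> B n" for b'
    proof -
      have "(\<Sum>b\<in>B (Suc n). push (Suc n) lam' \<kappa> b * mt n b b') =
        (\<Sum>U\<in>lgens (Suc n). \<kappa> U * push n lam (ldiff U) b')"
        unfolding sum_push[OF gm'] using lam' b' by (intro sum.cong) auto
      also have "\<dots> = push n lam (\<lambda>U'. \<Sum>U\<in>lgens (Suc n). \<kappa> U * ldiff U U') b'"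
        by (simp add: push_def sum_distrib_right mult.assoc)
      finally show ?thesis .
    qed
    then have "scycle B mt ag (Suc n) (push (Suc n) lam' \<kappa>) \<longleftrightarrow>
      (\<forall>b'\<in>B n. push n lam (\<lambda>U'. \<Sum>U\<in>lgens (Suc n). \<kappa> U * ldiff U U') b' = 0)"
      by (simp add: scycle_Suc)
    also have "\<dots> \<longleftrightarrow> lcycle (Suc n) \<kappa>"
      unfolding push_eq_0_iff[OF gm nz] by (simp add: lcycle_def)
    finally show ?thesis .
  qed
  then have "matched (Suc n) lam'" using gm' lam' by (auto simp: matched_def)
  moreover have "step_matched n lam lam'" using lam' by (auto simp: step_matched_def)
  ultimately show ?thesis by blast
qed

theorem linear_part_matched:
  obtains lam where "\<And>n. gens_matched n" "\<And>n U. U \<in> lgens n \<Longrightarrow> lam n U \<noteq> 0"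
    "\<And>n. step_matched n (lam n) (lam (Suc n))"
proof -
  obtain lam where "\<forall>n. matched n (lam n) \<and> step_matched n (lam n) (lam (Suc n))"
    using dependent_nat_choice[of matched step_matched] matched_0 matched_Suc by blast
  then show ?thesis using that[of lam] by (auto simp: matched_def)
qed

end

section \<open>Polynomials and squarefree monomial ideals\<close>

lemma poly_ring_simps [simp]:
  "(\<otimes>\<^bsub>poly_ring V\<^esub>) = (*)" "\<one>\<^bsub>poly_ring V\<^esub> = 1" "\<zero>\<^bsub>poly_ring V\<^esub> = 0" "(\<oplus>\<^bsub>poly_ring V\<^esub>) = (+)"
  by (simp_all add: poly_ring_def)

lemma in_carrier_poly_ring: "p \<in> carrier (poly_ring V) \<longleftrightarrow> (\<forall>t\<in>Poly_Mapping.keys p. supp t \<subseteq> V)"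
  by (simp add: poly_ring_def)

lemma supp_add: "supp (s + t) = supp s \<union> supp (t :: 'v monom)"
  by (auto simp: in_keys_iff lookup_add)

lemma supp_diff_subset: "supp (s - t) \<subseteq> supp (s :: 'v monom)"
  by (auto simp: in_keys_iff lookup_minus)

lemma mdivides_iff_add_diff: "mdivides s t \<longleftrightarrow> s + (t - s) = t"
  by (auto simp: mdivides_def poly_mapping_eq_iff lookup_add lookup_minus fun_eq_iff)
    (metis le_add1)

lemma mdivides_add [simp]: "mdivides s (s + t)"
  by (simp add: mdivides_def lookup_add)

lemma mdivides_refl [simp]: "mdivides t t"
  by (simp add: mdivides_def)

lemma mdivides_supp: "mdivides s t \<Longrightarrow> supp s \<subseteq> supp t"
  by (auto simp: mdivides_def in_keys_iff) (meson less_le_trans)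

lemma mdivides_squarefree:
  assumes "squarefree_monom s"
  shows "mdivides s t \<longleftrightarrow> supp s \<subseteq> supp t"
proof
  assume *: "supp s \<subseteq> supp t"
  show "mdivides s t" unfolding mdivides_def
  proof
    fix v
    show "expo s v \<le> expo t v"
      using assms * by (cases "v \<in> supp s") (auto simp: squarefree_monom_def in_keys_iff, metis (no_types) One_nat_def Suc_leI le_trans neq0_conv subsetD lookup_not_eq_zero_eq_in_keys)
  qed
qed (rule mdivides_supp)

lemma poly_mapping_sum_singles:
  "(\<Sum>t\<in>Poly_Mapping.keys p. Poly_Mapping.single t (Poly_Mapping.lookup p t)) = p"
proof (rule poly_mapping_eqI)
  fix u
  show "Poly_Mapping.lookup (\<Sum>t\<in>Poly_Mapping.keys p. Poly_Mapping.single t (Poly_Mapping.lookup p t)) u =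
    Poly_Mapping.lookup p u"
    by (simp add: lookup_sum lookup_single when_def sum.delta' in_keys_iff cong: if_cong)
qed

lemma lookup_single_mult:
  "Poly_Mapping.lookup (Poly_Mapping.single s a * q) t =
    (if mdivides s t then a * Poly_Mapping.lookup q (t - s) else 0)"
  for s t :: "'v monom" and q :: "('v, 'k::field) mpoly"
proof -
  let ?S = "Poly_Mapping.keys q"
  have "Poly_Mapping.single s a * q =
    (\<Sum>u\<in>?S. Poly_Mapping.single (s + u) (a * Poly_Mapping.lookup q u))"
    by (subst poly_mapping_sum_singles[of q, symmetric]) (simp add: sum_distrib_left mult_single)
  then have "Poly_Mapping.lookup (Poly_Mapping.single s a * q) t =
    (\<Sum>u\<in>?S. if s + u = t then a * Poly_Mapping.lookup q u else 0)"
    by (simp add: lookup_sum lookup_single when_def)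
  also have "\<dots> = (if mdivides s t then a * Poly_Mapping.lookup q (t - s) else 0)"
  proof (cases "mdivides s t")
    case True
    then have "s + u = t \<longleftrightarrow> u = t - s" for u
      by (auto simp: mdivides_iff_add_diff)
    then show ?thesis using True by (simp add: sum.delta' in_keys_iff)
  next
    case False
    then have "s + u \<noteq> t" for u using mdivides_add by blast
    then show ?thesis using False by simp
  qed
  finally show ?thesis .
qed

lemma lookup_mult_mpoly:
  "Poly_Mapping.lookup (p * q) t =
    (\<Sum>s\<in>{s\<in>Poly_Mapping.keys p. mdivides s t}. Poly_Mapping.lookup p s * Poly_Mapping.lookup q (t - s))"
  for p q :: "('v, 'k::field) mpoly"
proof -
  have "p * q = (\<Sum>s\<in>Poly_Mapping.keys p. Poly_Mapping.single s (Poly_Mapping.lookup p s) * q)"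
    by (subst poly_mapping_sum_singles[of p, symmetric]) (simp add: sum_distrib_right)
  then show ?thesis
    by (simp add: lookup_sum lookup_single_mult sum.If_cases Int_def)
qed

lemma keys_mult_subset:
  fixes p q :: "('v, 'k::field) mpoly"
  assumes "t \<in> Poly_Mapping.keys (p * q)"
  obtains s u where "s \<in> Poly_Mapping.keys p" "u \<in> Poly_Mapping.keys q" "t = s + u"
  using keys_mult[of p q] assms by blast

lemma keys_add_cases:
  assumes "t \<in> Poly_Mapping.keys (p + q)"
  shows "t \<in> Poly_Mapping.keys p \<or> t \<in> Poly_Mapping.keys q"
  using keys_add[of p q] assms by blast

lemma keys_uminus_mpoly [simp]: "Poly_Mapping.keys (- p) = Poly_Mapping.keys (p :: ('v, 'k::field) mpoly)"
  by (auto simp: in_keys_iff)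

lemma carrier_poly_ringD: "p \<in> carrier (poly_ring V) \<Longrightarrow> t \<in> Poly_Mapping.keys p \<Longrightarrow> supp t \<subseteq> V"
  by (simp add: in_carrier_poly_ring)

lemma poly_ring_closed:
  fixes p q :: "('v, 'k::field) mpoly"
  shows "0 \<in> carrier (poly_ring V :: ('v, 'k) mpoly ring)" "1 \<in> carrier (poly_ring V :: ('v, 'k) mpoly ring)"
    "p \<in> carrier (poly_ring V) \<Longrightarrow> - p \<in> carrier (poly_ring V)"
    "p \<in> carrier (poly_ring V) \<Longrightarrow> q \<in> carrier (poly_ring V) \<Longrightarrow> p + q \<in> carrier (poly_ring V)"
    "p \<in> carrier (poly_ring V) \<Longrightarrow> q \<in> carrier (poly_ring V) \<Longrightarrow> p * q \<in> carrier (poly_ring V)"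
proof -
  assume pq: "p \<in> carrier (poly_ring V)" "q \<in> carrier (poly_ring V)"
  show "p + q \<in> carrier (poly_ring V)"
    using pq by (simp add: in_carrier_poly_ring) (blast dest: keys_add_cases)
  show "p * q \<in> carrier (poly_ring V)"
    unfolding in_carrier_poly_ring
  proof
    fix t assume "t \<in> Poly_Mapping.keys (p * q)"
    then obtain s u where "s \<in> Poly_Mapping.keys p" "u \<in> Poly_Mapping.keys q" "t = s + u"
      by (rule keys_mult_subset)
    then show "supp t \<subseteq> V" using pq by (simp add: supp_add carrier_poly_ringD)
  qed
qed (simp_all add: in_carrier_poly_ring)

lemma cring_poly_ring: "cring (poly_ring V :: ('v, 'k::field) mpoly ring)"
proof (rule cringI)
  show "abelian_group (poly_ring V :: ('v, 'k) mpoly ring)"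
  proof (rule abelian_groupI)
    fix x :: "('v, 'k) mpoly" assume x: "x \<in> carrier (poly_ring V)"
    show "\<exists>y\<in>carrier (poly_ring V). y \<oplus>\<^bsub>poly_ring V\<^esub> x = \<zero>\<^bsub>poly_ring V\<^esub>"
      using poly_ring_closed(3)[OF x] by (intro bexI[of _ "- x"]) auto
  qed (simp_all add: poly_ring_closed add_ac)
  show "comm_monoid (poly_ring V :: ('v, 'k) mpoly ring)"
    by (rule comm_monoidI) (simp_all add: poly_ring_closed mult_ac)
qed (simp add: algebra_simps)

lemma monomial_mult_single: "Poly_Mapping.single s a * monomial t = Poly_Mapping.single (s + t) a"
  by (simp add: monomial_def mult_single)

lemma keys_monomial [simp]: "Poly_Mapping.keys (monomial t :: ('v, 'k::field) mpoly) = {t}"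
  by (simp add: monomial_def)

lemma sum_closed:
  assumes "(0::'a::comm_monoid_add) \<in> S" "\<And>x y. x \<in> S \<Longrightarrow> y \<in> S \<Longrightarrow> x + y \<in> S" "\<And>i. i \<in> A \<Longrightarrow> f i \<in> S"
  shows "(\<Sum>i\<in>A. f i) \<in> S"
  using assms(3)
proof (induction A rule: infinite_finite_induct)
  case (insert i A)
  then show ?case using assms(2) by auto
qed (use assms(1) in auto)

text \<open>The right side is an ideal containing the generators; conversely a polynomial is the sum
  of its terms, each of which is a multiple of some generator.\<close>

lemma genideal_monomials:
  fixes T :: "'v monom set"
  assumes T: "\<And>t. t \<in> T \<Longrightarrow> supp t \<subseteq> V"
  shows "genideal (poly_ring V) (monomial ` T) =
    {p :: ('v, 'k::field) mpoly. \<forall>t\<in>Poly_Mapping.keys p. supp t \<subseteq> V \<and> (\<exists>s\<in>T. mdivides s t)}"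
    (is "?I = ?J")
proof
  let ?R = "poly_ring V :: ('v, 'k) mpoly ring"
  interpret cring ?R by (rule cring_poly_ring)
  have sub: "monomial ` T \<subseteq> carrier ?R" using T by (auto simp: in_carrier_poly_ring)
  have "ideal ?J ?R"
  proof (rule idealI)
    show "ring ?R" ..
    show "subgroup ?J (add_monoid ?R)"
    proof (rule group.subgroupI)
      show "group (add_monoid ?R)" by (rule a_group)
      show "?J \<subseteq> carrier (add_monoid ?R)" by (auto simp: in_carrier_poly_ring)
      have "0 \<in> ?J" by simp
      then show "?J \<noteq> {}" by blast
      fix a assume a: "a \<in> ?J"
      then have "a \<in> carrier ?R" by (auto simp: in_carrier_poly_ring)
      then have "\<ominus>\<^bsub>?R\<^esub> a = - a"
        by (intro minus_equality) (auto simp: in_carrier_poly_ring)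
      then show "inv\<^bsub>add_monoid ?R\<^esub> a \<in> ?J" using a by (simp add: a_inv_def)
      fix b assume b: "b \<in> ?J"
      then show "a \<otimes>\<^bsub>add_monoid ?R\<^esub> b \<in> ?J" using a by (auto dest: keys_add_cases)
    qed
    fix a x assume a: "a \<in> ?J" and x: "x \<in> carrier ?R"
    have "x * a \<in> ?J"
      unfolding mem_Collect_eq
    proof (intro ballI conjI)
      fix t assume "t \<in> Poly_Mapping.keys (x * a)"
      then obtain s u where su: "s \<in> Poly_Mapping.keys x" "u \<in> Poly_Mapping.keys a" "t = s + u"
        by (rule keys_mult_subset)
      then show "supp t \<subseteq> V"
        using a carrier_poly_ringD[OF x] by (simp add: supp_add)
      obtain w where "w \<in> T" "mdivides w u" using a su by auto
      then show "\<exists>s\<in>T. mdivides s t"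
        using su by (auto simp: mdivides_def lookup_add intro!: bexI[of _ w] trans_le_add2)
    qed
    then show "x \<otimes>\<^bsub>?R\<^esub> a \<in> ?J" "a \<otimes>\<^bsub>?R\<^esub> x \<in> ?J" by (simp_all add: mult.commute)
  qed
  moreover have "monomial ` T \<subseteq> ?J"
  proof
    fix p :: "('v, 'k) mpoly" assume "p \<in> monomial ` T"
    then obtain t where t: "t \<in> T" "p = monomial t" by blast
    then have "\<exists>s\<in>T. mdivides s t" using mdivides_refl by blast
    then show "p \<in> ?J" using t T[OF t(1)] by simp
  qed
  ultimately show "?I \<subseteq> ?J" by (rule genideal_minimal)
  show "?J \<subseteq> ?I"
  proof
    fix p :: "('v, 'k) mpoly" assume p: "p \<in> ?J"
    interpret I: ideal ?I ?R by (rule genideal_ideal[OF sub])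
    have "(\<Sum>t\<in>Poly_Mapping.keys p. Poly_Mapping.single t (Poly_Mapping.lookup p t)) \<in> ?I"
    proof (rule sum_closed)
      show "0 \<in> ?I" using I.zero_closed by simp
      show "x + y \<in> ?I" if "x \<in> ?I" "y \<in> ?I" for x y using I.a_closed[OF that] by simp
      fix t assume t: "t \<in> Poly_Mapping.keys p"
      then obtain s where s: "s \<in> T" "mdivides s t" using p by auto
      have "monomial s \<in> ?I" using genideal_self[OF sub] s by auto
      moreover have "Poly_Mapping.single (t - s) (Poly_Mapping.lookup p t) \<in> carrier ?R"
        using p t supp_diff_subset[of t s] by (auto simp: in_carrier_poly_ring)
      ultimately have "Poly_Mapping.single (t - s) (Poly_Mapping.lookup p t) \<otimes>\<^bsub>?R\<^esub> monomial s \<in> ?I"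
        by (rule I.I_l_closed)
      then show "Poly_Mapping.single t (Poly_Mapping.lookup p t) \<in> ?I"
        using s by (simp add: monomial_mult_single mdivides_iff_add_diff add.commute)
    qed
    then show "p \<in> ?I" by (simp add: poly_mapping_sum_singles)
  qed
qed

section \<open>Squarefree monomials and ideals determined by supports\<close>

definition set_monom :: "'v set \<Rightarrow> 'v monom" where
  "set_monom D = (\<Sum>v\<in>D. Poly_Mapping.single v 1)"

lemma expo_set_monom: "finite D \<Longrightarrow> expo (set_monom D) v = (if v \<in> D then 1 else 0)"
  by (simp add: set_monom_def lookup_sum lookup_single when_def)

lemma supp_set_monom [simp]: "finite D \<Longrightarrow> supp (set_monom D) = D"
  by (auto simp: in_keys_iff expo_set_monom split: if_splits)

lemma squarefree_set_monom: "finite D \<Longrightarrow> squarefree_monom (set_monom D)"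
  by (simp add: squarefree_monom_def expo_set_monom)

lemma mdeg_set_monom [simp]: "finite D \<Longrightarrow> mdeg (set_monom D) = ind D"
  by (auto simp: mdeg_def ind_def expo_set_monom)

lemma mdeg_inject: "mdeg s = mdeg t \<longleftrightarrow> s = t"
  by (auto simp: mdeg_def poly_mapping_eq_iff fun_eq_iff)

lemma set_monom_insert: "finite D \<Longrightarrow> v \<notin> D \<Longrightarrow> set_monom (insert v D) = Poly_Mapping.single v 1 + set_monom D"
  by (simp add: set_monom_def)

lemma vars_prod_eq_monomial: "finite D \<Longrightarrow> vars_prod D = (monomial (set_monom D) :: ('v, 'k::field) mpoly)"
proof (induction D rule: finite_induct)
  case empty
  then show ?case by (simp add: vars_prod_def set_monom_def monomial_def)
next
  case (insert v D)
  then show ?case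
    by (simp add: vars_prod_def set_monom_insert var_def monomial_def mult_single)
qed

text \<open>For an upward closed family of sets of variables, this is a squarefree monomial ideal.\<close>

definition monomial_span :: "'v set \<Rightarrow> 'v set set \<Rightarrow> ('v, 'k::field) mpoly set" where
  "monomial_span V S = {p. \<forall>t\<in>Poly_Mapping.keys p. supp t \<subseteq> V \<and> supp t \<in> S}"

lemma monomial_in_span: "monomial t \<in> (monomial_span V S :: ('v, 'k::field) mpoly set) \<longleftrightarrow> supp t \<subseteq> V \<and> supp t \<in> S"
  by (simp add: monomial_span_def)

lemma vars_prod_in_span:
  "finite D \<Longrightarrow> vars_prod D \<in> (monomial_span V S :: ('v, 'k::field) mpoly set) \<longleftrightarrow> D \<subseteq> V \<and> D \<in> S"
  by (simp add: vars_prod_eq_monomial monomial_in_span)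

text \<open>For squarefree generators divisibility is inclusion of supports, so membership of a
  monomial depends on its support alone.\<close>

lemma genideal_squarefree:
  assumes "\<And>t. t \<in> T \<Longrightarrow> supp t \<subseteq> V" "\<And>t. t \<in> T \<Longrightarrow> squarefree_monom t"
  shows "genideal (poly_ring V) (monomial ` T) =
    (monomial_span V {S. \<exists>t\<in>T. supp t \<subseteq> S} :: ('v, 'k::field) mpoly set)"
proof -
  have "(\<exists>s\<in>T. mdivides s t) \<longleftrightarrow> (\<exists>s\<in>T. supp s \<subseteq> supp t)" for t
    using assms(2) mdivides_squarefree by blast
  then show ?thesis
    by (subst genideal_monomials[OF assms(1)]) (simp_all add: monomial_span_def)
qed

lemma edge_ideal_eq_span:
  assumes "finite V" "E \<subseteq> Pow V"
  shows "edge_ideal V E = (monomial_span V {S. \<exists>e\<in>E. e \<subseteq> S} :: ('v, 'k::field) mpoly set)"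
proof -
  have fin: "finite e" if "e \<in> E" for e using that assms finite_subset by blast
  have "vars_prod ` E = (monomial ` (set_monom ` E) :: ('v, 'k) mpoly set)"
    unfolding image_image by (rule image_cong) (auto simp: vars_prod_eq_monomial fin)
  moreover have "genideal (poly_ring V) (monomial ` (set_monom ` E)) =
      (monomial_span V {S. \<exists>t\<in>set_monom ` E. supp t \<subseteq> S} :: ('v, 'k) mpoly set)"
  proof (rule genideal_squarefree)
    fix t assume "t \<in> set_monom ` E"
    then obtain e where e: "e \<in> E" "t = set_monom e" by blast
    show "supp t \<subseteq> V" using e fin assms by auto
    show "squarefree_monom t" using e fin by (simp add: squarefree_set_monom)
  qed
  moreover have "(\<exists>t\<in>set_monom ` E. supp t \<subseteq> S) \<longleftrightarrow> (\<exists>e\<in>E. e \<subseteq> S)" for S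
    using fin by auto
  ultimately show ?thesis by (simp add: edge_ideal_def)
qed

lemma coprime_monom_iff: "coprime_monom s t \<longleftrightarrow> supp s \<inter> supp t = {}"
proof
  assume c: "coprime_monom s t"
  show "supp s \<inter> supp t = {}"
  proof (rule ccontr)
    assume "supp s \<inter> supp t \<noteq> {}"
    then obtain v where v: "v \<in> supp s" "v \<in> supp t" by blast
    then have "mdivides (Poly_Mapping.single v 1) s" "mdivides (Poly_Mapping.single v 1) t"
      by (auto simp: mdivides_def lookup_single when_def in_keys_iff)
    then have "Poly_Mapping.single v (1::nat) = 0" using c by (auto simp: coprime_monom_def)
    then show False by (metis keys_single keys_zero insert_not_empty zero_neq_one)
  qed
next
  assume *: "supp s \<inter> supp t = {}"
  show "coprime_monom s t" unfolding coprime_monom_def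
  proof (intro allI impI)
    fix c assume "mdivides c s \<and> mdivides c t"
    then have "supp c \<subseteq> supp s \<inter> supp t" using mdivides_supp by blast
    then show "c = 0" using * by (auto intro!: poly_mapping_eqI simp: in_keys_iff)
  qed
qed

text \<open>Coprimality sees only supports, and each \<open>D' \<in> S\<close> inside
  \<open>V\<close> is the support of a monomial of the ideal, namely
  \<open>set_monom D'\<close>.\<close>

lemma alexander_dual_span:
  assumes "finite V"
  shows "alexander_dual V (monomial_span V S :: ('v, 'k::field) mpoly set) =
    monomial_span V {D. \<forall>D'\<in>S. D' \<subseteq> V \<longrightarrow> D' \<inter> D \<noteq> {}}"
proof -
  let ?T = "{t. supp t \<subseteq> V \<and> (\<forall>D'\<in>S. D' \<subseteq> V \<longrightarrow> D' \<inter> supp t \<noteq> {})}"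
  have "(\<forall>s. (monomial s :: ('v, 'k) mpoly) \<in> monomial_span V S \<longrightarrow> \<not> coprime_monom s t) \<longleftrightarrow>
    (\<forall>D'\<in>S. D' \<subseteq> V \<longrightarrow> D' \<inter> supp t \<noteq> {})" for t :: "'v monom"
  proof safe
    fix D' assume *: "\<forall>s. (monomial s :: ('v, 'k) mpoly) \<in> monomial_span V S \<longrightarrow> \<not> coprime_monom s t"
      "D' \<in> S" "D' \<subseteq> V" "D' \<inter> supp t = {}"
    then have "finite D'" using assms finite_subset by blast
    then show False
      using *(1)[rule_format, of "set_monom D'"] *(2-4) by (simp add: monomial_in_span coprime_monom_iff)
  qed (auto simp: monomial_in_span coprime_monom_iff)
  then have "alexander_dual V (monomial_span V S :: ('v, 'k) mpoly set) =
    genideal (poly_ring V) (monomial ` ?T)"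
    by (simp add: alexander_dual_def)
  also have "\<dots> = monomial_span V {D. \<forall>D'\<in>S. D' \<subseteq> V \<longrightarrow> D' \<inter> D \<noteq> {}}"
  proof -
    have *: "(\<exists>s\<in>?T. mdivides s t) \<longleftrightarrow> (\<forall>D'\<in>S. D' \<subseteq> V \<longrightarrow> D' \<inter> supp t \<noteq> {})" if "supp t \<subseteq> V" for t
    proof
      assume "\<exists>s\<in>?T. mdivides s t"
      then obtain s where "\<forall>D'\<in>S. D' \<subseteq> V \<longrightarrow> D' \<inter> supp s \<noteq> {}" "supp s \<subseteq> supp t"
        using mdivides_supp by blast
      then show "\<forall>D'\<in>S. D' \<subseteq> V \<longrightarrow> D' \<inter> supp t \<noteq> {}" by blast
    next
      assume "\<forall>D'\<in>S. D' \<subseteq> V \<longrightarrow> D' \<inter> supp t \<noteq> {}"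
      then have "t \<in> ?T" using that by simp
      then show "\<exists>s\<in>?T. mdivides s t" using mdivides_refl by blast
    qed
    have eq: "(supp t \<subseteq> V \<and> (\<exists>s\<in>?T. mdivides s t)) \<longleftrightarrow>
      (supp t \<subseteq> V \<and> supp t \<in> {D. \<forall>D'\<in>S. D' \<subseteq> V \<longrightarrow> D' \<inter> D \<noteq> {}})" for t
      using *[of t] by (simp only: mem_Collect_eq cong: conj_cong)
    have "genideal (poly_ring V) (monomial ` ?T) =
        {p :: ('v, 'k) mpoly. \<forall>t\<in>Poly_Mapping.keys p. supp t \<subseteq> V \<and> (\<exists>s\<in>?T. mdivides s t)}"
      by (rule genideal_monomials) simp
    then show ?thesis unfolding monomial_span_def by (simp only: eq)
  qed
  finally show ?thesis .
qed

text \<open>The form in which minimality of a resolution is exploited: entries of the differential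
  have no constant term.\<close>

lemma maximal_ideal_lookup_0:
  assumes "p \<in> genideal (poly_ring V) (var ` V)"
  shows "Poly_Mapping.lookup (p :: ('v, 'k::field) mpoly) 0 = 0"
proof (rule ccontr)
  assume "Poly_Mapping.lookup p 0 \<noteq> 0"
  have "var ` V = (monomial ` ((\<lambda>v. Poly_Mapping.single v 1) ` V) :: ('v, 'k) mpoly set)"
    by (auto simp: var_def)
  then have "p \<in> {p. \<forall>t\<in>Poly_Mapping.keys p. supp t \<subseteq> V \<and> (\<exists>s\<in>(\<lambda>v. Poly_Mapping.single v 1) ` V. mdivides s t)}"
    using assms by (simp only:, subst (asm) genideal_monomials) auto
  then have "\<exists>v\<in>V. mdivides (Poly_Mapping.single v 1) (0 :: 'v monom)"
    using \<open>Poly_Mapping.lookup p 0 \<noteq> 0\<close> by (auto simp: in_keys_iff)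
  then obtain v where "mdivides (Poly_Mapping.single v 1) (0 :: 'v monom)" by blast
  then have "expo (Poly_Mapping.single v 1) v \<le> expo (0 :: 'v monom) v"
    unfolding mdivides_def by blast
  then show False by simp
qed

text \<open>Inverse of \<open>mdeg\<close> on the nonnegative degrees supported on a finite set.
  Negative components are truncated to exponent 0, whence the inequalities accompanying its
  use.\<close>

definition deg_monom :: "('v \<Rightarrow> int) \<Rightarrow> 'v monom" where
  "deg_monom c = Abs_poly_mapping (\<lambda>v. nat (c v))"

lemma expo_deg_monom:
  assumes "finite V" "c \<in> degrees V"
  shows "expo (deg_monom c) v = nat (c v)"
proof -
  have "finite {v. nat (c v) \<noteq> 0}"
    by (rule finite_subset[OF _ assms(1)]) (use assms(2) in \<open>force simp: degrees_def\<close>)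
  then show ?thesis by (simp add: deg_monom_def)
qed

lemma mdeg_deg_monom:
  assumes "finite V" "c \<in> degrees V" "\<forall>v. 0 \<le> c v"
  shows "mdeg (deg_monom c) = c"
  using assms by (auto simp: mdeg_def expo_deg_monom)

lemma deg_monom_mdeg [simp]: "deg_monom (mdeg t) = t"
  by (simp add: deg_monom_def mdeg_def lookup_inverse)

lemma mdeg_nonneg: "0 \<le> mdeg t v"
  by (simp add: mdeg_def)

lemma mdeg_degrees: "supp t \<subseteq> V \<longleftrightarrow> mdeg t \<in> degrees V"
  by (auto simp: mdeg_def degrees_def in_keys_iff)

lemma mdeg_add: "mdeg (s + t) = (\<lambda>v. mdeg s v + mdeg t v)"
  by (auto simp: mdeg_def lookup_add)

lemma mdeg_0 [simp]: "mdeg 0 = (\<lambda>v. 0)"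
  by (simp add: mdeg_def)

lemma mdeg_single: "mdeg (Poly_Mapping.single v 1) = ind {v}"
  by (auto simp: mdeg_def ind_def lookup_single when_def)

text \<open>Each multidegree of a polynomial ring has dimension at most one; this is what reduces
  homogeneous maps to matrices of scalars.\<close>

lemma homogeneous_eq_single:
  assumes "p \<in> homogeneous V c"
  shows "p = Poly_Mapping.single (deg_monom c) (Poly_Mapping.lookup p (deg_monom c))"
proof (rule poly_mapping_eqI)
  fix t
  show "Poly_Mapping.lookup p t =
    Poly_Mapping.lookup (Poly_Mapping.single (deg_monom c) (Poly_Mapping.lookup p (deg_monom c))) t"
    using assms by (cases "t \<in> Poly_Mapping.keys p")
      (auto simp: homogeneous_def lookup_single when_def in_keys_iff)
qed

lemma homogeneous_eq_0:
  assumes "p \<in> homogeneous V c" "\<not> (c \<in> degrees V \<and> (\<forall>v. 0 \<le> c v))"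
  shows "p = 0"
proof (rule ccontr)
  assume "p \<noteq> 0"
  then obtain t where t: "t \<in> Poly_Mapping.keys p"
    by (metis all_not_in_conv keys_eq_empty)
  then have "mdeg t = c" "supp t \<subseteq> V"
    using assms(1) by (auto simp: homogeneous_def in_carrier_poly_ring)
  then show False using assms(2) mdeg_nonneg[of t] by (auto simp: mdeg_degrees)
qed

lemma single_homogeneous:
  "supp t \<subseteq> V \<Longrightarrow> mdeg t = c \<Longrightarrow> Poly_Mapping.single t a \<in> homogeneous V c"
  by (auto simp: homogeneous_def in_carrier_poly_ring)

lemma homogeneous_0 [simp]: "0 \<in> homogeneous V c"
  by (auto simp: homogeneous_def in_carrier_poly_ring)

lemma homogeneous_add: "p \<in> homogeneous V c \<Longrightarrow> q \<in> homogeneous V c \<Longrightarrow> p + q \<in> homogeneous V c"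
  by (auto simp: homogeneous_def poly_ring_closed dest: keys_add_cases)

lemma homogeneous_mult:
  assumes "p \<in> homogeneous V b" "q \<in> homogeneous V c"
  shows "p * q \<in> homogeneous V (\<lambda>v. b v + c v)"
  using assms by (auto simp: homogeneous_def poly_ring_closed mdeg_add elim!: keys_mult_subset)

definition pfilter :: "('v monom \<Rightarrow> bool) \<Rightarrow> ('v, 'k::field) mpoly \<Rightarrow> ('v, 'k) mpoly" where
  "pfilter P p = Poly_Mapping.mapp (\<lambda>t a. if P t then a else 0) p"

lemma lookup_pfilter: "Poly_Mapping.lookup (pfilter P p) t = (if P t then Poly_Mapping.lookup p t else 0)"
  by (simp add: pfilter_def lookup_mapp when_def in_keys_iff)

lemma pfilter_add: "pfilter P (p + q) = pfilter P p + pfilter P q"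
  by (rule poly_mapping_eqI) (simp add: lookup_pfilter lookup_add)

lemma pfilter_0 [simp]: "pfilter P 0 = 0"
  by (rule poly_mapping_eqI) (simp add: lookup_pfilter)

lemma keys_pfilter: "Poly_Mapping.keys (pfilter P p) = {t\<in>Poly_Mapping.keys p. P t}"
  by (auto simp: in_keys_iff lookup_pfilter split: if_splits)

lemma (in abelian_monoid) additive_finsum:
  fixes h :: "_ \<Rightarrow> 's::comm_monoid_add"
  assumes "h \<zero> = 0" "\<And>x y. x \<in> carrier G \<Longrightarrow> y \<in> carrier G \<Longrightarrow> h (x \<oplus> y) = h x + h y"
    and "f \<in> A \<rightarrow> carrier G"
  shows "h (finsum G f A) = (\<Sum>i\<in>A. h (f i))"
  using assms(3)
proof (induction A rule: infinite_finite_induct)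
  case (insert i A)
  then show ?case using assms(1,2) by (auto simp: finsum_insert)
qed (use assms(1) in auto)

section \<open>Quotients of squarefree monomial ideals\<close>

lemma monomial_span_carrier: "x \<in> monomial_span V S \<Longrightarrow> x \<in> carrier (poly_ring V)"
  by (simp add: monomial_span_def in_carrier_poly_ring)

lemma monomial_span_0 [simp]: "0 \<in> monomial_span V S"
  by (simp add: monomial_span_def)

lemma monomial_span_add: "x \<in> monomial_span V S \<Longrightarrow> y \<in> monomial_span V S \<Longrightarrow> x + y \<in> monomial_span V S"
  unfolding monomial_span_def by (auto dest: keys_add_cases)

lemma monomial_span_uminus: "x \<in> monomial_span V S \<Longrightarrow> - x \<in> monomial_span V S"
  by (simp add: monomial_span_def)

lemma monomial_span_diff:
  "x \<in> monomial_span V S \<Longrightarrow> y \<in> monomial_span V S \<Longrightarrow> x - y \<in> monomial_span V S"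
  using monomial_span_add[of x V S "- y"] monomial_span_uminus[of y V S] by simp

lemma monomial_span_mult:
  assumes "\<And>D D'. D \<in> S \<Longrightarrow> D \<subseteq> D' \<Longrightarrow> D' \<subseteq> V \<Longrightarrow> D' \<in> S"
    and p: "p \<in> carrier (poly_ring V)" and x: "x \<in> monomial_span V S"
  shows "p * x \<in> monomial_span V S"
  unfolding monomial_span_def mem_Collect_eq
proof (intro ballI conjI)
  fix t assume "t \<in> Poly_Mapping.keys (p * x)"
  then obtain s u where su: "s \<in> Poly_Mapping.keys p" "u \<in> Poly_Mapping.keys x" "t = s + u"
    by (rule keys_mult_subset)
  then have "supp s \<subseteq> V" "supp u \<subseteq> V" "supp u \<in> S"
    using p x by (auto simp: monomial_span_def in_carrier_poly_ring)
  then show "supp t \<subseteq> V" "supp t \<in> S"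
    using assms(1)[of "supp u" "supp t"] su by (auto simp: supp_add)
qed

lemma monomial_span_single:
  "supp t \<subseteq> V \<Longrightarrow> supp t \<in> S \<Longrightarrow> Poly_Mapping.single t a \<in> monomial_span V S"
  by (auto simp: monomial_span_def)

text \<open>\<open>JJ\<close> and \<open>PP\<close> are the supports of the monomials of two nested
  ideals, in the application the dual ideal and the ideal of the regular sequence. Upward closure
  inside \<open>W\<close> is what makes the spans ideals.\<close>

locale squarefree_quotient =
  fixes W :: "'v set" and JJ PP :: "'v set set"
  assumes finW: "finite W"
    and JJ_up: "D \<in> JJ \<Longrightarrow> D \<subseteq> D' \<Longrightarrow> D' \<subseteq> W \<Longrightarrow> D' \<in> JJ"
    and PP_up: "D \<in> PP \<Longrightarrow> D \<subseteq> D' \<Longrightarrow> D' \<subseteq> W \<Longrightarrow> D' \<in> PP"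
    and PP_JJ: "D \<in> PP \<Longrightarrow> D \<subseteq> W \<Longrightarrow> D \<in> JJ"
begin

abbreviation J :: "('v, 'k::field) mpoly set" where "J \<equiv> monomial_span W JJ"

abbreviation P :: "('v, 'k::field) mpoly set" where "P \<equiv> monomial_span W PP"

definition M :: "(('v, 'k::field) mpoly, ('v, 'k) mpoly set, 'v) gmodule" where
  "M = quotient_module (ideal_module W J) P"

definition cl :: "('v, 'k::field) mpoly \<Rightarrow> ('v, 'k) mpoly set" where
  "cl x = (\<lambda>p. p + x) ` P"

text \<open>The representative of a coset without monomials in P.\<close>

definition nf :: "('v, 'k::field) mpoly set \<Rightarrow> ('v, 'k) mpoly" where
  "nf X = pfilter (\<lambda>t. supp t \<notin> PP) (SOME x. x \<in> X)"

lemma J_mult: "p \<in> carrier (poly_ring W) \<Longrightarrow> x \<in> J \<Longrightarrow> p * x \<in> J"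
  by (rule monomial_span_mult[OF JJ_up])

lemma P_mult: "p \<in> carrier (poly_ring W) \<Longrightarrow> x \<in> P \<Longrightarrow> p * x \<in> P"
  by (rule monomial_span_mult[OF PP_up])

lemma in_cl_iff: "y \<in> cl x \<longleftrightarrow> y - x \<in> P"
  by (auto simp: cl_def image_iff) (metis add.commute add_diff_cancel_left' diff_add_cancel)

lemma cl_self: "x \<in> cl x"
  by (simp add: in_cl_iff)

lemma cl_eq_iff: "cl x = cl y \<longleftrightarrow> x - y \<in> P"
proof
  assume "cl x = cl y"
  then show "x - y \<in> P" using cl_self[of x] by (simp add: in_cl_iff)
next
  assume xy: "x - y \<in> P"
  have "z - x \<in> P \<longleftrightarrow> z - y \<in> P" for z
    using monomial_span_add[OF _ xy, of "z - x"] monomial_span_diff[OF _ xy, of "z - y"] by auto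
  then show "cl x = cl y" by (auto simp: in_cl_iff)
qed

lemma pfilter_P_eq_0_iff:
  assumes "x \<in> carrier (poly_ring W)"
  shows "pfilter (\<lambda>t. supp t \<notin> PP) x = 0 \<longleftrightarrow> x \<in> P"
proof -
  have "pfilter (\<lambda>t. supp t \<notin> PP) x = 0 \<longleftrightarrow> (\<forall>t\<in>Poly_Mapping.keys x. supp t \<in> PP)"
    by (subst keys_eq_empty[symmetric]) (auto simp: keys_pfilter)
  then show ?thesis using assms by (auto simp: monomial_span_def in_carrier_poly_ring)
qed

text \<open>The arbitrary choice in \<open>nf\<close> is harmless: two representatives differ by an
  element of \<open>P\<close>, which the filter removes.\<close>

lemma nf_cl [simp]: "nf (cl x) = pfilter (\<lambda>t. supp t \<notin> PP) x"
proof -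
  have "(SOME y. y \<in> cl x) \<in> cl x" using cl_self by (rule someI)
  then obtain p where p: "p \<in> P" "(SOME y. y \<in> cl x) = p + x" by (auto simp: cl_def)
  then show ?thesis
    using pfilter_P_eq_0_iff[OF monomial_span_carrier[OF p(1)]] by (simp add: nf_def pfilter_add)
qed

lemma M_carrier: "carrier M = cl ` J"
  by (auto simp: M_def quotient_module_def ideal_module_def A_RCOSETS_def RCOSETS_def r_coset_def cl_def)

lemma M_zero: "\<zero>\<^bsub>M\<^esub> = cl 0"
  by (auto simp: M_def quotient_module_def cl_def)

lemma M_add: "cl x \<oplus>\<^bsub>M\<^esub> cl y = cl (x + y)"
proof -
  have "cl x \<oplus>\<^bsub>M\<^esub> cl y = {a + b | a b. a \<in> cl x \<and> b \<in> cl y}"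
    by (auto simp: M_def quotient_module_def ideal_module_def set_add_def set_mult_def)
  also have "\<dots> = cl (x + y)"
  proof (intro equalityI subsetI)
    fix z assume "z \<in> {a + b | a b. a \<in> cl x \<and> b \<in> cl y}"
    then obtain p q where "p \<in> P" "q \<in> P" "z = (p + x) + (q + y)" by (auto simp: cl_def)
    then have "z = (p + q) + (x + y)" "p + q \<in> P" by (auto simp: monomial_span_add)
    then show "z \<in> cl (x + y)" by (auto simp: cl_def)
  next
    fix z assume "z \<in> cl (x + y)"
    then obtain p where p: "p \<in> P" "z = p + (x + y)" by (auto simp: cl_def)
    then have "z = (p + x) + y" "p + x \<in> cl x" "y \<in> cl y" by (auto simp: cl_self cl_def)
    then show "z \<in> {a + b | a b. a \<in> cl x \<and> b \<in> cl y}" by blast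
  qed
  finally show ?thesis .
qed

lemma a_r_coset_ideal_module: "a_r_coset (ideal_module W J) P y = cl y"
  by (auto simp: a_r_coset_def r_coset_def ideal_module_def cl_def)

text \<open>The quotient multiplies all representatives and takes the union; the resulting cosets
  coincide because \<open>P\<close> absorbs multiplication.\<close>

lemma M_smult: "p \<in> carrier (poly_ring W) \<Longrightarrow> p \<odot>\<^bsub>M\<^esub> cl x = cl (p * x)"
proof -
  assume p: "p \<in> carrier (poly_ring W)"
  have "p \<odot>\<^bsub>M\<^esub> cl x = (\<Union>y\<in>cl x. cl (p \<odot>\<^bsub>ideal_module W J\<^esub> y))"
    by (simp add: M_def quotient_module_def a_r_coset_ideal_module)
  also have "\<dots> = (\<Union>y\<in>cl x. cl (p * y))"
    by (simp add: ideal_module_def)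
  also have "\<dots> = (\<Union>y\<in>cl x. cl (p * x))"
  proof (rule SUP_cong)
    fix y assume "y \<in> cl x"
    then show "cl (p * y) = cl (p * x)"
      using P_mult[OF p, of "y - x"] by (simp add: cl_eq_iff in_cl_iff algebra_simps)
  qed simp
  also have "\<dots> = cl (p * x)" using cl_self[of x] by blast
  finally show ?thesis .
qed

lemma M_grd: "grd M c = cl ` (J \<inter> homogeneous W c)"
proof -
  have "grd M c = cl ` grd (ideal_module W J) c"
    by (simp add: M_def quotient_module_def a_r_coset_ideal_module image_def)
  then show ?thesis by (simp add: ideal_module_def)
qed

lemma grd_in_carrier: "X \<in> grd M c \<Longrightarrow> X \<in> carrier M"
  by (auto simp: M_grd M_carrier)

text \<open>Equations in the quotient become equations between coefficients of polynomials.\<close>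

lemma nf_inject:
  assumes "X \<in> carrier M" "Y \<in> carrier M" "nf X = nf Y"
  shows "X = Y"
proof -
  obtain x y where xy: "x \<in> J" "X = cl x" "y \<in> J" "Y = cl y"
    using assms by (auto simp: M_carrier)
  have "pfilter (\<lambda>t. supp t \<notin> PP) (x - y) = pfilter (\<lambda>t. supp t \<notin> PP) x - pfilter (\<lambda>t. supp t \<notin> PP) y"
    by (rule poly_mapping_eqI) (simp add: lookup_pfilter lookup_minus)
  then have "x - y \<in> P"
    using assms(3) xy monomial_span_diff[OF xy(1,3)] monomial_span_carrier
    by (subst pfilter_P_eq_0_iff[symmetric]) auto
  then show ?thesis using xy by (simp add: cl_eq_iff)
qed

lemma cring_ring: "cring (poly_ring W :: ('v, 'k::field) mpoly ring)"
  by (rule cring_poly_ring)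

lemma M_abelian_group: "abelian_group (M :: (('v, 'k::field) mpoly, ('v, 'k) mpoly set, 'v) gmodule)"
proof (rule abelian_groupI)
  fix X :: "('v, 'k) mpoly set" assume "X \<in> carrier M"
  then obtain x where x: "x \<in> J" "X = cl x" by (auto simp: M_carrier)
  show "\<exists>Y\<in>carrier M. Y \<oplus>\<^bsub>M\<^esub> X = \<zero>\<^bsub>M\<^esub>"
    using x monomial_span_uminus[OF x(1)]
    by (intro bexI[of _ "cl (- x)"]) (auto simp: M_carrier M_add M_zero)
qed (auto simp: M_carrier M_add M_zero monomial_span_add add_ac)

lemma M_module: "module (poly_ring W) (M :: (('v, 'k::field) mpoly, ('v, 'k) mpoly set, 'v) gmodule)"
  by (rule moduleI[OF cring_ring M_abelian_group])
    (auto simp: M_carrier M_add M_smult J_mult poly_ring_closed algebra_simps)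

lemma M_uminus:
  assumes "x \<in> (J :: ('v, 'k::field) mpoly set)"
  shows "\<ominus>\<^bsub>M\<^esub> cl x = cl (- x)"
proof -
  interpret abelian_group "M :: (('v, 'k) mpoly, ('v, 'k) mpoly set, 'v) gmodule"
    by (rule M_abelian_group)
  show ?thesis using assms
    by (intro minus_equality) (auto simp: M_add M_zero M_carrier monomial_span_uminus)
qed

lemma nf_add: "X \<in> carrier M \<Longrightarrow> Y \<in> carrier M \<Longrightarrow> nf (X \<oplus>\<^bsub>M\<^esub> Y) = nf X + nf Y"
  by (auto simp: M_carrier M_add pfilter_add)

lemma nf_zero [simp]: "nf \<zero>\<^bsub>M\<^esub> = 0"
  by (simp add: M_zero)

lemma nf_finsum:
  fixes f :: "'i \<Rightarrow> ('v, 'k::field) mpoly set"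
  assumes "f \<in> A \<rightarrow> carrier M"
  shows "nf (finsum M f A) = (\<Sum>i\<in>A. nf (f i))"
proof -
  interpret abelian_group "M :: (('v, 'k) mpoly, ('v, 'k) mpoly set, 'v) gmodule"
    by (rule M_abelian_group)
  show ?thesis by (rule additive_finsum) (use assms in \<open>auto simp: nf_add\<close>)
qed

lemma finsum_cl:
  fixes g :: "'i \<Rightarrow> ('v, 'k::field) mpoly"
  assumes "\<And>i. i \<in> A \<Longrightarrow> g i \<in> J"
  shows "finsum M (\<lambda>i. cl (g i)) A = cl (\<Sum>i\<in>A. g i)"
proof -
  interpret abelian_group "M :: (('v, 'k) mpoly, ('v, 'k) mpoly set, 'v) gmodule"
    by (rule M_abelian_group)
  show ?thesis using assms
  proof (induction A rule: infinite_finite_induct)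
    case (insert i A)
    have "finsum M (\<lambda>i. cl (g i)) (insert i A) = cl (g i) \<oplus>\<^bsub>M\<^esub> finsum M (\<lambda>i. cl (g i)) A"
      using insert by (intro finsum_insert) (auto simp: M_carrier)
    then show ?case using insert by (simp add: M_add)
  qed (auto simp: M_zero)
qed

lemma grd_nf_keys:
  assumes "X \<in> grd M c" "t \<in> Poly_Mapping.keys (nf X)"
  shows "mdeg t = c"
  using assms by (auto simp: M_grd keys_pfilter homogeneous_def)

lemma single_in_J:
  assumes "x \<in> J" "x \<in> homogeneous W c" "x \<noteq> 0"
  shows "supp (deg_monom c) \<subseteq> W" "supp (deg_monom c) \<in> JJ" "mdeg (deg_monom c) = c"
proof -
  obtain t where t: "t \<in> Poly_Mapping.keys x"
    using assms(3) by (metis all_not_in_conv keys_eq_empty)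
  then have "mdeg t = c" using assms(2) by (simp add: homogeneous_def)
  then have "deg_monom c = t" by auto
  then show "supp (deg_monom c) \<subseteq> W" "supp (deg_monom c) \<in> JJ" "mdeg (deg_monom c) = c"
    using t assms(1) \<open>mdeg t = c\<close> by (auto simp: monomial_span_def)
qed

lemma M_grd_zero: "\<zero>\<^bsub>M\<^esub> \<in> grd M c"
  by (auto simp: M_grd M_zero)

lemma M_grd_subgroup: "additive_subgroup (grd M c) (M :: (('v, 'k::field) mpoly, ('v, 'k) mpoly set, 'v) gmodule)"
proof -
  interpret abelian_group "M :: (('v, 'k) mpoly, ('v, 'k) mpoly set, 'v) gmodule"
    by (rule M_abelian_group)
  show ?thesis
  proof (rule additive_subgroup.intro, rule group.subgroupI[OF a_group])
    show "grd M c \<subseteq> carrier (add_monoid M)" using grd_in_carrier by auto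
    show "grd M c \<noteq> {}" using M_grd_zero by auto
    fix X :: "('v, 'k) mpoly set" assume "X \<in> grd M c"
    then obtain x where x: "x \<in> J" "x \<in> homogeneous W c" "X = cl x" by (auto simp: M_grd)
    have "- x \<in> J \<inter> homogeneous W c"
      using x by (simp add: monomial_span_uminus homogeneous_def poly_ring_closed)
    then show "inv\<^bsub>add_monoid M\<^esub> X \<in> grd M c"
      using M_uminus[OF x(1)] x(3) by (auto simp: M_grd a_inv_def)
    fix Y :: "('v, 'k) mpoly set" assume "Y \<in> grd M c"
    then obtain y where y: "y \<in> J" "y \<in> homogeneous W c" "Y = cl y" by (auto simp: M_grd)
    show "X \<otimes>\<^bsub>add_monoid M\<^esub> Y \<in> grd M c"
      using x y by (auto simp: M_add M_grd monomial_span_add homogeneous_add)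
  qed
qed

lemma component_in_J: "x \<in> J \<Longrightarrow> pfilter Q x \<in> J"
  by (auto simp: monomial_span_def keys_pfilter)

lemma component_homogeneous:
  "x \<in> J \<Longrightarrow> pfilter (\<lambda>t. mdeg t = c) x \<in> homogeneous W c"
  by (auto simp: monomial_span_def homogeneous_def keys_pfilter in_carrier_poly_ring)

text \<open>At a monomial \<open>t\<close> only the summand of degree \<open>mdeg t\<close> has a
  coefficient. Thus a homogeneous family sums to a given element exactly when it is the family of
  its components, which settles existence and uniqueness of the decomposition together.\<close>

lemma component_nf:
  assumes f: "\<forall>c. f c \<in> grd M c" and fin: "finite {c. f c \<noteq> \<zero>\<^bsub>M\<^esub>}"
  shows "nf (finsum M f {c. f c \<noteq> \<zero>\<^bsub>M\<^esub>}) = x \<longleftrightarrow> (\<forall>c. nf (f c) = pfilter (\<lambda>t. mdeg t = c) x)"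
proof -
  let ?S = "{c. f c \<noteq> \<zero>\<^bsub>M\<^esub>}"
  have "nf (finsum M f ?S) = (\<Sum>c\<in>?S. nf (f c))"
    by (rule nf_finsum) (use f grd_in_carrier in blast)
  moreover have lk: "Poly_Mapping.lookup (\<Sum>c\<in>?S. nf (f c)) t = Poly_Mapping.lookup (nf (f (mdeg t))) t" for t
  proof -
    have "Poly_Mapping.lookup (\<Sum>c\<in>?S. nf (f c)) t =
      (\<Sum>c\<in>?S. if c = mdeg t then Poly_Mapping.lookup (nf (f c)) t else 0)"
      unfolding lookup_sum using f grd_nf_keys by (intro sum.cong) (auto simp: in_keys_iff)
    also have "\<dots> = Poly_Mapping.lookup (nf (f (mdeg t))) t"
      using fin by (auto simp: sum.delta')
    finally show ?thesis .
  qed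
  moreover have "(\<forall>t. Poly_Mapping.lookup (nf (f (mdeg t))) t = Poly_Mapping.lookup x t) \<longleftrightarrow>
    (\<forall>c. nf (f c) = pfilter (\<lambda>t. mdeg t = c) x)"
  proof
    assume *: "\<forall>t. Poly_Mapping.lookup (nf (f (mdeg t))) t = Poly_Mapping.lookup x t"
    show "\<forall>c. nf (f c) = pfilter (\<lambda>t. mdeg t = c) x"
    proof (intro allI poly_mapping_eqI)
      fix c t
      show "Poly_Mapping.lookup (nf (f c)) t = Poly_Mapping.lookup (pfilter (\<lambda>t. mdeg t = c) x) t"
        using * grd_nf_keys[of "f c" c t] f by (cases "mdeg t = c") (auto simp: lookup_pfilter in_keys_iff)
    qed
  qed (simp add: lookup_pfilter)
  ultimately show ?thesis by (simp add: poly_mapping_eq_iff fun_eq_iff)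
qed

lemma M_graded: "graded_module W (M :: (('v, 'k::field) mpoly, ('v, 'k) mpoly set, 'v) gmodule)"
  unfolding graded_module_def
proof (intro conjI allI impI ballI)
  let ?M = "M :: (('v, 'k) mpoly, ('v, 'k) mpoly set, 'v) gmodule"
  show "module (poly_ring W) ?M" by (rule M_module)
  show "additive_subgroup (grd ?M c) ?M" for c by (rule M_grd_subgroup)
  show "grd ?M c = {\<zero>\<^bsub>?M\<^esub>}" if "c \<notin> degrees W" for c
    using that homogeneous_eq_0[of _ W c] by (force simp: M_grd M_zero)
  show "p \<odot>\<^bsub>?M\<^esub> m \<in> grd ?M (\<lambda>v. b v + c v)" if h: "p \<in> homogeneous W b \<and> m \<in> grd ?M c" for b c p m
  proof -
    obtain x where x: "x \<in> J" "x \<in> homogeneous W c" "m = cl x" using h by (auto simp: M_grd)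
    have p: "p \<in> carrier (poly_ring W)" "p \<in> homogeneous W b" using h by (auto simp: homogeneous_def)
    show ?thesis using x p by (auto simp: M_smult M_grd J_mult homogeneous_mult)
  qed
  fix m assume m: "m \<in> carrier ?M"
  then obtain x where x: "x \<in> J" "m = cl x" by (auto simp: M_carrier)
  define f where "f = (\<lambda>c. cl (pfilter (\<lambda>t. mdeg t = c) x) :: ('v, 'k) mpoly set)"
  have f: "\<forall>c. f c \<in> grd ?M c"
    using component_in_J[OF x(1)] component_homogeneous[OF x(1)] by (auto simp: f_def M_grd)
  have fin: "finite {c. f c \<noteq> \<zero>\<^bsub>?M\<^esub>}"
  proof (rule finite_subset)
    show "{c. f c \<noteq> \<zero>\<^bsub>?M\<^esub>} \<subseteq> mdeg ` Poly_Mapping.keys x"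
    proof (rule subsetI)
      fix c assume "c \<in> {c. f c \<noteq> \<zero>\<^bsub>?M\<^esub>}"
      then have "pfilter (\<lambda>t. mdeg t = c) x \<noteq> 0" by (auto simp: f_def M_zero)
      then obtain t where "t \<in> Poly_Mapping.keys (pfilter (\<lambda>t. mdeg t = c) x)"
        by (metis all_not_in_conv keys_eq_empty)
      then show "c \<in> mdeg ` Poly_Mapping.keys x" by (auto simp: keys_pfilter)
    qed
  qed simp
  have closed: "finsum ?M g {c. g c \<noteq> \<zero>\<^bsub>?M\<^esub>} \<in> carrier ?M" if "\<forall>c. g c \<in> grd ?M c" for g
  proof -
    interpret abelian_group ?M by (rule M_abelian_group)
    show ?thesis by (rule finsum_closed) (use that grd_in_carrier in blast)
  qed
  have "nf (finsum ?M f {c. f c \<noteq> \<zero>\<^bsub>?M\<^esub>}) = nf m"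
    unfolding component_nf[OF f fin] by (auto simp: f_def x(2) lookup_pfilter intro!: poly_mapping_eqI)
  then have eq: "m = finsum ?M f {c. f c \<noteq> \<zero>\<^bsub>?M\<^esub>}"
    using nf_inject[OF closed[OF f] m] by simp
  show "\<exists>!f. (\<forall>c. f c \<in> grd ?M c) \<and> finite {c. f c \<noteq> \<zero>\<^bsub>?M\<^esub>} \<and> m = finsum ?M f {c. f c \<noteq> \<zero>\<^bsub>?M\<^esub>}"
  proof (rule ex1I[of _ f])
    fix g assume g: "(\<forall>c. g c \<in> grd ?M c) \<and> finite {c. g c \<noteq> \<zero>\<^bsub>?M\<^esub>} \<and> m = finsum ?M g {c. g c \<noteq> \<zero>\<^bsub>?M\<^esub>}"
    show "g = f"
    proof (rule ext)
      fix c
      have "nf (g c) = nf (f c)"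
        using component_nf[of g "nf m"] component_nf[OF f fin, of "nf m"] g eq by metis
      then show "g c = f c" using nf_inject g f grd_in_carrier by blast
    qed
  qed (use f fin eq in blast)
qed

text \<open>A monomial whose support \<open>D\<close> lies in \<open>JJ\<close> is a multiple of the
  squarefree monomial of \<open>D\<close>, and \<open>W\<close> has finitely many subsets.
  Combinations of these classes contain all single terms and are closed under sums.\<close>

lemma M_finitely_generated:
  "finitely_generated W (M :: (('v, 'k::field) mpoly, ('v, 'k) mpoly set, 'v) gmodule)"
proof -
  let ?M = "M :: (('v, 'k) mpoly, ('v, 'k) mpoly set, 'v) gmodule"
  let ?R = "poly_ring W :: ('v, 'k) mpoly ring"
  interpret module ?R ?M by (rule M_module)
  let ?S = "JJ \<inter> Pow W"
  let ?G = "(\<lambda>D. cl (monomial (set_monom D)) :: ('v, 'k) mpoly set) ` ?S"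
  have finS: "finite D" if "D \<in> ?S" for D using that finW finite_subset by blast
  have finG: "finite ?G" using finW by simp
  have G: "?G \<subseteq> carrier ?M" using finS by (auto simp: M_carrier monomial_in_span)
  define comb where "comb m \<longleftrightarrow> (\<exists>c. (\<forall>g\<in>?G. c g \<in> carrier ?R) \<and> m = finsum ?M (\<lambda>g. c g \<odot>\<^bsub>?M\<^esub> g) ?G)" for m
  have comb_zero: "comb \<zero>\<^bsub>?M\<^esub>"
  proof -
    have "finsum ?M (\<lambda>g. \<zero>\<^bsub>?R\<^esub> \<odot>\<^bsub>?M\<^esub> g) ?G = \<zero>\<^bsub>?M\<^esub>"
      using G by (intro M.add.finprod_one_eqI) (auto simp del: poly_ring_simps)
    then show ?thesis unfolding comb_def by (intro exI[of _ "\<lambda>_. \<zero>\<^bsub>?R\<^esub>"]) (simp add: poly_ring_closed)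
  qed
  have comb_add: "comb (m \<oplus>\<^bsub>?M\<^esub> m')" if m: "comb m" "comb m'" for m m'
  proof -
    obtain c c' where c: "\<forall>g\<in>?G. c g \<in> carrier ?R" "m = finsum ?M (\<lambda>g. c g \<odot>\<^bsub>?M\<^esub> g) ?G"
      and c': "\<forall>g\<in>?G. c' g \<in> carrier ?R" "m' = finsum ?M (\<lambda>g. c' g \<odot>\<^bsub>?M\<^esub> g) ?G"
      using m by (auto simp: comb_def)
    have "m \<oplus>\<^bsub>?M\<^esub> m' = finsum ?M (\<lambda>g. c g \<odot>\<^bsub>?M\<^esub> g \<oplus>\<^bsub>?M\<^esub> c' g \<odot>\<^bsub>?M\<^esub> g) ?G"
      unfolding c(2) c'(2) using G c(1) c'(1) by (intro M.finsum_addf[symmetric]) (auto intro!: smult_closed)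
    also have "\<dots> = finsum ?M (\<lambda>g. (c g + c' g) \<odot>\<^bsub>?M\<^esub> g) ?G"
    proof (rule M.finsum_cong')
      fix g assume g: "g \<in> ?G"
      then show "c g \<odot>\<^bsub>?M\<^esub> g \<oplus>\<^bsub>?M\<^esub> c' g \<odot>\<^bsub>?M\<^esub> g = (c g + c' g) \<odot>\<^bsub>?M\<^esub> g"
        using smult_l_distr[of "c g" "c' g" g] c(1) c'(1) G by auto
    qed (use G c(1) c'(1) in \<open>auto intro!: smult_closed simp: poly_ring_closed\<close>)
    finally show ?thesis
      unfolding comb_def using c(1) c'(1) by (intro exI[of _ "\<lambda>g. c g + c' g"]) (simp add: poly_ring_closed)
  qed
  have comb_single: "comb (cl (Poly_Mapping.single t a))" if t: "supp t \<subseteq> W" "supp t \<in> JJ" for t and a :: 'k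
  proof -
    let ?D = "supp t"
    have D: "?D \<in> ?S" using t by auto
    let ?g = "cl (monomial (set_monom ?D)) :: ('v, 'k) mpoly set"
    let ?p = "Poly_Mapping.single (t - set_monom ?D) a"
    have gM: "?g \<in> carrier ?M" using D G by blast
    have p: "?p \<in> carrier ?R"
      using t supp_diff_subset[of t "set_monom ?D"] by (auto simp: in_carrier_poly_ring)
    have "mdivides (set_monom ?D) t" by (subst mdivides_squarefree) (auto simp: squarefree_set_monom)
    then have eq: "?p \<odot>\<^bsub>?M\<^esub> ?g = cl (Poly_Mapping.single t a)"
      by (simp add: M_smult[OF p] monomial_mult_single mdivides_iff_add_diff add.commute)
    have "finsum ?M (\<lambda>g. (if g = ?g then ?p else 0) \<odot>\<^bsub>?M\<^esub> g) ?G =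
      finsum ?M (\<lambda>g. if g = ?g then ?p \<odot>\<^bsub>?M\<^esub> g else \<zero>\<^bsub>?M\<^esub>) ?G"
    proof (rule M.finsum_cong')
      fix g assume "g \<in> ?G"
      then show "(if g = ?g then ?p else 0) \<odot>\<^bsub>?M\<^esub> g = (if g = ?g then ?p \<odot>\<^bsub>?M\<^esub> g else \<zero>\<^bsub>?M\<^esub>)"
        using smult_l_null[of g] G by auto
    qed (use G p gM in \<open>auto intro!: smult_closed\<close>)
    also have "\<dots> = ?p \<odot>\<^bsub>?M\<^esub> ?g"
      using D finG G p by (intro M.add.finprod_singleton_swap) (auto intro!: smult_closed)
    finally show ?thesis
      unfolding comb_def eq using p by (intro exI[of _ "\<lambda>g. if g = ?g then ?p else 0"]) (auto simp: poly_ring_closed)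
  qed
  have "comb m" if h: "m \<in> carrier ?M" for m
  proof -
    obtain x where x: "x \<in> J" "m = cl x" using h by (auto simp: M_carrier)
    have "comb (cl (\<Sum>t\<in>A. Poly_Mapping.single t (Poly_Mapping.lookup x t)))" if "A \<subseteq> Poly_Mapping.keys x" for A
      using finite_subset[OF that finite_keys] that
    proof (induction A rule: finite_induct)
      case empty
      then show ?case using comb_zero by (simp add: M_zero)
    next
      case (insert t A)
      have "comb (cl (Poly_Mapping.single t (Poly_Mapping.lookup x t)))"
        using insert x(1) by (intro comb_single) (auto simp: monomial_span_def)
      then show ?case using insert comb_add by (simp add: M_add[symmetric])
    qed
    then show ?thesis using x by (metis order_refl poly_mapping_sum_singles)
  qed
  then show ?thesis unfolding finitely_generated_def comb_def using finG G by blast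
qed

text \<open>As \<open>1 \<le> c w\<close>, multiplying by \<open>w\<close> leaves the support
  unchanged, and membership in \<open>J\<close> and \<open>P\<close> depends on supports only. Both
  components are therefore given by the same scalars, up to the same identifications.\<close>

lemma var_mult_bij:
  assumes c: "c \<in> degrees W" "\<forall>v. 0 \<le> c v" and w: "w \<in> W" "1 \<le> c w"
  shows "bij_betw (\<lambda>m. var w \<odot>\<^bsub>M\<^esub> m) (grd M c)
    (grd (M :: (('v, 'k::field) mpoly, ('v, 'k) mpoly set, 'v) gmodule) (\<lambda>v. c v + ind {w} v))"
proof -
  let ?M = "M :: (('v, 'k) mpoly, ('v, 'k) mpoly set, 'v) gmodule"
  let ?e = "Poly_Mapping.single w (1::nat)"
  let ?t = "deg_monom c"
  have mt: "mdeg ?t = c" using mdeg_deg_monom[OF finW c] .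
  have "1 \<le> mdeg ?t w" using w(2) by (simp only: mt)
  then have wt: "w \<in> supp ?t" by (simp add: mdeg_def in_keys_iff)
  have supp: "supp (?e + ?t) = supp ?t" "supp ?t \<subseteq> W"
    using wt mdeg_degrees[of ?t W] mt c(1) by (auto simp: supp_add)
  have mt': "mdeg (?e + ?t) = (\<lambda>v. c v + ind {w} v)"
    by (simp only: mdeg_add mdeg_single mt add.commute)
  then have t': "deg_monom (\<lambda>v. c v + ind {w} v) = ?e + ?t"
    by (metis deg_monom_mdeg)
  have 1: "{x. x \<in> J \<and> x \<in> homogeneous W c} = {Poly_Mapping.single ?t (a :: 'k) | a. a = 0 \<or> supp ?t \<in> JJ}"
  proof safe
    fix x :: "('v, 'k) mpoly" assume x: "x \<in> J" "x \<in> homogeneous W c"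
    then show "\<exists>a. x = Poly_Mapping.single ?t a \<and> (a = 0 \<or> supp ?t \<in> JJ)"
      using homogeneous_eq_single[OF x(2)] single_in_J[OF x] by (cases "x = 0") (auto intro!: exI[of _ "Poly_Mapping.lookup x ?t"])
  qed (use mt supp in \<open>auto intro: monomial_span_single single_homogeneous\<close>)
  have "grd ?M c = cl ` {x. x \<in> J \<and> x \<in> homogeneous W c}"
    by (simp add: M_grd Int_def)
  then have g: "grd ?M c = {cl (Poly_Mapping.single ?t a) | a. a = 0 \<or> supp ?t \<in> JJ}"
    unfolding 1 by blast
  have 2: "{x. x \<in> J \<and> x \<in> homogeneous W (\<lambda>v. c v + ind {w} v)} =
    {Poly_Mapping.single (?e + ?t) (a :: 'k) | a. a = 0 \<or> supp ?t \<in> JJ}"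
  proof safe
    fix x :: "('v, 'k) mpoly" assume x: "x \<in> J" "x \<in> homogeneous W (\<lambda>v. c v + ind {w} v)"
    then show "\<exists>a. x = Poly_Mapping.single (?e + ?t) a \<and> (a = 0 \<or> supp ?t \<in> JJ)"
      using homogeneous_eq_single[OF x(2)] single_in_J[OF x] supp unfolding t'
      by (cases "x = 0") (auto intro!: exI[of _ "Poly_Mapping.lookup x (?e + ?t)"])
  qed (use mt' supp in \<open>auto simp: monomial_span_def intro: single_homogeneous\<close>)
  have "grd ?M (\<lambda>v. c v + ind {w} v) = cl ` {x. x \<in> J \<and> x \<in> homogeneous W (\<lambda>v. c v + ind {w} v)}"
    by (simp add: M_grd Int_def)
  then have g': "grd ?M (\<lambda>v. c v + ind {w} v) = {cl (Poly_Mapping.single (?e + ?t) a) | a. a = 0 \<or> supp ?t \<in> JJ}"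
    unfolding 2 by blast
  have varw: "var w \<in> carrier (poly_ring W :: ('v, 'k) mpoly ring)"
    using w by (auto simp: var_def in_carrier_poly_ring)
  have mult: "var w \<odot>\<^bsub>?M\<^esub> cl (Poly_Mapping.single ?t a) = cl (Poly_Mapping.single (?e + ?t) a)" for a
    by (simp add: M_smult[OF varw]) (simp add: var_def monomial_def mult_single)
  have inj: "cl (Poly_Mapping.single ?t a) = cl (Poly_Mapping.single ?t b)"
    if eq: "cl (Poly_Mapping.single (?e + ?t) a) = cl (Poly_Mapping.single (?e + ?t) b)" for a b :: 'k
  proof -
    have "Poly_Mapping.single (?e + ?t) (a - b) \<in> P"
      using eq by (simp add: cl_eq_iff single_diff)
    then have "Poly_Mapping.single ?t (a - b) \<in> P"
      using supp by (cases "a = b") (auto simp: monomial_span_def)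
    then show ?thesis by (simp add: cl_eq_iff single_diff)
  qed
  let ?A = "{a :: 'k. a = 0 \<or> supp ?t \<in> JJ}"
  have g: "grd ?M c = (\<lambda>a. cl (Poly_Mapping.single ?t a)) ` ?A"
    unfolding g by blast
  have g': "grd ?M (\<lambda>v. c v + ind {w} v) = (\<lambda>a. cl (Poly_Mapping.single (?e + ?t) a)) ` ?A"
    unfolding g' by blast
  show ?thesis
    unfolding g g' bij_betw_def image_image mult
  proof
    show "inj_on (\<lambda>m. var w \<odot>\<^bsub>?M\<^esub> m) ((\<lambda>a. cl (Poly_Mapping.single ?t a)) ` ?A)"
    proof (rule inj_onI, elim imageE)
      fix X Y a b assume XY: "X = cl (Poly_Mapping.single ?t (a :: 'k))" "Y = cl (Poly_Mapping.single ?t b)"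
        and "var w \<odot>\<^bsub>?M\<^esub> X = var w \<odot>\<^bsub>?M\<^esub> Y"
      then have "cl (Poly_Mapping.single (?e + ?t) a) = cl (Poly_Mapping.single (?e + ?t) b)"
        by (simp only: mult)
      then show "X = Y" unfolding XY by (rule inj)
    qed
  qed simp
qed

theorem squarefree_module_M:
  "squarefree_module W (M :: (('v, 'k::field) mpoly, ('v, 'k) mpoly set, 'v) gmodule)"
  unfolding squarefree_module_def
proof (intro conjI allI impI ballI)
  let ?M = "M :: (('v, 'k) mpoly, ('v, 'k) mpoly set, 'v) gmodule"
  show "grd ?M c = {\<zero>\<^bsub>?M\<^esub>}" if "\<exists>v. c v < 0" for c
  proof -
    have "\<not> (c \<in> degrees W \<and> (\<forall>v. 0 \<le> c v))" using that by (auto simp: not_le)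
    then show ?thesis using homogeneous_eq_0[of _ W c] by (force simp: M_grd M_zero)
  qed
qed (use M_graded M_finitely_generated var_mult_bij in blast)+

end

section \<open>The complex of a quotient of squarefree monomial ideals\<close>

lemma expo_mrestrict: "expo (mrestrict U t) v = (if v \<in> U then expo t v else 0)"
  by (simp add: mrestrict_def lookup_mapp when_def in_keys_iff)

lemma supp_mrestrict: "supp (mrestrict U t) = supp t \<inter> U"
  by (auto simp: in_keys_iff expo_mrestrict split: if_splits)

lemma mrestrict_empty [simp]: "mrestrict {} t = 0"
  by (rule poly_mapping_eqI) (simp add: expo_mrestrict)

lemma mrestrict_mrestrict [simp]: "mrestrict U (mrestrict U t) = mrestrict U t"
  by (rule poly_mapping_eqI) (simp add: expo_mrestrict)

lemma mrestrict_add_mrestrict: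
  assumes "supp t \<subseteq> V" "W \<subseteq> V"
  shows "mrestrict (V - W) t + mrestrict W t = t"
proof (rule poly_mapping_eqI)
  fix v
  show "expo (mrestrict (V - W) t + mrestrict W t) v = expo t v"
    using assms(2) subsetD[OF assms(1), of v] by (auto simp: lookup_add expo_mrestrict in_keys_iff)
qed

lemma mrestrict_of_add:
  assumes "supp u \<subseteq> V - W" "supp u' \<subseteq> W"
  shows "mrestrict (V - W) (u + u') = u" "mrestrict W (u + u') = u'"
proof -
  show "mrestrict (V - W) (u + u') = u"
  proof (rule poly_mapping_eqI)
    fix v
    show "expo (mrestrict (V - W) (u + u')) v = expo u v"
      using assms by (cases "v \<in> V - W") (auto simp: expo_mrestrict lookup_add in_keys_iff)
  qed
  show "mrestrict W (u + u') = u'"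
  proof (rule poly_mapping_eqI)
    fix v
    show "expo (mrestrict W (u + u')) v = expo u' v"
      using assms by (cases "v \<in> W") (auto simp: expo_mrestrict lookup_add in_keys_iff)
  qed
qed

lemma mdivides_split:
  assumes "supp u \<subseteq> V - W" "supp u' \<subseteq> W" "supp s \<subseteq> V"
  shows "mdivides s (u + u') \<longleftrightarrow> mdivides (mrestrict (V - W) s) u \<and> mdivides (mrestrict W s) u'"
    and "mdivides s (u + u') \<Longrightarrow> u + u' - s = (u - mrestrict (V - W) s) + (u' - mrestrict W s)"
proof -
  have out: "v \<in> W \<Longrightarrow> expo u v = 0" "v \<notin> W \<Longrightarrow> expo u' v = 0" "v \<notin> V \<Longrightarrow> expo s v = 0 \<and> expo u v = 0" for v
    using assms by (auto simp: in_keys_iff)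
  have "expo s v \<le> expo (u + u') v \<longleftrightarrow>
    expo (mrestrict (V - W) s) v \<le> expo u v \<and> expo (mrestrict W s) v \<le> expo u' v" for v
    using out[of v] by (auto simp: expo_mrestrict lookup_add)
  then show "mdivides s (u + u') \<longleftrightarrow> mdivides (mrestrict (V - W) s) u \<and> mdivides (mrestrict W s) u'"
    by (auto simp: mdivides_def)
  show "u + u' - s = (u - mrestrict (V - W) s) + (u' - mrestrict W s)"
  proof (rule poly_mapping_eqI)
    fix v
    show "expo (u + u' - s) v = expo ((u - mrestrict (V - W) s) + (u' - mrestrict W s)) v"
      using out[of v] by (cases "v \<in> V"; cases "v \<in> W") (auto simp: expo_mrestrict lookup_add lookup_minus)
  qed
qed

lemma supp_diff_other:
  assumes "\<not> supp u \<subseteq> U"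
  shows "\<not> supp (u - mrestrict U t) \<subseteq> U"
proof -
  obtain v where v: "v \<in> supp u" "v \<notin> U" using assms by blast
  then have "v \<in> supp (u - mrestrict U t)" by (simp add: in_keys_iff lookup_minus expo_mrestrict)
  then show ?thesis using v by blast
qed

lemma minus_one_power_mpoly: "(- 1) ^ n = (Poly_Mapping.single 0 ((- 1) ^ n) :: ('v, 'k::field) mpoly)"
  by (cases "even n") (simp_all add: single_uminus)

lemma extend_scalars_simps:
  "f \<in> carrier (extend_scalars U V N) \<longleftrightarrow> (\<forall>u. f u \<in> carrier N) \<and> finite {u. f u \<noteq> \<zero>\<^bsub>N\<^esub>} \<and>
     (\<forall>u. f u \<noteq> \<zero>\<^bsub>N\<^esub> \<longrightarrow> supp u \<subseteq> V - U)"
  "\<zero>\<^bsub>extend_scalars U V N\<^esub> = (\<lambda>u. \<zero>\<^bsub>N\<^esub>)"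
  "f \<oplus>\<^bsub>extend_scalars U V N\<^esub> g = (\<lambda>u. f u \<oplus>\<^bsub>N\<^esub> g u)"
  "f \<in> grd (extend_scalars U V N) c \<longleftrightarrow> f \<in> carrier (extend_scalars U V N) \<and>
     (\<forall>u. f u \<in> grd N (\<lambda>v. c v - mdeg u v))"
  "p \<odot>\<^bsub>extend_scalars U V N\<^esub> f = (\<lambda>u. finsum N
     (\<lambda>t. Poly_Mapping.single (mrestrict U t) (Poly_Mapping.lookup p t)
            \<odot>\<^bsub>N\<^esub> f (u - mrestrict (V - U) t))
     {t \<in> Poly_Mapping.keys p. mdivides (mrestrict (V - U) t) u})"
  by (simp_all add: extend_scalars_def Let_def)

lemma direct_sum_simps:
  "f \<in> carrier (direct_sum A N) \<longleftrightarrow> f \<in> (\<Pi>\<^sub>E i\<in>A. carrier (N i)) \<and> finite {i\<in>A. f i \<noteq> \<zero>\<^bsub>N i\<^esub>}"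
  "\<zero>\<^bsub>direct_sum A N\<^esub> = (\<lambda>i\<in>A. \<zero>\<^bsub>N i\<^esub>)"
  "f \<oplus>\<^bsub>direct_sum A N\<^esub> g = (\<lambda>i\<in>A. f i \<oplus>\<^bsub>N i\<^esub> g i)"
  "p \<odot>\<^bsub>direct_sum A N\<^esub> f = (\<lambda>i\<in>A. p \<odot>\<^bsub>N i\<^esub> f i)"
  "f \<in> grd (direct_sum A N) c \<longleftrightarrow> f \<in> carrier (direct_sum A N) \<and> (\<forall>i\<in>A. f i \<in> grd (N i) c)"
  by (simp_all add: direct_sum_def Let_def)

lemma degree_part_simps:
  "carrier (degree_part W M D) = grd M (ind D)"
  "\<zero>\<^bsub>degree_part W M D\<^esub> = \<zero>\<^bsub>M\<^esub>"
  "(\<oplus>\<^bsub>degree_part W M D\<^esub>) = (\<oplus>\<^bsub>M\<^esub>)"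
  "(\<odot>\<^bsub>degree_part W M D\<^esub>) = (\<odot>\<^bsub>M\<^esub>)"
  "grd (degree_part W M D) c = (if c = ind (W - D) then grd M (ind D) else {\<zero>\<^bsub>M\<^esub>})"
  by (simp_all add: degree_part_def)

lemma shifted_ring_simps:
  "carrier (shifted_ring V a) = carrier (poly_ring V)"
  "\<zero>\<^bsub>shifted_ring V a\<^esub> = 0"
  "(\<oplus>\<^bsub>shifted_ring V a\<^esub>) = (+)"
  "(\<odot>\<^bsub>shifted_ring V a\<^esub>) = (*)"
  "grd (shifted_ring V a) c = homogeneous V (\<lambda>v. c v - a v)"
  by (simp_all add: shifted_ring_def)

lemma abelian_monoid_extend_scalars:
  assumes "abelian_monoid N"
  shows "abelian_monoid (extend_scalars U V N)"
proof -
  interpret N: abelian_monoid N by fact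
  show ?thesis
  proof (rule abelian_monoidI)
    fix f g assume f: "f \<in> carrier (extend_scalars U V N)" and g: "g \<in> carrier (extend_scalars U V N)"
    have "{u. f u \<oplus>\<^bsub>N\<^esub> g u \<noteq> \<zero>\<^bsub>N\<^esub>} \<subseteq> {u. f u \<noteq> \<zero>\<^bsub>N\<^esub>} \<union> {u. g u \<noteq> \<zero>\<^bsub>N\<^esub>}" by auto
    moreover have "finite ({u. f u \<noteq> \<zero>\<^bsub>N\<^esub>} \<union> {u. g u \<noteq> \<zero>\<^bsub>N\<^esub>})"
      using f g by (simp add: extend_scalars_simps(1))
    ultimately have "finite {u. f u \<oplus>\<^bsub>N\<^esub> g u \<noteq> \<zero>\<^bsub>N\<^esub>}"
      by (rule finite_subset)
    moreover have "supp u \<subseteq> V - U" if "f u \<oplus>\<^bsub>N\<^esub> g u \<noteq> \<zero>\<^bsub>N\<^esub>" for u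
    proof (cases "f u = \<zero>\<^bsub>N\<^esub>")
      case True
      then have "g u \<noteq> \<zero>\<^bsub>N\<^esub>" using that by auto
      then show ?thesis using g by (simp add: extend_scalars_simps(1))
    next
      case False
      then show ?thesis using f by (simp add: extend_scalars_simps(1))
    qed
    ultimately show "f \<oplus>\<^bsub>extend_scalars U V N\<^esub> g \<in> carrier (extend_scalars U V N)"
      using f g by (simp add: extend_scalars_simps)
  qed (auto simp: extend_scalars_simps fun_eq_iff N.a_ac)
qed

lemma abelian_monoid_direct_sum:
  assumes "\<And>i. i \<in> A \<Longrightarrow> abelian_monoid (N i)" "finite A"
  shows "abelian_monoid (direct_sum A N)"
proof (rule abelian_monoidI)
  have c: "f i \<in> carrier (N i)" if "f \<in> carrier (direct_sum A N)" "i \<in> A" for f i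
    using that by (auto simp: direct_sum_simps(1) dest: PiE_mem)
  have ext: "f i = undefined" if "f \<in> carrier (direct_sum A N)" "i \<notin> A" for f i
    using that by (simp add: direct_sum_simps(1)) (blast dest: PiE_arb)
  fix f g h assume f: "f \<in> carrier (direct_sum A N)" and g: "g \<in> carrier (direct_sum A N)"
  show "f \<oplus>\<^bsub>direct_sum A N\<^esub> g \<in> carrier (direct_sum A N)"
    using c[OF f] c[OF g] assms by (auto simp: direct_sum_simps abelian_monoid.a_closed)
  show "f \<oplus>\<^bsub>direct_sum A N\<^esub> g = g \<oplus>\<^bsub>direct_sum A N\<^esub> f"
    using c[OF f] c[OF g] assms by (auto simp: direct_sum_simps abelian_monoid.a_comm fun_eq_iff)
  show "\<zero>\<^bsub>direct_sum A N\<^esub> \<oplus>\<^bsub>direct_sum A N\<^esub> f = f"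
    using c[OF f] ext[OF f] assms by (auto simp: direct_sum_simps abelian_monoid.l_zero fun_eq_iff)
  assume h: "h \<in> carrier (direct_sum A N)"
  show "f \<oplus>\<^bsub>direct_sum A N\<^esub> g \<oplus>\<^bsub>direct_sum A N\<^esub> h = f \<oplus>\<^bsub>direct_sum A N\<^esub> (g \<oplus>\<^bsub>direct_sum A N\<^esub> h)"
    using c[OF f] c[OF g] c[OF h] assms by (auto simp: direct_sum_simps abelian_monoid.a_assoc fun_eq_iff)
next
  show "\<zero>\<^bsub>direct_sum A N\<^esub> \<in> carrier (direct_sum A N)"
    using assms by (auto simp: direct_sum_simps abelian_monoid.zero_closed)
qed

lemma graded_isoI:
  assumes "graded_hom V M N f" "bij_betw f (carrier M) (carrier N)"
    and "\<And>x c. x \<in> carrier M \<Longrightarrow> f x \<in> grd N c \<Longrightarrow> x \<in> grd M c"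
    and "\<And>c. grd N c \<subseteq> carrier N"
  shows "graded_iso V M N f"
proof -
  have "grd N c \<subseteq> f ` grd M c" for c
  proof
    fix y assume y: "y \<in> grd N c"
    then have "y \<in> carrier N" using assms(4) by blast
    then obtain x where "x \<in> carrier M" "y = f x"
      using assms(2) by (auto simp: bij_betw_def)
    then show "y \<in> f ` grd M c" using assms(3) y by auto
  qed
  moreover have "f ` grd M c \<subseteq> grd N c" for c using assms(1) by (simp add: graded_hom_def)
  ultimately have "f ` grd M c = grd N c" for c by (metis subset_antisym)
  then show ?thesis using assms(1,2) by (simp add: graded_iso_def)
qed

section \<open>Comparison of the explicit complex with the complex of the squarefree module\<close>

locale squarefree_quotient_complex = squarefree_quotient W JJ PP
  for W :: "'v set" and JJ PP :: "'v set set" +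
  fixes V :: "'v set" and r :: "('v \<times> 'v) set" and d :: int
  assumes WV: "W \<subseteq> V"
begin

definition qidx :: "int \<Rightarrow> 'v set set" where
  "qidx i = {D. D \<subseteq> W \<and> int (card (W - D)) = i + d}"

text \<open>The \<open>D\<close> whose component in the quotient is nonzero; the complex of the
  module is indexed by all of \<open>qidx i\<close>, the remaining summands being zero
  modules.\<close>

definition qgens :: "int \<Rightarrow> 'v set set" where
  "qgens i = {D \<in> qidx i. D \<in> JJ \<and> D \<notin> PP}"

text \<open>The explicit complex with its differential read from the target: the coefficient at
  \<open>D'\<close> collects the sources \<open>D' - {v}\<close>, which is also the form of
  \<open>L_complex\<close>.\<close>

definition quot_complex :: "(('v, 'k::field) mpoly, 'v set, 'v) free_complex" where
  "quot_complex = \<lparr>gens = qgens, gdeg = (\<lambda>i D. ind (W - D)),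
     fdiff = (\<lambda>i x. \<lambda>D'\<in>qgens (i - 1). \<Sum>v\<in>D'. if D' - {v} \<in> qgens i
       then (- 1) ^ alpha r v (D' - {v}) * var v * x (D' - {v}) else 0)\<rparr>"

definition LC :: "(('v, 'k::field) mpoly, 'v monom \<Rightarrow> 'v set \<Rightarrow> 'v monom \<Rightarrow> ('v, 'k) mpoly set, 'v) gcomplex" where
  "LC = extend_complex W V (shift_complex d (L_complex r W M))"

abbreviation Ex :: "'v set \<Rightarrow> (('v, 'k::field) mpoly, 'v monom \<Rightarrow> ('v, 'k) mpoly set, 'v) gmodule" where
  "Ex D \<equiv> extend_scalars {} W (degree_part W M D)"

abbreviation Ls :: "int \<Rightarrow> (('v, 'k::field) mpoly, 'v set \<Rightarrow> 'v monom \<Rightarrow> ('v, 'k) mpoly set, 'v) gmodule" where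
  "Ls i \<equiv> direct_sum (qidx i) Ex"

text \<open>The coordinate on the component of degree \<open>D\<close> relative to the class of its
  squarefree monomial.\<close>

definition sc :: "'v set \<Rightarrow> ('v, 'k::field) mpoly set \<Rightarrow> 'k" where
  "sc D X = Poly_Mapping.lookup (nf X) (set_monom D)"

text \<open>
  The monomial t = u u' in V, with u in V - W and u' in W, in the polynomial x(D) corresponds to the
  iterated index u, u' of the two successive extensions of scalars.
\<close>

definition qmap :: "int \<Rightarrow> ('v set \<Rightarrow> ('v, 'k::field) mpoly) \<Rightarrow> 'v monom \<Rightarrow> 'v set \<Rightarrow> 'v monom \<Rightarrow> ('v, 'k) mpoly set" where
  "qmap i x = (\<lambda>u. \<lambda>D\<in>qidx i. \<lambda>u'. if D \<in> qgens i \<and> supp u \<subseteq> V - W \<and> supp u' \<subseteq> W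
     then cl (Poly_Mapping.single (set_monom D) (Poly_Mapping.lookup (x D) (u + u'))) else cl 0)"

lemma LC_simps: "obj LC i = extend_scalars W V (Ls i)"
  "diff LC i f u = (\<lambda>D'\<in>qidx (i - 1). \<lambda>u'. finsum M (\<lambda>v. (- 1) ^ alpha r v (D' - {v}) \<odot>\<^bsub>M\<^esub>
     mult_both M v (f u (D' - {v})) u') D')"
  by (simp_all add: LC_def extend_complex_def shift_complex_def L_complex_def qidx_def algebra_simps)

lemma finite_subsets_W: "D \<subseteq> W \<Longrightarrow> finite D"
  using finW finite_subset by blast

lemma finite_qidx: "finite (qidx i)"
  by (rule finite_subset[of _ "Pow W"]) (auto simp: qidx_def finW)

lemma qidx_subset: "D \<in> qidx i \<Longrightarrow> D \<subseteq> W"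
  by (simp add: qidx_def)

lemma qgens_qidx: "D \<in> qgens i \<Longrightarrow> D \<in> qidx i"
  by (simp add: qgens_def)

lemma sc_zero [simp]: "sc D (cl 0) = 0"
  by (simp add: sc_def)

lemma sc_add: "X \<in> carrier M \<Longrightarrow> Y \<in> carrier M \<Longrightarrow> sc D (X \<oplus>\<^bsub>M\<^esub> Y) = sc D X + sc D Y"
  by (simp add: sc_def nf_add lookup_add)

lemma sc_single: "D \<in> qgens i \<Longrightarrow> sc D (cl (Poly_Mapping.single (set_monom D) a)) = a"
  using finite_subsets_W[OF qidx_subset[OF qgens_qidx]] by (simp add: sc_def lookup_pfilter) (simp add: qgens_def)

lemma single_const_carrier: "Poly_Mapping.single 0 a \<in> carrier (poly_ring W)"
  by (simp add: in_carrier_poly_ring)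

lemma smult_const: "Poly_Mapping.single 0 a \<odot>\<^bsub>M\<^esub> cl x = cl (Poly_Mapping.single 0 a * x)"
  by (rule M_smult[OF single_const_carrier])

lemma sc_smult: "X \<in> carrier M \<Longrightarrow> sc D (Poly_Mapping.single 0 a \<odot>\<^bsub>M\<^esub> X) = a * sc D X"
  by (auto simp: M_carrier smult_const sc_def lookup_pfilter lookup_single_mult mdivides_def)

lemma grd_smult_const: "X \<in> grd M c \<Longrightarrow> Poly_Mapping.single 0 a \<odot>\<^bsub>M\<^esub> X \<in> grd M c"
proof -
  assume "X \<in> grd M c"
  then obtain x where x: "x \<in> J" "x \<in> homogeneous W c" "X = cl x" by (auto simp: M_grd)
  have "Poly_Mapping.single 0 a * x \<in> homogeneous W (\<lambda>v. 0 + c v)"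
    using x by (intro homogeneous_mult single_homogeneous) auto
  then show ?thesis
    using x J_mult[OF single_const_carrier x(1)] by (auto simp: smult_const M_grd)
qed

lemma sc_inject:
  assumes "D \<subseteq> W" "X \<in> grd M (ind D)" "Y \<in> grd M (ind D)" "sc D X = sc D Y"
  shows "X = Y"
proof (rule nf_inject)
  show "X \<in> carrier M" "Y \<in> carrier M" using assms grd_in_carrier by blast+
  have D: "mdeg (set_monom D) = ind D" using finite_subsets_W[OF assms(1)] by simp
  show "nf X = nf Y"
  proof (rule poly_mapping_eqI)
    fix t
    show "Poly_Mapping.lookup (nf X) t = Poly_Mapping.lookup (nf Y) t"
    proof (cases "t = set_monom D")
      case True
      then show ?thesis using assms(4) by (simp add: sc_def)
    next
      case False
      then have "mdeg t \<noteq> ind D" using D mdeg_inject by metis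
      then have "t \<notin> Poly_Mapping.keys (nf X)" "t \<notin> Poly_Mapping.keys (nf Y)"
        using grd_nf_keys[OF assms(2)] grd_nf_keys[OF assms(3)] by blast+
      then show ?thesis by (simp add: in_keys_iff)
    qed
  qed
qed

lemma grd_trivial:
  assumes "D \<subseteq> W" "D \<notin> JJ \<or> D \<in> PP" "X \<in> grd M (ind D)"
  shows "X = cl 0"
proof -
  obtain x where x: "x \<in> J" "x \<in> homogeneous W (ind D)" "X = cl x" using assms(3) by (auto simp: M_grd)
  have "deg_monom (ind D) = set_monom D"
    using finite_subsets_W[OF assms(1)] by (metis deg_monom_mdeg mdeg_set_monom)
  then have "x = Poly_Mapping.single (set_monom D) (Poly_Mapping.lookup x (set_monom D))"
    using homogeneous_eq_single[OF x(2)] by simp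
  moreover have "x = 0 \<or> D \<in> JJ"
    using single_in_J[OF x(1,2)] \<open>deg_monom (ind D) = set_monom D\<close> finite_subsets_W[OF assms(1)] by auto
  ultimately have "x \<in> P"
    using assms(1,2) finite_subsets_W[OF assms(1)]
    by (metis monomial_span_0 monomial_span_single supp_set_monom)
  then show ?thesis using x by (simp add: cl_eq_iff)
qed

lemma cl_single_grd: "D \<in> qgens i \<Longrightarrow> cl (Poly_Mapping.single (set_monom D) a) \<in> grd M (ind D)"
proof -
  assume D: "D \<in> qgens i"
  then have "D \<subseteq> W" "finite D" "D \<in> JJ"
    using qidx_subset finite_subsets_W by (auto simp: qgens_def)
  then show ?thesis
    by (auto simp: M_grd intro!: imageI monomial_span_single single_homogeneous)
qed

lemma zero_grd: "cl 0 \<in> grd M c"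
  using M_grd_zero by (simp add: M_zero)

lemma abelian_monoid_degree_part:
  "abelian_monoid (degree_part W (M :: (('v, 'k::field) mpoly, ('v, 'k) mpoly set, 'v) gmodule) D)"
proof -
  interpret M: abelian_group "M :: (('v, 'k) mpoly, ('v, 'k) mpoly set, 'v) gmodule" by (rule M_abelian_group)
  interpret S: additive_subgroup "grd M (ind D)" "M :: (('v, 'k) mpoly, ('v, 'k) mpoly set, 'v) gmodule"
    by (rule M_grd_subgroup)
  show ?thesis
    by (rule abelian_monoidI)
      (auto simp: degree_part_simps M_grd_zero M.a_ac grd_in_carrier simp del: subset_iff)
qed

lemma abelian_monoid_Ex: "abelian_monoid (Ex D)"
  by (rule abelian_monoid_extend_scalars[OF abelian_monoid_degree_part])

lemma abelian_monoid_Ls: "abelian_monoid (Ls i)"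
  by (rule abelian_monoid_direct_sum[OF abelian_monoid_Ex finite_qidx])

lemma Ex_carrierD: "f \<in> carrier (Ex D) \<Longrightarrow> f u' \<in> grd M (ind D)"
  "f \<in> carrier (Ex D) \<Longrightarrow> \<not> supp u' \<subseteq> W \<Longrightarrow> f u' = cl 0"
  by (auto simp: extend_scalars_simps degree_part_simps M_zero)

lemma Ls_carrierD: "f \<in> carrier (Ls i) \<Longrightarrow> D \<in> qidx i \<Longrightarrow> f D \<in> carrier (Ex D)"
  by (auto simp: direct_sum_simps)

lemma Ls_carrierI:
  assumes "\<And>D. D \<in> qidx i \<Longrightarrow> f D \<in> carrier (Ex D)" "\<And>D. D \<notin> qidx i \<Longrightarrow> f D = undefined"
  shows "f \<in> carrier (Ls i)"
  using assms finite_qidx by (auto simp: direct_sum_simps)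

lemma LC_carrierD: "f \<in> carrier (obj LC i) \<Longrightarrow> f u \<in> carrier (Ls i)"
  "f \<in> carrier (obj LC i) \<Longrightarrow> \<not> supp u \<subseteq> V - W \<Longrightarrow> D \<in> qidx i \<Longrightarrow> f u D u' = cl 0"
  "f \<in> carrier (obj LC i) \<Longrightarrow> D \<in> qidx i \<Longrightarrow> f u D u' \<in> grd M (ind D)"
proof -
  show 1: "f \<in> carrier (obj LC i) \<Longrightarrow> f u \<in> carrier (Ls i)"
    by (simp add: LC_simps extend_scalars_simps(1))
  show "f \<in> carrier (obj LC i) \<Longrightarrow> \<not> supp u \<subseteq> V - W \<Longrightarrow> D \<in> qidx i \<Longrightarrow> f u D u' = cl 0"
    unfolding LC_simps extend_scalars_simps(1)
    by (auto simp: direct_sum_simps(2) extend_scalars_simps(2) degree_part_simps M_zero dest!: spec[of _ u])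
  show "f \<in> carrier (obj LC i) \<Longrightarrow> D \<in> qidx i \<Longrightarrow> f u D u' \<in> grd M (ind D)"
    using 1 Ls_carrierD Ex_carrierD(1) by blast
qed

text \<open>Single terms suffice here: the outer extension of scalars splits a polynomial into terms
  and lets the \<open>W\<close>-part of each act on the inner one. The scalar acts on
  \<open>M\<close>, the monomial shifts the index.\<close>

lemma Ex_smult_single:
  assumes f: "f \<in> carrier (Ex D)" and t: "supp t \<subseteq> W"
  shows "Poly_Mapping.single t a \<odot>\<^bsub>Ex D\<^esub> f =
    (\<lambda>u'. if a \<noteq> 0 \<and> mdivides t u' then Poly_Mapping.single 0 a \<odot>\<^bsub>M\<^esub> f (u' - t) else cl 0)"
proof
  fix u'
  interpret abelian_monoid "degree_part W (M :: (('v, 'a) mpoly, ('v, 'a) mpoly set, 'v) gmodule) D"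
    by (rule abelian_monoid_degree_part)
  interpret M: abelian_group "M :: (('v, 'a) mpoly, ('v, 'a) mpoly set, 'v) gmodule"
    by (rule M_abelian_group)
  have rt: "mrestrict W t = t" using t by (intro poly_mapping_eqI) (auto simp: expo_mrestrict in_keys_iff)
  have c: "Poly_Mapping.single 0 a \<odot>\<^bsub>M\<^esub> f (u' - t) \<in> grd M (ind D)"
    using Ex_carrierD(1)[OF f] grd_smult_const by blast
  have "{s \<in> Poly_Mapping.keys (Poly_Mapping.single t a). mdivides (mrestrict (W - {}) s) u'} =
    (if a \<noteq> 0 \<and> mdivides t u' then {t} else {})" by (auto simp: rt)
  then show "(Poly_Mapping.single t a \<odot>\<^bsub>Ex D\<^esub> f) u' =
    (if a \<noteq> 0 \<and> mdivides t u' then Poly_Mapping.single 0 a \<odot>\<^bsub>M\<^esub> f (u' - t) else cl 0)"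
    using c finsum_insert[of "{}" t] by (auto simp: extend_scalars_simps degree_part_simps rt M_zero[symmetric] grd_in_carrier)
qed

lemma Ex_smult_single_closed:
  assumes f: "f \<in> carrier (Ex D)" and t: "supp t \<subseteq> W"
  shows "Poly_Mapping.single t a \<odot>\<^bsub>Ex D\<^esub> f \<in> carrier (Ex D)"
proof -
  let ?g = "Poly_Mapping.single t a \<odot>\<^bsub>Ex D\<^esub> f"
  note eq = Ex_smult_single[OF f t, of a]
  have z: "Poly_Mapping.single 0 a \<odot>\<^bsub>M\<^esub> cl 0 = cl 0" by (simp add: smult_const)
  have "{u'. ?g u' \<noteq> cl 0} \<subseteq> (\<lambda>u. t + u) ` {u. f u \<noteq> cl 0}"
  proof
    fix u' assume "u' \<in> {u'. ?g u' \<noteq> cl 0}"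
    then have "mdivides t u'" "f (u' - t) \<noteq> cl 0" using z by (auto simp: eq split: if_splits)
    then show "u' \<in> (\<lambda>u. t + u) ` {u. f u \<noteq> cl 0}"
      by (intro image_eqI[of _ _ "u' - t"]) (auto simp: mdivides_iff_add_diff)
  qed
  moreover have "finite {u. f u \<noteq> cl 0}"
    using f by (simp add: extend_scalars_simps degree_part_simps M_zero)
  ultimately have "finite {u'. ?g u' \<noteq> cl 0}" using finite_surj by blast
  moreover have "supp u' \<subseteq> W" if "?g u' \<noteq> cl 0" for u'
  proof -
    have "mdivides t u'" "f (u' - t) \<noteq> cl 0" using that z by (auto simp: eq split: if_splits)
    then have "supp (u' - t) \<subseteq> W" "u' = t + (u' - t)"
      using Ex_carrierD(2)[OF f] by (auto simp: mdivides_iff_add_diff)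
    then show ?thesis using t supp_add by (metis Un_least)
  qed
  moreover have "?g u' \<in> grd M (ind D)" for u'
    using grd_smult_const[OF Ex_carrierD(1)[OF f]] by (simp add: eq zero_grd)
  ultimately show ?thesis by (simp add: extend_scalars_simps(1) degree_part_simps M_zero)
qed

text \<open>In the two nested extensions the part of a term outside \<open>W\<close> shifts the
  outer index and the part inside \<open>W\<close> the inner index.\<close>

lemma LC_smult:
  fixes f :: "'v monom \<Rightarrow> 'v set \<Rightarrow> 'v monom \<Rightarrow> ('v, 'k::field) mpoly set"
  assumes f: "f \<in> carrier (obj LC i)"
  shows "(p \<odot>\<^bsub>obj LC i\<^esub> f) u \<in> carrier (Ls i)"
    and "D \<in> qidx i \<Longrightarrow> sc D ((p \<odot>\<^bsub>obj LC i\<^esub> f) u D u') =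
      (\<Sum>t\<in>{t \<in> Poly_Mapping.keys p. mdivides (mrestrict (V - W) t) u}.
        if mdivides (mrestrict W t) u' then Poly_Mapping.lookup p t *
          sc D (f (u - mrestrict (V - W) t) D (u' - mrestrict W t)) else 0)"
proof -
  interpret Ls: abelian_monoid "Ls i :: (('v, 'k) mpoly, 'v set \<Rightarrow> 'v monom \<Rightarrow> ('v, 'k) mpoly set, 'v) gmodule"
    by (rule abelian_monoid_Ls)
  let ?S = "{t \<in> Poly_Mapping.keys p. mdivides (mrestrict (V - W) t) u}"
  let ?g = "\<lambda>t. Poly_Mapping.single (mrestrict W t) (Poly_Mapping.lookup p t) \<odot>\<^bsub>Ls i\<^esub> f (u - mrestrict (V - W) t)"
  have eq: "(p \<odot>\<^bsub>obj LC i\<^esub> f) u = finsum (Ls i) ?g ?S"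
    by (simp add: LC_simps extend_scalars_simps)
  have g: "?g t \<in> carrier (Ls i)" for t
    using Ls_carrierD[OF LC_carrierD(1)[OF f]]
    by (intro Ls_carrierI) (auto simp: direct_sum_simps(4) supp_mrestrict intro!: Ex_smult_single_closed)
  then show "(p \<odot>\<^bsub>obj LC i\<^esub> f) u \<in> carrier (Ls i)"
    unfolding eq by (intro Ls.finsum_closed) auto
  assume D: "D \<in> qidx i"
  have "sc D (finsum (Ls i) ?g ?S D u') = (\<Sum>t\<in>?S. sc D (?g t D u'))"
  proof (rule Ls.additive_finsum[where h = "\<lambda>F. sc D (F D u')"])
    show "sc D (\<zero>\<^bsub>Ls i\<^esub> D u') = 0"
      using D by (simp add: direct_sum_simps extend_scalars_simps degree_part_simps M_zero)
    fix F G :: "'v set \<Rightarrow> 'v monom \<Rightarrow> ('v, 'k) mpoly set"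
    assume "F \<in> carrier (Ls i)" "G \<in> carrier (Ls i)"
    then have "F D u' \<in> carrier M" "G D u' \<in> carrier M"
      using Ex_carrierD(1)[OF Ls_carrierD[OF _ D]] grd_in_carrier by blast+
    then show "sc D ((F \<oplus>\<^bsub>Ls i\<^esub> G) D u') = sc D (F D u') + sc D (G D u')"
      using D by (simp add: direct_sum_simps extend_scalars_simps degree_part_simps sc_add)
  qed (use g in blast)
  also have "\<dots> = (\<Sum>t\<in>?S. if mdivides (mrestrict W t) u' then Poly_Mapping.lookup p t *
          sc D (f (u - mrestrict (V - W) t) D (u' - mrestrict W t)) else 0)"
  proof (rule sum.cong)
    fix t assume "t \<in> ?S"
    then have "Poly_Mapping.lookup p t \<noteq> 0" by (simp add: in_keys_iff)
    moreover have fD: "f (u - mrestrict (V - W) t) D \<in> carrier (Ex D)"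
      using Ls_carrierD[OF LC_carrierD(1)[OF f] D] .
    moreover have "f (u - mrestrict (V - W) t) D (u' - mrestrict W t) \<in> carrier M"
      using Ex_carrierD(1)[OF fD] grd_in_carrier by blast
    ultimately show "sc D (?g t D u') = (if mdivides (mrestrict W t) u' then Poly_Mapping.lookup p t *
          sc D (f (u - mrestrict (V - W) t) D (u' - mrestrict W t)) else 0)"
      using D by (simp add: direct_sum_simps(4) Ex_smult_single supp_mrestrict sc_smult)
  qed simp
  finally show "sc D ((p \<odot>\<^bsub>obj LC i\<^esub> f) u D u') =
      (\<Sum>t\<in>?S. if mdivides (mrestrict W t) u' then Poly_Mapping.lookup p t *
          sc D (f (u - mrestrict (V - W) t) D (u' - mrestrict W t)) else 0)"
    unfolding eq .
qed

lemma quot_complex_simps: "gens quot_complex = qgens" "gdeg quot_complex i D = ind (W - D)"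
  "fdiff quot_complex i x = (\<lambda>D'\<in>qgens (i - 1). \<Sum>v\<in>D'. if D' - {v} \<in> qgens i
       then (- 1) ^ alpha r v (D' - {v}) * var v * x (D' - {v}) else 0)"
  by (simp_all add: quot_complex_def)

lemma finite_qgens: "finite (qgens i)"
  using finite_qidx by (rule finite_subset[rotated]) (auto simp: qgens_def)

lemma quot_obj_carrier: "x \<in> carrier (free_obj V quot_complex i) \<longleftrightarrow>
  x \<in> (\<Pi>\<^sub>E D\<in>qgens i. carrier (poly_ring V))"
  using finite_qgens by (auto simp: free_obj_def quot_complex_simps direct_sum_simps shifted_ring_simps)

lemma qmap_grd: "D \<in> qidx i \<Longrightarrow> qmap i x u D u' \<in> grd M (ind D)"
  using cl_single_grd zero_grd by (auto simp: qmap_def)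

lemma sc_qmap: "D \<in> qgens i \<Longrightarrow> sc D (qmap i x u D u') =
  (if supp u \<subseteq> V - W \<and> supp u' \<subseteq> W then Poly_Mapping.lookup (x D) (u + u') else 0)"
  by (auto simp: qmap_def sc_single qgens_qidx)

text \<open>Only coordinates at \<open>D \<in> qgens i\<close> need comparison: at the other
  \<open>D\<close> of \<open>qidx i\<close> the component vanishes, and outside
  \<open>qidx i\<close> both sides are \<open>undefined\<close>.\<close>

lemma qmap_eqI:
  assumes g: "\<And>u. g u \<in> carrier (Ls i)"
    and eq: "\<And>u D u'. D \<in> qgens i \<Longrightarrow> sc D (g u D u') =
      (if supp u \<subseteq> V - W \<and> supp u' \<subseteq> W then Poly_Mapping.lookup (x D) (u + u') else 0)"
  shows "qmap i x = g"
proof (intro ext)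
  fix u D u'
  show "qmap i x u D u' = g u D u'"
  proof (cases "D \<in> qidx i")
    case True
    have gM: "g u D u' \<in> grd M (ind D)" using Ex_carrierD(1)[OF Ls_carrierD[OF g True]] .
    show ?thesis
    proof (cases "D \<in> qgens i")
      case D: True
      show ?thesis
        by (rule sc_inject[OF qidx_subset[OF True] qmap_grd[OF True] gM]) (simp add: sc_qmap[OF D] eq[OF D])
    next
      case False
      then have "D \<notin> JJ \<or> D \<in> PP" using True by (auto simp: qgens_def)
      then show ?thesis
        using grd_trivial[OF qidx_subset[OF True]] gM qmap_grd[OF True] by metis
    qed
  next
    case False
    have "g u D = undefined"
      using g[of u] False by (simp add: direct_sum_simps(1)) (blast dest: PiE_arb)
    moreover have "qmap i x u D = undefined" using False by (simp add: qmap_def)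
    ultimately show ?thesis by simp
  qed
qed

lemma qmap_nonzeroD:
  assumes "D \<in> qidx i" "qmap i x u D u' \<noteq> cl 0"
  shows "D \<in> qgens i" "supp u \<subseteq> V - W" "supp u' \<subseteq> W" "Poly_Mapping.lookup (x D) (u + u') \<noteq> 0"
proof -
  have *: "D \<in> qgens i \<and> supp u \<subseteq> V - W \<and> supp u' \<subseteq> W"
  proof (rule ccontr)
    assume "\<not> ?thesis"
    then have "qmap i x u D u' = cl 0"
      using assms(1) by (simp only: qmap_def restrict_apply' if_not_P if_False)
    then show False using assms(2) by blast
  qed
  then show "D \<in> qgens i" "supp u \<subseteq> V - W" "supp u' \<subseteq> W" by auto
  show "Poly_Mapping.lookup (x D) (u + u') \<noteq> 0"
  proof
    assume "Poly_Mapping.lookup (x D) (u + u') = 0"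
    then have "qmap i x u D u' = cl 0" using assms(1) by (simp add: qmap_def)
    then show False using assms(2) by blast
  qed
qed

text \<open>Finiteness in both indices: a nonzero value at \<open>u, u'\<close> requires the
  monomial \<open>u + u'\<close> in some \<open>x D\<close>, and \<open>u\<close> and
  \<open>u'\<close> are its restrictions.\<close>

lemma qmap_carrier:
  assumes x: "x \<in> carrier (free_obj V quot_complex i)"
  shows "qmap i x \<in> carrier (obj LC i)"
proof -
  have Ex: "qmap i x u D \<in> carrier (Ex D)" if D: "D \<in> qidx i" for u D
  proof -
    have nz: "supp u' \<subseteq> W \<and> u' \<in> mrestrict W ` Poly_Mapping.keys (x D)" if "qmap i x u D u' \<noteq> cl 0" for u'
    proof -
      note * = qmap_nonzeroD[OF D that]
      then have "u' = mrestrict W (u + u')" "u + u' \<in> Poly_Mapping.keys (x D)"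
        using mrestrict_of_add(2)[of u V W u'] by (auto simp: in_keys_iff)
      then show ?thesis using * by blast
    qed
    have "finite {u'. qmap i x u D u' \<noteq> cl 0}"
      by (rule finite_subset[of _ "mrestrict W ` Poly_Mapping.keys (x D)"]) (use nz in auto)
    then show ?thesis using nz qmap_grd[OF D] by (auto simp: extend_scalars_simps degree_part_simps M_zero)
  qed
  have Ls: "qmap i x u \<in> carrier (Ls i)" for u
    by (rule Ls_carrierI) (auto simp: Ex, simp add: qmap_def)
  have nz: "supp u \<subseteq> V - W \<and> (\<exists>D\<in>qgens i. u \<in> mrestrict (V - W) ` Poly_Mapping.keys (x D))"
    if "qmap i x u \<noteq> \<zero>\<^bsub>Ls i\<^esub>" for u
  proof -
    have "\<exists>D\<in>qidx i. \<exists>u'. qmap i x u D u' \<noteq> cl 0"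
    proof (rule ccontr)
      assume "\<not> ?thesis"
      then have "qmap i x u D u' = \<zero>\<^bsub>Ls i\<^esub> D u'" for D u'
        by (cases "D \<in> qidx i")
          (simp_all add: direct_sum_simps(2) extend_scalars_simps(2) degree_part_simps M_zero, simp add: qmap_def)
      then show False using that by blast
    qed
    then obtain D u' where D: "D \<in> qidx i" "qmap i x u D u' \<noteq> cl 0" by blast
    note * = qmap_nonzeroD[OF D]
    then have "u = mrestrict (V - W) (u + u')" "u + u' \<in> Poly_Mapping.keys (x D)"
      using mrestrict_of_add(1)[of u V W u'] by (auto simp: in_keys_iff)
    then show ?thesis using * by blast
  qed
  have "finite {u. qmap i x u \<noteq> \<zero>\<^bsub>Ls i\<^esub>}"
    by (rule finite_subset[of _ "\<Union>D\<in>qgens i. mrestrict (V - W) ` Poly_Mapping.keys (x D)"])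
      (use nz finite_qgens in auto)
  then show ?thesis using Ls nz by (simp add: LC_simps extend_scalars_simps(1))
qed

end

context squarefree_quotient_complex
begin

lemma quot_obj_simps:
  "x \<oplus>\<^bsub>free_obj V quot_complex i\<^esub> y = (\<lambda>D\<in>qgens i. x D + y D)"
  "p \<odot>\<^bsub>free_obj V quot_complex i\<^esub> x = (\<lambda>D\<in>qgens i. p * x D)"
  "x \<in> grd (free_obj V quot_complex i) c \<longleftrightarrow> x \<in> carrier (free_obj V quot_complex i) \<and>
     (\<forall>D\<in>qgens i. x D \<in> homogeneous V (\<lambda>v. c v - ind (W - D) v))"
  by (simp_all add: free_obj_def quot_complex_simps direct_sum_simps shifted_ring_simps)

lemma quot_objD: "x \<in> carrier (free_obj V quot_complex i) \<Longrightarrow> D \<in> qgens i \<Longrightarrow> x D \<in> carrier (poly_ring V)"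
  by (auto simp: quot_obj_carrier dest: PiE_mem)

lemma LC_carrier_add:
  assumes "f \<in> carrier (obj LC i)" "g \<in> carrier (obj LC i)"
  shows "f \<oplus>\<^bsub>obj LC i\<^esub> g \<in> carrier (obj LC i)"
  using abelian_monoid.a_closed[OF abelian_monoid_extend_scalars[OF abelian_monoid_Ls]] assms
  unfolding LC_simps by blast

lemma qmap_add:
  assumes "x \<in> carrier (free_obj V quot_complex i)" "y \<in> carrier (free_obj V quot_complex i)"
  shows "qmap i (x \<oplus>\<^bsub>free_obj V quot_complex i\<^esub> y) = qmap i x \<oplus>\<^bsub>obj LC i\<^esub> qmap i y"
proof (rule qmap_eqI)
  note qx = qmap_carrier[OF assms(1)] and qy = qmap_carrier[OF assms(2)]
  show "(qmap i x \<oplus>\<^bsub>obj LC i\<^esub> qmap i y) u \<in> carrier (Ls i)" for u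
    using LC_carrierD(1)[OF LC_carrier_add[OF qx qy]] .
  fix u D u' assume D: "D \<in> qgens i"
  have "qmap i x u D u' \<in> carrier M" "qmap i y u D u' \<in> carrier M"
    using qmap_grd[OF qgens_qidx[OF D]] grd_in_carrier by blast+
  then show "sc D ((qmap i x \<oplus>\<^bsub>obj LC i\<^esub> qmap i y) u D u') =
      (if supp u \<subseteq> V - W \<and> supp u' \<subseteq> W then Poly_Mapping.lookup ((x \<oplus>\<^bsub>free_obj V quot_complex i\<^esub> y) D) (u + u') else 0)"
    using D qgens_qidx[OF D]
    by (simp add: LC_simps extend_scalars_simps direct_sum_simps degree_part_simps sc_add sc_qmap
        quot_obj_simps lookup_add)
qed

lemma qmap_smult:
  assumes p: "p \<in> carrier (poly_ring V)" and x: "x \<in> carrier (free_obj V quot_complex i)"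
  shows "qmap i (p \<odot>\<^bsub>free_obj V quot_complex i\<^esub> x) = p \<odot>\<^bsub>obj LC i\<^esub> qmap i x"
proof (rule qmap_eqI)
  note qx = qmap_carrier[OF x]
  show "(p \<odot>\<^bsub>obj LC i\<^esub> qmap i x) u \<in> carrier (Ls i)" for u
    using LC_smult(1)[OF qx] .
  fix u D u' assume D: "D \<in> qgens i"
  let ?S = "{t \<in> Poly_Mapping.keys p. mdivides (mrestrict (V - W) t) u}"
  have "sc D ((p \<odot>\<^bsub>obj LC i\<^esub> qmap i x) u D u') =
      (\<Sum>t\<in>?S. if mdivides (mrestrict W t) u' then Poly_Mapping.lookup p t *
          sc D (qmap i x (u - mrestrict (V - W) t) D (u' - mrestrict W t)) else 0)"
    by (rule LC_smult(2)[OF qx qgens_qidx[OF D]])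
  also have "\<dots> = (if supp u \<subseteq> V - W \<and> supp u' \<subseteq> W
      then Poly_Mapping.lookup (p * x D) (u + u') else 0)"
  proof (cases "supp u \<subseteq> V - W \<and> supp u' \<subseteq> W")
    case True
    have "(\<Sum>t\<in>?S. if mdivides (mrestrict W t) u' then Poly_Mapping.lookup p t *
          sc D (qmap i x (u - mrestrict (V - W) t) D (u' - mrestrict W t)) else 0) =
      (\<Sum>t\<in>{t\<in>?S. mdivides (mrestrict W t) u'}. Poly_Mapping.lookup p t *
          sc D (qmap i x (u - mrestrict (V - W) t) D (u' - mrestrict W t)))"
      by (simp add: sum.If_cases Int_def)
    also have "\<dots> = (\<Sum>t\<in>{t\<in>Poly_Mapping.keys p. mdivides t (u + u')}.
        Poly_Mapping.lookup p t * Poly_Mapping.lookup (x D) (u + u' - t))"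
    proof (rule sum.cong)
      show "{t\<in>?S. mdivides (mrestrict W t) u'} = {t\<in>Poly_Mapping.keys p. mdivides t (u + u')}"
        using mdivides_split(1) True carrier_poly_ringD[OF p] by blast
      fix t assume t: "t \<in> {t\<in>Poly_Mapping.keys p. mdivides t (u + u')}"
      have "supp (u - mrestrict (V - W) t) \<subseteq> V - W" "supp (u' - mrestrict W t) \<subseteq> W"
        using True order.trans[OF supp_diff_subset] by auto
      then show "Poly_Mapping.lookup p t * sc D (qmap i x (u - mrestrict (V - W) t) D (u' - mrestrict W t)) =
        Poly_Mapping.lookup p t * Poly_Mapping.lookup (x D) (u + u' - t)"
        using t True mdivides_split(2)[of u V W u' t] carrier_poly_ringD[OF p] by (simp add: sc_qmap[OF D])
    qed
    also have "\<dots> = Poly_Mapping.lookup (p * x D) (u + u')" by (simp add: lookup_mult_mpoly)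
    finally show ?thesis using True by simp
  next
    case False
    \<comment> \<open>Subtracting a restricted monomial cannot remove a variable outside the
      permitted set, so the shifted indices remain outside the support of
      \<open>qmap\<close>.\<close>
    have z: "sc D (qmap i x (u - mrestrict (V - W) t) D (u' - mrestrict W t)) = 0" for t
      using False supp_diff_other[of u "V - W" t] supp_diff_other[of u' W t] by (auto simp: sc_qmap[OF D])
    show ?thesis unfolding z if_not_P[OF False] by (simp cong: if_cong)
  qed
  finally show "sc D ((p \<odot>\<^bsub>obj LC i\<^esub> qmap i x) u D u') =
      (if supp u \<subseteq> V - W \<and> supp u' \<subseteq> W then Poly_Mapping.lookup ((p \<odot>\<^bsub>free_obj V quot_complex i\<^esub> x) D) (u + u') else 0)"
    using D by (simp add: quot_obj_simps)
qed

text \<open>On the summand \<open>D\<close> the index pair \<open>u, u'\<close> has degree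
  \<open>mdeg u + mdeg u' + ind (W - D)\<close>, the degree of the monomial \<open>u + u'\<close> on
  the generator \<open>D\<close>.\<close>

lemma qmap_grd_iff:
  assumes x: "x \<in> carrier (free_obj V quot_complex i)"
  shows "qmap i x \<in> grd (obj LC i) c \<longleftrightarrow> x \<in> grd (free_obj V quot_complex i) c"
proof -
  note qx = qmap_carrier[OF x]
  have "qmap i x \<in> grd (obj LC i) c \<longleftrightarrow>
    (\<forall>u. \<forall>D\<in>qidx i. \<forall>u'. qmap i x u D u' \<in> grd (degree_part W M D) (\<lambda>v. c v - mdeg u v - mdeg u' v))"
    using qx LC_carrierD(1)[OF qx] Ls_carrierD[OF LC_carrierD(1)[OF qx]]
    by (simp add: LC_simps extend_scalars_simps(4) direct_sum_simps(5))
  also have "\<dots> \<longleftrightarrow> (\<forall>D\<in>qgens i. \<forall>t. supp t \<subseteq> V \<longrightarrow> Poly_Mapping.lookup (x D) t \<noteq> 0 \<longrightarrow>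
      mdeg t = (\<lambda>v. c v - ind (W - D) v))" (is "?L \<longleftrightarrow> ?R")
  proof
    assume L: ?L
    show ?R
    proof (intro ballI allI impI)
      fix D t assume D: "D \<in> qgens i" and t: "supp t \<subseteq> V" "Poly_Mapping.lookup (x D) t \<noteq> 0"
      let ?u = "mrestrict (V - W) t" and ?u' = "mrestrict W t"
      have uu: "?u + ?u' = t" by (rule mrestrict_add_mrestrict[OF t(1) WV])
      have "sc D (qmap i x ?u D ?u') \<noteq> 0"
        using t uu by (simp add: sc_qmap[OF D] supp_mrestrict)
      then have "qmap i x ?u D ?u' \<noteq> cl 0" by force
      then have "(\<lambda>v. c v - mdeg ?u v - mdeg ?u' v) = ind (W - D)"
        using L qgens_qidx[OF D] by (auto simp: degree_part_simps M_zero split: if_splits)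
      moreover have "mdeg t v = mdeg ?u v + mdeg ?u' v" for v
        using mdeg_add[of ?u ?u'] uu by metis
      ultimately show "mdeg t = (\<lambda>v. c v - ind (W - D) v)"
        by (auto simp: fun_eq_iff) (smt (verit))
    qed
  next
    assume R: ?R
    show ?L
    proof (intro ballI allI)
      fix u D u' assume D: "D \<in> qidx i"
      show "qmap i x u D u' \<in> grd (degree_part W M D) (\<lambda>v. c v - mdeg u v - mdeg u' v)"
      proof (cases "qmap i x u D u' = cl 0")
        case True
        then show ?thesis by (simp add: degree_part_simps M_zero zero_grd)
      next
        case False
        note * = qmap_nonzeroD[OF D False]
        have "supp (u + u') \<subseteq> V" using * WV by (auto simp: supp_add)
        then have "mdeg (u + u') = (\<lambda>v. c v - ind (W - D) v)" using R * by blast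
        then have "(\<lambda>v. c v - mdeg u v - mdeg u' v) = ind (W - D)"
          by (simp add: mdeg_add fun_eq_iff) (smt (verit))
        then show ?thesis using qmap_grd[OF D] by (simp add: degree_part_simps)
      qed
    qed
  qed
  also have "\<dots> \<longleftrightarrow> (\<forall>D\<in>qgens i. x D \<in> homogeneous V (\<lambda>v. c v - ind (W - D) v))"
    using quot_objD[OF x] by (auto simp: homogeneous_def in_keys_iff in_carrier_poly_ring)
  finally show ?thesis using x by (simp add: quot_obj_simps)
qed

lemma qmap_bij: "bij_betw (qmap i) (carrier (free_obj V quot_complex i)) (carrier (obj LC i))"
  unfolding bij_betw_def
proof
  show "inj_on (qmap i) (carrier (free_obj V quot_complex i))"
  proof (rule inj_onI)
    fix x y :: "'v set \<Rightarrow> ('v, 'b) mpoly"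
    assume x: "x \<in> carrier (free_obj V quot_complex i)" and y: "y \<in> carrier (free_obj V quot_complex i)"
      and eq: "qmap i x = qmap i y"
    show "x = y"
    proof (rule PiE_ext)
      show "x \<in> (\<Pi>\<^sub>E D\<in>qgens i. carrier (poly_ring V))" "y \<in> (\<Pi>\<^sub>E D\<in>qgens i. carrier (poly_ring V))"
        using x y by (simp_all add: quot_obj_carrier)
      fix D assume D: "D \<in> qgens i"
      show "x D = y D"
      proof (rule poly_mapping_eqI)
        fix t
        show "Poly_Mapping.lookup (x D) t = Poly_Mapping.lookup (y D) t"
        proof (cases "supp t \<subseteq> V")
          case True
          let ?u = "mrestrict (V - W) t" and ?u' = "mrestrict W t"
          have "sc D (qmap i x ?u D ?u') = sc D (qmap i y ?u D ?u')" using eq by simp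
          then show ?thesis
            by (simp add: sc_qmap[OF D] supp_mrestrict mrestrict_add_mrestrict[OF True WV])
        next
          case False
          then have "t \<notin> Poly_Mapping.keys (x D)" "t \<notin> Poly_Mapping.keys (y D)"
            using carrier_poly_ringD[OF quot_objD[OF x D]] carrier_poly_ringD[OF quot_objD[OF y D]] by blast+
          then show ?thesis by (simp add: in_keys_iff)
        qed
      qed
    qed
  qed
  show "qmap i ` carrier (free_obj V quot_complex i) = carrier (obj LC i)"
  proof (intro equalityI subsetI)
    fix f :: "'v monom \<Rightarrow> 'v set \<Rightarrow> 'v monom \<Rightarrow> ('v, 'b) mpoly set"
    assume f: "f \<in> carrier (obj LC i)"
    \<comment> \<open>The inverse map: the coefficient at \<open>t\<close> is read off at the pair
      of restrictions of \<open>t\<close>.\<close>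
    define g where "g = (\<lambda>D t. if supp t \<subseteq> V then sc D (f (mrestrict (V - W) t) D (mrestrict W t)) else 0)"
    have fin: "finite {t. g D t \<noteq> 0}" if D: "D \<in> qidx i" for D
    proof (rule finite_subset)
      show "{t. g D t \<noteq> 0} \<subseteq> (\<Union>u\<in>{u. f u \<noteq> \<zero>\<^bsub>Ls i\<^esub>}. (\<lambda>u'. u + u') ` {u'. f u D u' \<noteq> cl 0})"
      proof
        fix t assume "t \<in> {t. g D t \<noteq> 0}"
        then have t: "supp t \<subseteq> V" "sc D (f (mrestrict (V - W) t) D (mrestrict W t)) \<noteq> 0"
          by (auto simp: g_def split: if_splits)
        then have 1: "f (mrestrict (V - W) t) D (mrestrict W t) \<noteq> cl 0" by force
        then have 2: "f (mrestrict (V - W) t) \<noteq> \<zero>\<^bsub>Ls i\<^esub>"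
          using D by (auto simp: direct_sum_simps(2) extend_scalars_simps(2) degree_part_simps M_zero)
        show "t \<in> (\<Union>u\<in>{u. f u \<noteq> \<zero>\<^bsub>Ls i\<^esub>}. (\<lambda>u'. u + u') ` {u'. f u D u' \<noteq> cl 0})"
          using 1 2 mrestrict_add_mrestrict[OF t(1) WV]
          by (intro UN_I[of "mrestrict (V - W) t"] image_eqI[of _ _ "mrestrict W t"]) simp_all
      qed
      have "finite {u. f u \<noteq> \<zero>\<^bsub>Ls i\<^esub>}" using f by (simp add: LC_simps extend_scalars_simps(1))
      moreover have "finite {u'. f u D u' \<noteq> cl 0}" for u
        using Ls_carrierD[OF LC_carrierD(1)[OF f] D, of u]
        by (simp add: extend_scalars_simps(1) degree_part_simps M_zero)
      ultimately show "finite (\<Union>u\<in>{u. f u \<noteq> \<zero>\<^bsub>Ls i\<^esub>}. (\<lambda>u'. u + u') ` {u'. f u D u' \<noteq> cl 0})"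
        by simp
    qed
    define x where "x = (\<lambda>D\<in>qgens i. Abs_poly_mapping (g D))"
    have lookup_x: "Poly_Mapping.lookup (x D) t = g D t" if "D \<in> qgens i" for D t
      using fin[OF qgens_qidx[OF that]] that by (simp add: x_def)
    have x: "x \<in> carrier (free_obj V quot_complex i)"
      unfolding quot_obj_carrier
    proof (rule PiE_I)
      fix D assume D: "D \<in> qgens i"
      show "x D \<in> carrier (poly_ring V)"
        unfolding in_carrier_poly_ring
      proof
        fix t assume "t \<in> Poly_Mapping.keys (x D)"
        then have "g D t \<noteq> 0" using lookup_x[OF D] by (metis in_keys_iff)
        then show "supp t \<subseteq> V" unfolding g_def by meson
      qed
    qed (simp add: x_def)
    have "qmap i x = f"
    proof (rule qmap_eqI)
      show "f u \<in> carrier (Ls i)" for u using LC_carrierD(1)[OF f] .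
      fix u D u' assume D: "D \<in> qgens i"
      show "sc D (f u D u') = (if supp u \<subseteq> V - W \<and> supp u' \<subseteq> W then Poly_Mapping.lookup (x D) (u + u') else 0)"
      proof (cases "supp u \<subseteq> V - W \<and> supp u' \<subseteq> W")
        case True
        then have "supp (u + u') \<subseteq> V" using WV by (auto simp: supp_add)
        then show ?thesis using True by (simp add: lookup_x[OF D] g_def mrestrict_of_add[of u V W u'])
      next
        case False
        then have "f u D u' = cl 0"
          using LC_carrierD(2)[OF f _ qgens_qidx[OF D], of u u']
            Ex_carrierD(2)[OF Ls_carrierD[OF LC_carrierD(1)[OF f] qgens_qidx[OF D]], of u' u] by blast
        then show ?thesis unfolding if_not_P[OF False] by simp
      qed
    qed
    then show "f \<in> qmap i ` carrier (free_obj V quot_complex i)" using x by blast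
  qed (use qmap_carrier in blast)
qed

lemma qmap_iso: "graded_iso V (free_obj V quot_complex i) (obj LC i) (qmap i)"
proof (rule graded_isoI)
  show "graded_hom V (free_obj V quot_complex i) (obj LC i) (qmap i)"
    unfolding graded_hom_def
  proof (intro conjI ballI allI)
    show "qmap i ` grd (free_obj V quot_complex i) c \<subseteq> grd (obj LC i) c" for c
    proof (rule image_subsetI)
      fix x assume x: "x \<in> grd (free_obj V quot_complex i) c"
      then have "x \<in> carrier (free_obj V quot_complex i)" by (simp add: quot_obj_simps(3))
      then show "qmap i x \<in> grd (obj LC i) c" using x qmap_grd_iff by blast
    qed
  qed (use qmap_carrier qmap_add qmap_smult in blast)+
  show "grd (obj LC i) c \<subseteq> carrier (obj LC i)" for c
    by (auto simp: LC_simps extend_scalars_simps(4))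
qed (use qmap_bij qmap_grd_iff in blast)+

lemma monomial_var_mult:
  "(- 1) ^ n * var v * p = Poly_Mapping.single (Poly_Mapping.single v 1) ((- 1) ^ n) * (p :: ('v, 'k::field) mpoly)"
  by (simp add: minus_one_power_mpoly var_def monomial_def mult_single)

text \<open>Multiplication by \<open>v\<close> leads from \<open>D' - {v}\<close> to
  \<open>D'\<close>, so all summands of the differential at \<open>D'\<close> are classes of
  multiples of the one monomial \<open>set_monom D'\<close>, and the comparison reduces to
  scalars.\<close>

lemma qmap_diff:
  fixes x :: "'v set \<Rightarrow> ('v, 'k::field) mpoly"
  assumes x: "x \<in> carrier (free_obj V quot_complex i)"
  shows "qmap (i - 1) (fdiff quot_complex i x) = diff LC i (qmap i x)"
proof (intro ext)
  fix u D' u'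
  show "qmap (i - 1) (fdiff quot_complex i x) u D' u' = diff LC i (qmap i x) u D' u'"
  proof (cases "D' \<in> qidx (i - 1)")
    case False
    then show ?thesis by (simp add: qmap_def LC_simps)
  next
    case D': True
    have sub: "D' \<subseteq> W" and finD': "finite D'" using qidx_subset[OF D'] finite_subsets_W by auto
    have idx: "D' - {v} \<in> qidx i" if "v \<in> D'" for v
    proof -
      have "W - (D' - {v}) = insert v (W - D')" using that sub by auto
      then have "card (W - (D' - {v})) = Suc (card (W - D'))"
        using finW that by simp
      then show ?thesis using D' sub by (auto simp: qidx_def)
    qed
    define ok where "ok = (supp u \<subseteq> V - W \<and> supp u' \<subseteq> W)"
    \<comment> \<open>The scalar contributed by \<open>v\<close>; it is zero if \<open>v\<close>
      does not divide \<open>u'\<close>, as \<open>mult_both\<close> also multiplies the second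
      factor by \<open>v\<close>.\<close>
    define g where "g = (\<lambda>v. if ok \<and> D' - {v} \<in> qgens i \<and> 1 \<le> expo u' v
      then (- 1) ^ alpha r v (D' - {v}) * Poly_Mapping.lookup (x (D' - {v})) (u + (u' - Poly_Mapping.single v 1))
      else 0)"
    have gJ: "Poly_Mapping.single (set_monom D') (g v) \<in> J" if "v \<in> D'" for v
    proof (cases "g v = 0")
      case False
      then have "D' - {v} \<in> JJ" by (auto simp: g_def qgens_def split: if_splits)
      then have "D' \<in> JJ" using JJ_up sub by blast
      then show ?thesis using sub finD' by (intro monomial_span_single) auto
    qed simp
    have "(- 1) ^ alpha r v (D' - {v}) \<odot>\<^bsub>M\<^esub> mult_both M v (qmap i x u (D' - {v})) u'
      = cl (Poly_Mapping.single (set_monom D') (g v))" if v: "v \<in> D'" for v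
    proof (cases "1 \<le> expo u' v")
      case False
      then show ?thesis
        by (simp add: mult_both_def g_def M_zero minus_one_power_mpoly smult_const)
    next
      case True
      let ?u = "u' - Poly_Mapping.single v 1"
      have varv: "var v \<in> carrier (poly_ring W :: ('v, 'k) mpoly ring)"
        using v sub by (auto simp: var_def in_carrier_poly_ring)
      have supp_iff: "supp ?u \<subseteq> W \<longleftrightarrow> supp u' \<subseteq> W"
      proof -
        have "supp u' = supp ?u \<union> {v}"
          using True by (auto simp: in_keys_iff lookup_minus lookup_single when_def split: if_splits)
        then show ?thesis using v sub by auto
      qed
      have D'_eq: "Poly_Mapping.single v 1 + set_monom (D' - {v}) = set_monom D'"
        using set_monom_insert[of "D' - {v}" v] finD' v by (simp add: insert_absorb)
      have "qmap i x u (D' - {v}) ?u = (if ok \<and> D' - {v} \<in> qgens i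
        then cl (Poly_Mapping.single (set_monom (D' - {v})) (Poly_Mapping.lookup (x (D' - {v})) (u + ?u))) else cl 0)"
        using idx[OF v] supp_iff by (simp add: qmap_def ok_def)
      then have "mult_both M v (qmap i x u (D' - {v})) u' = (if ok \<and> D' - {v} \<in> qgens i
        then cl (Poly_Mapping.single (set_monom D') (Poly_Mapping.lookup (x (D' - {v})) (u + ?u))) else cl 0)"
        using True
        by (simp add: mult_both_def M_smult[OF varv] del: One_nat_def)
          (simp add: var_def monomial_def mult_single D'_eq del: One_nat_def)
      then show ?thesis
        using True by (simp add: g_def minus_one_power_mpoly smult_const mult_single del: One_nat_def)
    qed
    then have "diff LC i (qmap i x) u D' u' = finsum M (\<lambda>v. cl (Poly_Mapping.single (set_monom D') (g v))) D'"
      using D' gJ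
      by (simp add: LC_simps, intro abelian_monoid.finsum_cong'[OF abelian_group.axioms(1)[OF M_abelian_group]])
        (auto simp: M_carrier)
    also have "\<dots> = cl (\<Sum>v\<in>D'. Poly_Mapping.single (set_monom D') (g v))"
      using gJ by (rule finsum_cl)
    also have "(\<Sum>v\<in>D'. Poly_Mapping.single (set_monom D') (g v)) = Poly_Mapping.single (set_monom D') (\<Sum>v\<in>D'. g v)"
      by (rule poly_mapping_eqI) (simp add: lookup_sum lookup_single when_def)
    finally have eq: "diff LC i (qmap i x) u D' u' = cl (Poly_Mapping.single (set_monom D') (\<Sum>v\<in>D'. g v))" .
    show ?thesis
    proof (cases "D' \<in> qgens (i - 1)")
      case True
      have "(\<Sum>v\<in>D'. g v) = (if ok then Poly_Mapping.lookup (fdiff quot_complex i x D') (u + u') else 0)"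
      proof (cases ok)
        case okT: True
        have "g v = Poly_Mapping.lookup (if D' - {v} \<in> qgens i
          then (- 1) ^ alpha r v (D' - {v}) * var v * x (D' - {v}) else 0) (u + u')" if v: "v \<in> D'" for v
        proof (cases "D' - {v} \<in> qgens i")
          case D: True
          let ?e = "Poly_Mapping.single v (1::nat)"
          \<comment> \<open>\<open>v\<close> lies in \<open>W\<close> and \<open>u\<close> has no
            variables there, so dividing \<open>u + u'\<close> by \<open>v\<close> affects
            \<open>u'\<close> alone.\<close>
          have uv: "expo u v = 0" using okT v sub by (auto simp: ok_def in_keys_iff)
          have dv: "mdivides ?e (u + u') \<longleftrightarrow> 1 \<le> expo u' v"
            using uv by (auto simp: mdivides_def lookup_single when_def lookup_add)
          have dd: "u + u' - ?e = u + (u' - ?e)"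
            using uv by (intro poly_mapping_eqI) (auto simp: lookup_minus lookup_add lookup_single when_def)
          show ?thesis
            using D okT by (simp add: g_def monomial_var_mult lookup_single_mult dv dd del: One_nat_def)
        next
          case False
          then show ?thesis by (simp add: g_def)
        qed
        then show ?thesis using okT True by (simp add: quot_complex_simps lookup_sum)
      next
        case False
        then show ?thesis by (simp add: g_def)
      qed
      then show ?thesis unfolding eq using True D' by (simp add: qmap_def ok_def)
    next
      case False
      \<comment> \<open>Outside \<open>qgens\<close> the sum must vanish in the quotient: for
        \<open>D' \<notin> JJ\<close> no source \<open>D' - {v}\<close> is a generator, and for
        \<open>D' \<in> PP\<close> the monomial of \<open>D'\<close> lies in
        \<open>P\<close>.\<close>
      then consider "D' \<notin> JJ" | "D' \<in> PP" using D' by (auto simp: qgens_def)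
      then have "Poly_Mapping.single (set_monom D') (\<Sum>v\<in>D'. g v) \<in> P"
      proof cases
        case 1
        have "g v = 0" if "v \<in> D'" for v
        proof (rule ccontr)
          assume "g v \<noteq> 0"
          then have "D' - {v} \<in> JJ" by (auto simp: g_def qgens_def split: if_splits)
          then show False using 1 JJ_up sub by blast
        qed
        then show ?thesis by simp
      next
        case 2
        then show ?thesis using sub finD' by (intro monomial_span_single) auto
      qed
      then have "cl (Poly_Mapping.single (set_monom D') (\<Sum>v\<in>D'. g v)) = cl 0" by (simp add: cl_eq_iff)
      then show ?thesis unfolding eq using False D' by (simp add: qmap_def)
    qed
  qed
qed

theorem quot_complex_iso_LC:
  "complex_iso V (underlying_complex V (quot_complex :: (('v, 'k::field) mpoly, 'v set, 'v) free_complex)) LC"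
  unfolding complex_iso_def underlying_complex_def
  by (rule exI[of _ qmap]) (simp add: qmap_iso qmap_diff)

end

section \<open>From minimal free resolutions to scalar matrices\<close>

lemma single_eq_0_iff: "Poly_Mapping.single t a = 0 \<longleftrightarrow> a = 0"
  by (metis lookup_single_eq lookup_zero single_zero)

text \<open>The inequalities keep the truncation in \<open>deg_monom\<close> from taking effect, so
  the exponents telescope.\<close>

lemma deg_monom_diff_add:
  assumes "finite V" "a \<in> degrees V" "b \<in> degrees V" "c \<in> degrees V" "a \<le> b" "b \<le> c"
  shows "deg_monom (\<lambda>v. c v - b v) + deg_monom (\<lambda>v. b v - a v) = deg_monom (\<lambda>v. c v - a v)"
proof (rule poly_mapping_eqI)
  fix v
  have "(\<lambda>v. c v - b v) \<in> degrees V" "(\<lambda>v. b v - a v) \<in> degrees V" "(\<lambda>v. c v - a v) \<in> degrees V"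
    using assms by (auto simp: degrees_def)
  moreover have "a v \<le> b v" "b v \<le> c v" using assms by (auto simp: le_fun_def)
  ultimately show "expo (deg_monom (\<lambda>v. c v - b v) + deg_monom (\<lambda>v. b v - a v)) v =
    expo (deg_monom (\<lambda>v. c v - a v)) v"
    using assms(1) by (simp add: lookup_add expo_deg_monom)
qed

lemma mdivides_deg_monom:
  assumes "finite V" "a \<in> degrees V" "b \<in> degrees V" "c \<in> degrees V" "a \<le> b" "a \<le> c"
    "mdivides (deg_monom (\<lambda>v. b v - a v)) (deg_monom (\<lambda>v. c v - a v))"
  shows "b \<le> c"
proof (rule le_funI)
  fix v
  have "(\<lambda>v. b v - a v) \<in> degrees V" "(\<lambda>v. c v - a v) \<in> degrees V"
    using assms by (auto simp: degrees_def)
  then have "nat (b v - a v) \<le> nat (c v - a v)"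
    using assms(1,7) by (simp add: mdivides_def expo_deg_monom)
  moreover have "a v \<le> b v" "a v \<le> c v" using assms by (auto simp: le_fun_def)
  ultimately show "b v \<le> c v" by linarith
qed

lemma graded_homD:
  assumes "graded_hom V M N f"
  shows "x \<in> carrier M \<Longrightarrow> f x \<in> carrier N"
    "x \<in> carrier M \<Longrightarrow> y \<in> carrier M \<Longrightarrow> f (x \<oplus>\<^bsub>M\<^esub> y) = f x \<oplus>\<^bsub>N\<^esub> f y"
    "p \<in> carrier (poly_ring V) \<Longrightarrow> x \<in> carrier M \<Longrightarrow> f (p \<odot>\<^bsub>M\<^esub> x) = p \<odot>\<^bsub>N\<^esub> f x"
    "x \<in> grd M c \<Longrightarrow> f x \<in> grd N c"
proof -
  show "x \<in> grd M c \<Longrightarrow> f x \<in> grd N c"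
    using assms by (simp add: graded_hom_def) blast
qed (use assms in \<open>simp_all add: graded_hom_def Pi_iff\<close>)

section \<open>Scalar coordinates of a multigraded resolution\<close>

locale monomial_resolution =
  fixes V :: "'v set" and S :: "'v set set"
    and F :: "(('v, 'k::field) mpoly, 'b, 'v) free_complex"
    and aug :: "('b \<Rightarrow> ('v, 'k) mpoly) \<Rightarrow> ('v, 'k) mpoly"
  assumes finV: "finite V" and res: "minimal_free_resolution V (monomial_span V S) F aug"
begin

abbreviation Fobj where "Fobj \<equiv> free_obj V F"

definition unit_vec :: "int \<Rightarrow> 'b \<Rightarrow> 'b \<Rightarrow> ('v, 'k) mpoly" where
  "unit_vec i b = (\<lambda>b'\<in>gens F i. if b' = b then 1 else 0)"

text \<open>The entry is homogeneous, so this one coefficient determines it. If the difference of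
  degrees has a negative component, the truncated monomial means nothing, but the entry is then
  zero.\<close>

definition coeff_mat :: "int \<Rightarrow> 'b \<Rightarrow> 'b \<Rightarrow> 'k" where
  "coeff_mat i b b' = Poly_Mapping.lookup (fdiff F i (unit_vec i b) b')
     (deg_monom (\<lambda>v. gdeg F i b v - gdeg F (i - 1) b' v))"

definition coeff_aug :: "'b \<Rightarrow> 'k" where
  "coeff_aug b = Poly_Mapping.lookup (aug (unit_vec 0 b)) (deg_monom (gdeg F 0 b))"

definition ideal_degrees :: "('v \<Rightarrow> int) set" where
  "ideal_degrees = {mdeg t | t. supp t \<subseteq> V \<and> supp t \<in> S}"

text \<open>
  This is homogeneous of degree c only if \<kappa> vanishes at the generators whose degree is not at
  most c, as the exponents are truncated at 0.
\<close>

definition hvec :: "int \<Rightarrow> ('v \<Rightarrow> int) \<Rightarrow> ('b \<Rightarrow> 'k) \<Rightarrow> 'b \<Rightarrow> ('v, 'k) mpoly" where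
  "hvec i c \<kappa> = (\<lambda>b\<in>gens F i. Poly_Mapping.single (deg_monom (\<lambda>v. c v - gdeg F i b v)) (\<kappa> b))"

text \<open>The counterpart of \<open>hvec\<close> for arbitrary \<open>x\<close>: the scalars of
  its component of degree \<open>c\<close>. The test keeps truncated exponents from picking up
  foreign coefficients.\<close>

definition part_at :: "int \<Rightarrow> ('v \<Rightarrow> int) \<Rightarrow> ('b \<Rightarrow> ('v, 'k) mpoly) \<Rightarrow> 'b \<Rightarrow> 'k" where
  "part_at i c x b = (if gdeg F i b \<le> c
     then Poly_Mapping.lookup (x b) (deg_monom (\<lambda>v. c v - gdeg F i b v)) else 0)"

lemma finite_gens: "finite (gens F i)"
  using res by (simp add: minimal_free_resolution_def)

lemma gdeg_degrees: "b \<in> gens F i \<Longrightarrow> gdeg F i b \<in> degrees V"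
  using res by (simp add: minimal_free_resolution_def)

lemma gens_neg: "i < 0 \<Longrightarrow> gens F i = {}"
  using res by (simp add: minimal_free_resolution_def)

lemma hom_fdiff: "graded_hom V (Fobj i) (Fobj (i - 1)) (fdiff F i)"
  using res by (simp add: minimal_free_resolution_def)

lemma hom_aug: "graded_hom V (Fobj 0) (ideal_module V (monomial_span V S)) aug"
  using res by (simp add: minimal_free_resolution_def)

lemma aug_surj: "aug ` carrier (Fobj 0) = monomial_span V S"
  using res by (simp add: minimal_free_resolution_def)

lemma exact_aug: "{x \<in> carrier (Fobj 0). aug x = 0} = fdiff F 1 ` carrier (Fobj 1)"
  using res by (simp add: minimal_free_resolution_def)

lemma exact_fdiff: "i \<ge> 1 \<Longrightarrow> {x \<in> carrier (Fobj i). fdiff F i x = \<zero>\<^bsub>Fobj (i - 1)\<^esub>} =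
  fdiff F (i + 1) ` carrier (Fobj (i + 1))"
  using res by (simp add: minimal_free_resolution_def)

lemma minimal: "x \<in> carrier (Fobj i) \<Longrightarrow> b \<in> gens F (i - 1) \<Longrightarrow>
  fdiff F i x b \<in> genideal (poly_ring V) (var ` V)"
  using res by (simp add: minimal_free_resolution_def)

lemma Fobj_simps:
  "x \<in> carrier (Fobj i) \<longleftrightarrow> x \<in> (\<Pi>\<^sub>E b\<in>gens F i. carrier (poly_ring V))"
  "x \<oplus>\<^bsub>Fobj i\<^esub> y = (\<lambda>b\<in>gens F i. x b + y b)"
  "p \<odot>\<^bsub>Fobj i\<^esub> x = (\<lambda>b\<in>gens F i. p * x b)"
  "\<zero>\<^bsub>Fobj i\<^esub> = (\<lambda>b\<in>gens F i. 0)"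
  "x \<in> grd (Fobj i) c \<longleftrightarrow> x \<in> carrier (Fobj i) \<and>
     (\<forall>b\<in>gens F i. x b \<in> homogeneous V (\<lambda>v. c v - gdeg F i b v))"
  using finite_gens by (simp_all add: free_obj_def direct_sum_simps shifted_ring_simps)

lemma FobjD: "x \<in> carrier (Fobj i) \<Longrightarrow> b \<in> gens F i \<Longrightarrow> x b \<in> carrier (poly_ring V)"
  by (auto simp: Fobj_simps(1) dest: PiE_mem)

lemma Fobj_undefined: "x \<in> carrier (Fobj i) \<Longrightarrow> b \<notin> gens F i \<Longrightarrow> x b = undefined"
  unfolding Fobj_simps(1) by (rule PiE_arb)

lemma Fobj_eqI:
  assumes "x \<in> carrier (Fobj i)" "y \<in> carrier (Fobj i)" "\<And>b. b \<in> gens F i \<Longrightarrow> x b = y b"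
  shows "x = y"
  by (rule ext) (metis assms Fobj_undefined)

lemma fdiff_closed: "x \<in> carrier (Fobj i) \<Longrightarrow> fdiff F i x \<in> carrier (Fobj (i - 1))"
  by (rule graded_homD(1)[OF hom_fdiff])

lemma unit_vec_carrier: "unit_vec i b \<in> carrier (Fobj i)"
  by (auto simp: unit_vec_def Fobj_simps(1) poly_ring_closed)

lemma unit_vec_grd: "b \<in> gens F i \<Longrightarrow> unit_vec i b \<in> grd (Fobj i) (gdeg F i b)"
proof -
  assume "b \<in> gens F i"
  moreover have "(1 :: ('v, 'k) mpoly) \<in> homogeneous V (\<lambda>v. 0)"
    by (simp add: homogeneous_def poly_ring_closed)
  ultimately show ?thesis
    using unit_vec_carrier[of i b] by (auto simp: Fobj_simps(5) unit_vec_def)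
qed

text \<open>Induction over the truncations of \<open>x\<close> to growing sets of generators; the
  empty truncation is killed because it equals its own multiple by 0.\<close>

lemma linear_expansion:
  assumes add: "\<And>x y. x \<in> carrier (Fobj i) \<Longrightarrow> y \<in> carrier (Fobj i) \<Longrightarrow> h (x \<oplus>\<^bsub>Fobj i\<^esub> y) = h x + h y"
    and smult: "\<And>p x. p \<in> carrier (poly_ring V) \<Longrightarrow> x \<in> carrier (Fobj i) \<Longrightarrow> h (p \<odot>\<^bsub>Fobj i\<^esub> x) = p * h x"
    and x: "x \<in> carrier (Fobj i)"
  shows "h x = (\<Sum>b\<in>gens F i. x b * h (unit_vec i b))"
proof -
  define xa where "xa A = (\<lambda>b\<in>gens F i. if b \<in> A then x b else 0)" for A
  have xa: "xa A \<in> carrier (Fobj i)" for A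
    using FobjD[OF x] by (auto simp: xa_def Fobj_simps(1) poly_ring_closed)
  have "h (xa A) = (\<Sum>b\<in>A. x b * h (unit_vec i b))" if "A \<subseteq> gens F i" for A
    using finite_subset[OF that finite_gens] that
  proof (induction A rule: finite_induct)
    case empty
    have "0 \<odot>\<^bsub>Fobj i\<^esub> xa {} = xa {}" by (simp add: xa_def Fobj_simps(3) restrict_def)
    then have "h (xa {}) = 0 * h (xa {})" using smult[OF poly_ring_closed(1) xa, of "{}"] by simp
    then show ?case by simp
  next
    case (insert b A)
    have "xa (insert b A) = (x b \<odot>\<^bsub>Fobj i\<^esub> unit_vec i b) \<oplus>\<^bsub>Fobj i\<^esub> xa A"
      using insert by (auto simp: xa_def Fobj_simps unit_vec_def restrict_def fun_eq_iff)
    moreover have "x b \<odot>\<^bsub>Fobj i\<^esub> unit_vec i b \<in> carrier (Fobj i)"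
      using FobjD[OF x, of b] insert FobjD[OF unit_vec_carrier]
      by (auto simp: Fobj_simps(1,3) poly_ring_closed)
    ultimately have "h (xa (insert b A)) = x b * h (unit_vec i b) + h (xa A)"
      using add xa smult unit_vec_carrier FobjD[OF x, of b] insert by simp
    then show ?case using insert by simp
  qed
  from this[OF order_refl] have "h (xa (gens F i)) = (\<Sum>b\<in>gens F i. x b * h (unit_vec i b))" .
  moreover have "xa (gens F i) = x"
    by (rule Fobj_eqI[OF xa x]) (simp add: xa_def)
  ultimately show ?thesis by simp
qed

lemma fdiff_expansion:
  assumes "x \<in> carrier (Fobj i)" "b' \<in> gens F (i - 1)"
  shows "fdiff F i x b' = (\<Sum>b\<in>gens F i. x b * fdiff F i (unit_vec i b) b')"
proof (rule linear_expansion[where h = "\<lambda>x. fdiff F i x b'"])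
  show "fdiff F i (y \<oplus>\<^bsub>Fobj i\<^esub> z) b' = fdiff F i y b' + fdiff F i z b'"
    if "y \<in> carrier (Fobj i)" "z \<in> carrier (Fobj i)" for y z
    unfolding graded_homD(2)[OF hom_fdiff that] using assms(2) by (simp add: Fobj_simps(2))
  show "fdiff F i (p \<odot>\<^bsub>Fobj i\<^esub> z) b' = p * fdiff F i z b'"
    if "p \<in> carrier (poly_ring V)" "z \<in> carrier (Fobj i)" for p z
    unfolding graded_homD(3)[OF hom_fdiff that] using assms(2) by (simp add: Fobj_simps(3))
qed (rule assms(1))

lemma aug_expansion:
  assumes "x \<in> carrier (Fobj 0)"
  shows "aug x = (\<Sum>b\<in>gens F 0. x b * aug (unit_vec 0 b))"
  by (rule linear_expansion[OF _ _ assms])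
    (simp_all add: graded_homD(2,3)[OF hom_aug], simp_all add: ideal_module_def)

text \<open>A nonzero homogeneous polynomial has nonnegative degree, which orders the two
  generators; equal degrees would leave a nonzero constant, contrary to minimality.\<close>

lemma fdiff_unit_vec:
  assumes b: "b \<in> gens F i" and b': "b' \<in> gens F (i - 1)"
  shows "fdiff F i (unit_vec i b) b' =
      Poly_Mapping.single (deg_monom (\<lambda>v. gdeg F i b v - gdeg F (i - 1) b' v)) (coeff_mat i b b')"
    and "coeff_mat i b b' \<noteq> 0 \<Longrightarrow> gdeg F (i - 1) b' \<le> gdeg F i b"
    and "coeff_mat i b b' \<noteq> 0 \<Longrightarrow> gdeg F (i - 1) b' \<noteq> gdeg F i b"
proof -
  have "fdiff F i (unit_vec i b) \<in> grd (Fobj (i - 1)) (gdeg F i b)"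
    by (rule graded_homD(4)[OF hom_fdiff unit_vec_grd[OF b]])
  then have h: "fdiff F i (unit_vec i b) b' \<in> homogeneous V (\<lambda>v. gdeg F i b v - gdeg F (i - 1) b' v)"
    using b' by (simp add: Fobj_simps(5))
  show "fdiff F i (unit_vec i b) b' =
      Poly_Mapping.single (deg_monom (\<lambda>v. gdeg F i b v - gdeg F (i - 1) b' v)) (coeff_mat i b b')"
    unfolding coeff_mat_def by (rule homogeneous_eq_single[OF h])
  assume nz: "coeff_mat i b b' \<noteq> 0"
  then have "fdiff F i (unit_vec i b) b' \<noteq> 0" by (auto simp: coeff_mat_def)
  then have "\<forall>v. 0 \<le> gdeg F i b v - gdeg F (i - 1) b' v" using homogeneous_eq_0[OF h] by blast
  then show "gdeg F (i - 1) b' \<le> gdeg F i b" by (simp add: le_fun_def)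
  show "gdeg F (i - 1) b' \<noteq> gdeg F i b"
  proof
    assume "gdeg F (i - 1) b' = gdeg F i b"
    moreover have "deg_monom (\<lambda>v. 0) = (0 :: 'v monom)" by (simp add: deg_monom_def)
    ultimately have "coeff_mat i b b' = Poly_Mapping.lookup (fdiff F i (unit_vec i b) b') 0"
      by (simp add: coeff_mat_def)
    then show False using nz maximal_ideal_lookup_0[OF minimal[OF unit_vec_carrier b']] by simp
  qed
qed

lemma aug_unit_vec:
  assumes b: "b \<in> gens F 0"
  shows "aug (unit_vec 0 b) = Poly_Mapping.single (deg_monom (gdeg F 0 b)) (coeff_aug b)"
    and "coeff_aug b \<noteq> 0 \<Longrightarrow> gdeg F 0 b \<in> ideal_degrees"
    and "coeff_aug b \<noteq> 0 \<Longrightarrow> (\<lambda>v. 0) \<le> gdeg F 0 b"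
proof -
  have h: "aug (unit_vec 0 b) \<in> homogeneous V (gdeg F 0 b)" "aug (unit_vec 0 b) \<in> monomial_span V S"
    using graded_homD(4)[OF hom_aug unit_vec_grd[OF b]] by (simp_all add: ideal_module_def)
  show "aug (unit_vec 0 b) = Poly_Mapping.single (deg_monom (gdeg F 0 b)) (coeff_aug b)"
    unfolding coeff_aug_def by (rule homogeneous_eq_single[OF h(1)])
  assume nz: "coeff_aug b \<noteq> 0"
  then have t: "deg_monom (gdeg F 0 b) \<in> Poly_Mapping.keys (aug (unit_vec 0 b))"
    by (simp add: coeff_aug_def in_keys_iff)
  then have m: "mdeg (deg_monom (gdeg F 0 b)) = gdeg F 0 b"
    using h(1) by (simp add: homogeneous_def)
  then show "(\<lambda>v. 0) \<le> gdeg F 0 b"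
    using mdeg_nonneg[of "deg_monom (gdeg F 0 b)"] by (simp add: le_fun_def)
  have "supp (deg_monom (gdeg F 0 b)) \<subseteq> V \<and> supp (deg_monom (gdeg F 0 b)) \<in> S"
    using t h(2) unfolding monomial_span_def by blast
  then have "mdeg (deg_monom (gdeg F 0 b)) \<in> ideal_degrees"
    unfolding ideal_degrees_def by blast
  then show "gdeg F 0 b \<in> ideal_degrees" unfolding m .
qed

lemma hvec_grd:
  assumes c: "c \<in> degrees V" and \<kappa>: "supp_le (gens F i) (gdeg F i) c \<kappa>"
  shows "hvec i c \<kappa> \<in> grd (Fobj i) c"
proof -
  have "Poly_Mapping.single (deg_monom (\<lambda>v. c v - gdeg F i b v)) (\<kappa> b) \<in>
      homogeneous V (\<lambda>v. c v - gdeg F i b v)" if b: "b \<in> gens F i" for b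
  proof (cases "\<kappa> b = 0")
    case False
    then have "\<forall>v. 0 \<le> c v - gdeg F i b v" using \<kappa> b by (auto simp: supp_le_def le_fun_def)
    moreover have deg: "(\<lambda>v. c v - gdeg F i b v) \<in> degrees V"
      using c gdeg_degrees[OF b] by (auto simp: degrees_def)
    ultimately have m: "mdeg (deg_monom (\<lambda>v. c v - gdeg F i b v)) = (\<lambda>v. c v - gdeg F i b v)"
      using mdeg_deg_monom[OF finV] by blast
    have "supp (deg_monom (\<lambda>v. c v - gdeg F i b v)) \<subseteq> V" unfolding mdeg_degrees m by (rule deg)
    then show ?thesis by (rule single_homogeneous[OF _ m])
  qed simp
  then show ?thesis
    by (auto simp: hvec_def Fobj_simps(1,5) homogeneous_def)
qed

lemma hvec_carrier: "c \<in> degrees V \<Longrightarrow> supp_le (gens F i) (gdeg F i) c \<kappa> \<Longrightarrow> hvec i c \<kappa> \<in> carrier (Fobj i)"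
  using hvec_grd by (auto simp: Fobj_simps(5))

lemma part_at_supp_le: "supp_le (gens F i) (gdeg F i) c (part_at i c x)"
  by (simp add: supp_le_def part_at_def)

text \<open>In every term with a nonzero scalar the monomials of degrees
  \<open>c - gdeg F i b\<close> and \<open>gdeg F i b - a\<close> multiply to that of degree
  \<open>c - a\<close>, so only the scalars add up.\<close>

lemma sum_hvec:
  assumes c: "c \<in> degrees V" and a: "a \<in> degrees V" and \<kappa>: "supp_le (gens F i) (gdeg F i) c \<kappa>"
    and m: "\<And>b. b \<in> gens F i \<Longrightarrow> m b \<noteq> 0 \<Longrightarrow> a \<le> gdeg F i b"
  shows "(\<Sum>b\<in>gens F i. hvec i c \<kappa> b * Poly_Mapping.single (deg_monom (\<lambda>v. gdeg F i b v - a v)) (m b)) =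
    Poly_Mapping.single (deg_monom (\<lambda>v. c v - a v)) (\<Sum>b\<in>gens F i. \<kappa> b * m b)"
proof -
  have "hvec i c \<kappa> b * Poly_Mapping.single (deg_monom (\<lambda>v. gdeg F i b v - a v)) (m b) =
    Poly_Mapping.single (deg_monom (\<lambda>v. c v - a v)) (\<kappa> b * m b)" if b: "b \<in> gens F i" for b
  proof (cases "\<kappa> b * m b = 0")
    case True
    then show ?thesis using b by (auto simp: hvec_def mult_single)
  next
    case False
    then have "a \<le> gdeg F i b" "gdeg F i b \<le> c" using m b \<kappa> by (auto simp: supp_le_def)
    then show ?thesis
      using deg_monom_diff_add[OF finV a gdeg_degrees[OF b] c] b by (simp add: hvec_def mult_single)
  qed
  then have "(\<Sum>b\<in>gens F i. hvec i c \<kappa> b * Poly_Mapping.single (deg_monom (\<lambda>v. gdeg F i b v - a v)) (m b)) =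
    (\<Sum>b\<in>gens F i. Poly_Mapping.single (deg_monom (\<lambda>v. c v - a v)) (\<kappa> b * m b))"
    by (rule sum.cong[OF refl])
  also have "\<dots> = Poly_Mapping.single (deg_monom (\<lambda>v. c v - a v)) (\<Sum>b\<in>gens F i. \<kappa> b * m b)"
    by (rule poly_mapping_eqI) (simp add: lookup_sum lookup_single when_def)
  finally show ?thesis .
qed

text \<open>The factors have fixed degrees, so only the component of \<open>x\<close> of degree
  \<open>c\<close> contributes; if \<open>gdeg F i b\<close> is not at most \<open>c\<close>, the
  factor does not divide the monomial in question.\<close>

lemma lookup_sum_part_at:
  assumes c: "c \<in> degrees V" and a: "a \<in> degrees V" "a \<le> c"
    and m: "\<And>b. b \<in> gens F i \<Longrightarrow> m b \<noteq> 0 \<Longrightarrow> a \<le> gdeg F i b"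
  shows "Poly_Mapping.lookup (\<Sum>b\<in>gens F i. x b *
      Poly_Mapping.single (deg_monom (\<lambda>v. gdeg F i b v - a v)) (m b)) (deg_monom (\<lambda>v. c v - a v)) =
    (\<Sum>b\<in>gens F i. part_at i c x b * m b)"
  unfolding lookup_sum
proof (rule sum.cong[OF refl])
  fix b assume b: "b \<in> gens F i"
  let ?s = "deg_monom (\<lambda>v. gdeg F i b v - a v)" and ?t = "deg_monom (\<lambda>v. c v - a v)"
  show "Poly_Mapping.lookup (x b * Poly_Mapping.single ?s (m b)) ?t = part_at i c x b * m b"
  proof (cases "m b = 0")
    case False
    note am = m[OF b False]
    show ?thesis
    proof (cases "gdeg F i b \<le> c")
      case True
      have "?t = ?s + deg_monom (\<lambda>v. c v - gdeg F i b v)"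
        using deg_monom_diff_add[OF finV a(1) gdeg_degrees[OF b] c am True] by (simp add: add.commute)
      then show ?thesis
        using True by (simp add: mult.commute[of "x b"] lookup_single_mult part_at_def)
    next
      case False
      then have "\<not> mdivides ?s ?t"
        using mdivides_deg_monom[OF finV a(1) gdeg_degrees[OF b] c am a(2)] by blast
      then show ?thesis
        using False by (simp add: mult.commute[of "x b"] lookup_single_mult part_at_def)
    qed
  qed simp
qed

lemma fdiff_hvec:
  assumes c: "c \<in> degrees V" and \<kappa>: "supp_le (gens F i) (gdeg F i) c \<kappa>" and b': "b' \<in> gens F (i - 1)"
  shows "fdiff F i (hvec i c \<kappa>) b' = Poly_Mapping.single (deg_monom (\<lambda>v. c v - gdeg F (i - 1) b' v))
    (\<Sum>b\<in>gens F i. \<kappa> b * coeff_mat i b b')"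
proof -
  have "fdiff F i (hvec i c \<kappa>) b' = (\<Sum>b\<in>gens F i. hvec i c \<kappa> b * fdiff F i (unit_vec i b) b')"
    by (rule fdiff_expansion[OF hvec_carrier[OF c \<kappa>] b'])
  also have "\<dots> = (\<Sum>b\<in>gens F i. hvec i c \<kappa> b *
      Poly_Mapping.single (deg_monom (\<lambda>v. gdeg F i b v - gdeg F (i - 1) b' v)) (coeff_mat i b b'))"
    by (simp add: fdiff_unit_vec(1)[OF _ b'])
  also have "\<dots> = Poly_Mapping.single (deg_monom (\<lambda>v. c v - gdeg F (i - 1) b' v))
    (\<Sum>b\<in>gens F i. \<kappa> b * coeff_mat i b b')"
    by (rule sum_hvec[OF c gdeg_degrees[OF b'] \<kappa> fdiff_unit_vec(2)[OF _ b']])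
  finally show ?thesis .
qed

lemma aug_hvec:
  assumes c: "c \<in> degrees V" and \<kappa>: "supp_le (gens F 0) (gdeg F 0) c \<kappa>"
  shows "aug (hvec 0 c \<kappa>) = Poly_Mapping.single (deg_monom c) (\<Sum>b\<in>gens F 0. \<kappa> b * coeff_aug b)"
proof -
  have "aug (hvec 0 c \<kappa>) = (\<Sum>b\<in>gens F 0. hvec 0 c \<kappa> b * aug (unit_vec 0 b))"
    by (rule aug_expansion[OF hvec_carrier[OF c \<kappa>]])
  also have "\<dots> = (\<Sum>b\<in>gens F 0. hvec 0 c \<kappa> b *
      Poly_Mapping.single (deg_monom (\<lambda>v. gdeg F 0 b v - 0)) (coeff_aug b))"
    by (simp add: aug_unit_vec(1))
  also have "\<dots> = Poly_Mapping.single (deg_monom (\<lambda>v. c v - 0)) (\<Sum>b\<in>gens F 0. \<kappa> b * coeff_aug b)"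
    by (rule sum_hvec[OF c _ \<kappa> aug_unit_vec(3)]) (simp add: degrees_def)
  finally show ?thesis by simp
qed

lemma fdiff_part_at:
  assumes c: "c \<in> degrees V" and x: "x \<in> carrier (Fobj i)" and b': "b' \<in> gens F (i - 1)"
    and le: "gdeg F (i - 1) b' \<le> c"
  shows "Poly_Mapping.lookup (fdiff F i x b') (deg_monom (\<lambda>v. c v - gdeg F (i - 1) b' v)) =
    (\<Sum>b\<in>gens F i. part_at i c x b * coeff_mat i b b')"
proof -
  have "fdiff F i x b' = (\<Sum>b\<in>gens F i. x b *
      Poly_Mapping.single (deg_monom (\<lambda>v. gdeg F i b v - gdeg F (i - 1) b' v)) (coeff_mat i b b'))"
    using fdiff_expansion[OF x b'] by (simp add: fdiff_unit_vec(1)[OF _ b'])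
  then show ?thesis
    using lookup_sum_part_at[OF c gdeg_degrees[OF b'] le fdiff_unit_vec(2)[OF _ b']] by simp
qed

text \<open>A preimage need not be homogeneous, but its component of degree \<open>c\<close> is
  again a preimage. This makes exactness a statement about scalars.\<close>

lemma exact_degreewise:
  assumes c: "c \<in> degrees V" and \<kappa>: "supp_le (gens F i) (gdeg F i) c \<kappa>"
    and img: "hvec i c \<kappa> \<in> fdiff F (i + 1) ` carrier (Fobj (i + 1))"
  shows "\<exists>\<kappa>'. supp_le (gens F (i + 1)) (gdeg F (i + 1)) c \<kappa>' \<and>
    (\<forall>b\<in>gens F i. \<kappa> b = (\<Sum>b'\<in>gens F (i + 1). \<kappa>' b' * coeff_mat (i + 1) b' b))"
proof -
  obtain x where x: "x \<in> carrier (Fobj (i + 1))" "hvec i c \<kappa> = fdiff F (i + 1) x" using img by blast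
  have "\<kappa> b = (\<Sum>b'\<in>gens F (i + 1). part_at (i + 1) c x b' * coeff_mat (i + 1) b' b)"
    if b: "b \<in> gens F i" for b
  proof (cases "gdeg F i b \<le> c")
    case True
    have "\<kappa> b = Poly_Mapping.lookup (hvec i c \<kappa> b) (deg_monom (\<lambda>v. c v - gdeg F i b v))"
      using b by (simp add: hvec_def)
    then show ?thesis
      using fdiff_part_at[OF c x(1), of b] b True by (simp add: x(2))
  next
    case False
    then have "\<kappa> b = 0" using \<kappa> b by (auto simp: supp_le_def)
    moreover have "part_at (i + 1) c x b' * coeff_mat (i + 1) b' b = 0" if "b' \<in> gens F (i + 1)" for b'
      using fdiff_unit_vec(2)[OF that, of b] b False by (auto simp: part_at_def dest: order.trans)
    ultimately show ?thesis by (simp add: sum.neutral)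
  qed
  then show ?thesis using part_at_supp_le by blast
qed

lemma fdiff_unit_vec_hvec:
  assumes b: "b \<in> gens F i"
  shows "fdiff F i (unit_vec i b) = hvec (i - 1) (gdeg F i b) (coeff_mat i b)"
    and "supp_le (gens F (i - 1)) (gdeg F (i - 1)) (gdeg F i b) (coeff_mat i b)"
proof -
  show le: "supp_le (gens F (i - 1)) (gdeg F (i - 1)) (gdeg F i b) (coeff_mat i b)"
    using fdiff_unit_vec(2)[OF b] by (auto simp: supp_le_def)
  show "fdiff F i (unit_vec i b) = hvec (i - 1) (gdeg F i b) (coeff_mat i b)"
    by (rule Fobj_eqI[OF fdiff_closed[OF unit_vec_carrier] hvec_carrier[OF gdeg_degrees[OF b] le]])
      (simp add: fdiff_unit_vec(1)[OF b] hvec_def)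
qed

abbreviation sB :: "nat \<Rightarrow> 'b set" where "sB n \<equiv> gens F (int n)"

abbreviation sdg :: "nat \<Rightarrow> 'b \<Rightarrow> 'v \<Rightarrow> int" where "sdg n \<equiv> gdeg F (int n)"

text \<open>Numbered by its target: from homological degree \<open>n + 1\<close> to
  \<open>n\<close>.\<close>

abbreviation smt :: "nat \<Rightarrow> 'b \<Rightarrow> 'b \<Rightarrow> 'k" where "smt n \<equiv> coeff_mat (int (Suc n))"

text \<open>Kernel and image agree in \<open>F\<close>, and on a homogeneous vector the kernel
  condition is one scalar equation per generator of the target, or a single one for the
  augmentation.\<close>

lemma scycle_iff:
  assumes c: "c \<in> degrees V" and \<kappa>: "supp_le (sB n) (sdg n) c \<kappa>"
  shows "scycle sB smt coeff_aug n \<kappa> \<longleftrightarrow>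
    hvec (int n) c \<kappa> \<in> fdiff F (int n + 1) ` carrier (Fobj (int n + 1))"
proof (cases n)
  case 0
  have "hvec 0 c \<kappa> \<in> fdiff F 1 ` carrier (Fobj 1) \<longleftrightarrow> aug (hvec 0 c \<kappa>) = 0"
    unfolding exact_aug[symmetric] using hvec_carrier[OF c, of 0 \<kappa>] \<kappa> 0 by simp
  also have "\<dots> \<longleftrightarrow> (\<Sum>b\<in>gens F 0. \<kappa> b * coeff_aug b) = 0"
  proof -
    have eq: "aug (hvec 0 c \<kappa>) = Poly_Mapping.single (deg_monom c) (\<Sum>b\<in>gens F 0. \<kappa> b * coeff_aug b)"
      using aug_hvec[OF c] \<kappa> 0 by simp
    show ?thesis unfolding eq by (rule single_eq_0_iff)
  qed
  finally show ?thesis using 0 by (simp add: scycle_0)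
next
  case (Suc m)
  have \<kappa>': "supp_le (gens F (int n)) (gdeg F (int n)) c \<kappa>" using \<kappa> .
  have nm: "int n - 1 = int m" using Suc by simp
  have "hvec (int n) c \<kappa> \<in> fdiff F (int n + 1) ` carrier (Fobj (int n + 1)) \<longleftrightarrow>
    fdiff F (int n) (hvec (int n) c \<kappa>) = (\<lambda>b\<in>gens F (int m). 0)"
    using exact_fdiff[of "int n", symmetric] hvec_carrier[OF c \<kappa>'] Suc by (simp add: Fobj_simps(4) nm)
  also have "\<dots> \<longleftrightarrow> (\<forall>b'\<in>gens F (int m). fdiff F (int n) (hvec (int n) c \<kappa>) b' = 0)"
  proof
    assume z: "\<forall>b'\<in>gens F (int m). fdiff F (int n) (hvec (int n) c \<kappa>) b' = 0"
    have "fdiff F (int n) (hvec (int n) c \<kappa>) \<in> carrier (Fobj (int m))"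
      using fdiff_closed[OF hvec_carrier[OF c \<kappa>']] by (simp add: nm)
    then show "fdiff F (int n) (hvec (int n) c \<kappa>) = (\<lambda>b\<in>gens F (int m). 0)"
      by (rule Fobj_eqI) (use z in \<open>simp_all add: Fobj_simps(1) poly_ring_closed\<close>)
  qed simp
  also have "\<dots> \<longleftrightarrow> (\<forall>b'\<in>gens F (int m). (\<Sum>b\<in>gens F (int n). \<kappa> b * coeff_mat (int n) b b') = 0)"
  proof (rule ball_cong[OF refl])
    fix b' assume b': "b' \<in> gens F (int m)"
    have eq: "fdiff F (int n) (hvec (int n) c \<kappa>) b' =
      Poly_Mapping.single (deg_monom (\<lambda>v. c v - gdeg F (int m) b' v)) (\<Sum>b\<in>gens F (int n). \<kappa> b * coeff_mat (int n) b b')"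
      using fdiff_hvec[OF c \<kappa>', of b'] b' by (simp add: nm)
    show "fdiff F (int n) (hvec (int n) c \<kappa>) b' = 0 \<longleftrightarrow> (\<Sum>b\<in>gens F (int n). \<kappa> b * coeff_mat (int n) b b') = 0"
      unfolding eq by (rule single_eq_0_iff)
  qed
  finally show ?thesis unfolding Suc by (simp add: scycle_Suc)
qed

sublocale scalar_resolution V sB sdg smt coeff_aug ideal_degrees
proof
  show "finite V" by (rule finV)
  show "finite (sB n)" for n by (rule finite_gens)
  show "sdg n b \<in> degrees V" if "b \<in> sB n" for b n using gdeg_degrees that by blast
  show "sdg n b' \<le> sdg (Suc n) b \<and> sdg n b' \<noteq> sdg (Suc n) b"
    if "b \<in> sB (Suc n)" "b' \<in> sB n" "smt n b b' \<noteq> 0" for b n b'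
    using fdiff_unit_vec(2,3)[OF that(1), of b'] that by simp
  show "sdg 0 b \<in> ideal_degrees" if "b \<in> sB 0" "coeff_aug b \<noteq> 0" for b
    using aug_unit_vec(2) that by simp
  show "\<exists>\<kappa>. supp_le (sB 0) (sdg 0) c \<kappa> \<and> (\<Sum>b\<in>sB 0. \<kappa> b * coeff_aug b) = 1"
    if c: "c \<in> ideal_degrees" for c
  proof -
    obtain t where t: "c = mdeg t" "supp t \<subseteq> V" "supp t \<in> S" using c by (auto simp: ideal_degrees_def)
    then have "(monomial t :: ('v, 'k) mpoly) \<in> aug ` carrier (Fobj 0)"
      unfolding aug_surj by (simp add: monomial_in_span)
    \<comment> \<open>The preimage of the monomial is replaced by the scalars of its component of
      degree \<open>c\<close>.\<close>
    then obtain x where x: "x \<in> carrier (Fobj 0)" "aug x = monomial t" by force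
    have eq: "aug x = (\<Sum>b\<in>gens F 0. x b *
        Poly_Mapping.single (deg_monom (\<lambda>v. gdeg F 0 b v - 0)) (coeff_aug b))"
      using aug_expansion[OF x(1)] by (simp add: aug_unit_vec(1))
    have "c \<in> degrees V" "(\<lambda>v. 0) \<le> c"
      using t mdeg_degrees[of t V] mdeg_nonneg[of t] by (auto simp: le_fun_def)
    then have "Poly_Mapping.lookup (aug x) (deg_monom (\<lambda>v. c v - 0)) =
        (\<Sum>b\<in>gens F 0. part_at 0 c x b * coeff_aug b)"
      unfolding eq by (intro lookup_sum_part_at aug_unit_vec(3)) (auto simp: degrees_def)
    then have "(\<Sum>b\<in>gens F 0. part_at 0 c x b * coeff_aug b) = 1"
      by (simp add: x(2) t(1) monomial_def)
    then show ?thesis using part_at_supp_le[of 0 c x] by auto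
  qed
  show "scycle sB smt coeff_aug n (smt n b)" if b: "b \<in> sB (Suc n)" for b n
  proof -
    have 1: "supp_le (sB n) (sdg n) (gdeg F (int (Suc n)) b) (smt n b)"
      using fdiff_unit_vec_hvec(2)[OF b] by simp
    have "fdiff F (int n + 1) (unit_vec (int (Suc n)) b) = hvec (int n) (gdeg F (int (Suc n)) b) (smt n b)"
      using fdiff_unit_vec_hvec(1)[OF b] by (simp add: add.commute)
    then have "hvec (int n) (gdeg F (int (Suc n)) b) (smt n b) \<in> fdiff F (int n + 1) ` carrier (Fobj (int n + 1))"
      using unit_vec_carrier[of "int (Suc n)" b] by (metis imageI of_nat_Suc add.commute)
    then show ?thesis using scycle_iff[OF gdeg_degrees[OF b] 1] by blast
  qed
  show "\<exists>\<kappa>'. supp_le (sB (Suc n)) (sdg (Suc n)) c \<kappa>' \<and> (\<forall>b\<in>sB n. \<kappa> b = (\<Sum>b'\<in>sB (Suc n). \<kappa>' b' * smt n b' b))"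
    if "c \<in> degrees V" "supp_le (sB n) (sdg n) c \<kappa>" "scycle sB smt coeff_aug n \<kappa>" for c n \<kappa>
    using exact_degreewise[OF that(1,2)] scycle_iff[OF that(1,2)] that(3)
    by (simp add: add.commute)
qed

end

section \<open>The first linear strand\<close>

lemma complex_iso_trans:
  assumes "complex_iso V C C'" "complex_iso V C' C''"
  shows "complex_iso V C C''"
proof -
  obtain \<phi> where \<phi>: "\<And>i. graded_iso V (obj C i) (obj C' i) (\<phi> i)"
    "\<And>i x. x \<in> carrier (obj C i) \<Longrightarrow> \<phi> (i - 1) (diff C i x) = diff C' i (\<phi> i x)"
    using assms(1) by (auto simp: complex_iso_def)
  obtain \<psi> where \<psi>: "\<And>i. graded_iso V (obj C' i) (obj C'' i) (\<psi> i)"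
    "\<And>i x. x \<in> carrier (obj C' i) \<Longrightarrow> \<psi> (i - 1) (diff C' i x) = diff C'' i (\<psi> i x)"
    using assms(2) by (auto simp: complex_iso_def)
  have \<phi>h: "graded_hom V (obj C i) (obj C' i) (\<phi> i)" and \<psi>h: "graded_hom V (obj C' i) (obj C'' i) (\<psi> i)" for i
    using \<phi>(1)[of i] \<psi>(1)[of i] by (auto simp: graded_iso_def)
  note closed = graded_homD(1)[OF \<phi>h]
  have grd: "(\<psi> i \<circ> \<phi> i) ` grd (obj C i) c = grd (obj C'' i) c" for i c
    using \<phi>(1)[of i] \<psi>(1)[of i] unfolding image_comp[symmetric] graded_iso_def by simp
  have "graded_iso V (obj C i) (obj C'' i) (\<psi> i \<circ> \<phi> i)" for i
    unfolding graded_iso_def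
  proof (intro conjI allI grd)
    show "graded_hom V (obj C i) (obj C'' i) (\<psi> i \<circ> \<phi> i)"
      unfolding graded_hom_def
      by (auto simp: graded_homD[OF \<phi>h] graded_homD[OF \<psi>h] simp del: o_apply)
        (auto simp: graded_homD[OF \<phi>h] graded_homD[OF \<psi>h])
    show "bij_betw (\<psi> i \<circ> \<phi> i) (carrier (obj C i)) (carrier (obj C'' i))"
      using \<phi>(1)[of i] \<psi>(1)[of i] unfolding graded_iso_def by (metis bij_betw_trans)
  qed
  moreover have "(\<psi> (i - 1) \<circ> \<phi> (i - 1)) (diff C i x) = diff C'' i ((\<psi> i \<circ> \<phi> i) x)"
    if "x \<in> carrier (obj C i)" for i x
    using \<phi>(2)[OF that] \<psi>(2)[OF closed[OF that]] by simp
  ultimately show ?thesis unfolding complex_iso_def by (intro exI[of _ "\<lambda>i. \<psi> i \<circ> \<phi> i"]) blast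
qed

text \<open>\<open>complex_iso\<close> does not say that the operations and the differential of
  \<open>C\<close> preserve its carriers; the inverse maps can be evaluated only on elements known
  to come from there, hence the closure assumptions.\<close>

lemma complex_iso_sym:
  assumes iso: "complex_iso V C C'"
    and add: "\<And>i x y. x \<in> carrier (obj C i) \<Longrightarrow> y \<in> carrier (obj C i) \<Longrightarrow> x \<oplus>\<^bsub>obj C i\<^esub> y \<in> carrier (obj C i)"
    and smult: "\<And>i p x. p \<in> carrier (poly_ring V) \<Longrightarrow> x \<in> carrier (obj C i) \<Longrightarrow> p \<odot>\<^bsub>obj C i\<^esub> x \<in> carrier (obj C i)"
    and grd: "\<And>i c. grd (obj C i) c \<subseteq> carrier (obj C i)"
    and diff: "\<And>i x. x \<in> carrier (obj C i) \<Longrightarrow> diff C i x \<in> carrier (obj C (i - 1))"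
  shows "complex_iso V C' C"
proof -
  obtain \<phi> where \<phi>: "\<And>i. graded_iso V (obj C i) (obj C' i) (\<phi> i)"
    "\<And>i x. x \<in> carrier (obj C i) \<Longrightarrow> \<phi> (i - 1) (diff C i x) = diff C' i (\<phi> i x)"
    using assms(1) by (auto simp: complex_iso_def)
  have h: "graded_hom V (obj C i) (obj C' i) (\<phi> i)"
    and bij: "bij_betw (\<phi> i) (carrier (obj C i)) (carrier (obj C' i))"
    and gr: "\<phi> i ` grd (obj C i) c = grd (obj C' i) c" for i c
    using \<phi>(1)[of i] by (auto simp: graded_iso_def)
  define \<psi> where "\<psi> i = inv_into (carrier (obj C i)) (\<phi> i)" for i
  have inv: "\<psi> i (\<phi> i x) = x" if "x \<in> carrier (obj C i)" for i x
    using bij[of i] that by (simp add: \<psi>_def bij_betw_def)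
  have surj: "\<exists>x\<in>carrier (obj C i). y = \<phi> i x" if "y \<in> carrier (obj C' i)" for i y
    using bij[of i] that by (auto simp: bij_betw_def)
  have grd': "\<psi> i ` grd (obj C' i) c = grd (obj C i) c" for i c
  proof -
    have "\<psi> i ` grd (obj C' i) c = (\<lambda>x. \<psi> i (\<phi> i x)) ` grd (obj C i) c"
      by (simp add: gr[symmetric] image_image)
    also have "\<dots> = (\<lambda>x. x) ` grd (obj C i) c"
      using grd[of i c] by (intro image_cong) (auto simp: inv subset_iff)
    finally show ?thesis by simp
  qed
  have "graded_iso V (obj C' i) (obj C i) (\<psi> i)" for i
    unfolding graded_iso_def
  proof (intro conjI allI grd')
    show "bij_betw (\<psi> i) (carrier (obj C' i)) (carrier (obj C i))"
      unfolding \<psi>_def by (rule bij_betw_inv_into[OF bij])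
    show "graded_hom V (obj C' i) (obj C i) (\<psi> i)"
      unfolding graded_hom_def
    proof (intro conjI ballI allI)
      show "\<psi> i \<in> carrier (obj C' i) \<rightarrow> carrier (obj C i)"
        using surj inv by fastforce
      fix y assume "y \<in> carrier (obj C' i)"
      then obtain x where x: "x \<in> carrier (obj C i)" "y = \<phi> i x" using surj by blast
      show "\<psi> i (p \<odot>\<^bsub>obj C' i\<^esub> y) = p \<odot>\<^bsub>obj C i\<^esub> \<psi> i y" if p: "p \<in> carrier (poly_ring V)" for p
        using inv[OF smult[OF p x(1)]] inv[OF x(1)] graded_homD(3)[OF h p x(1)] x(2) by simp
      fix z assume "z \<in> carrier (obj C' i)"
      then obtain w where w: "w \<in> carrier (obj C i)" "z = \<phi> i w" using surj by blast
      show "\<psi> i (y \<oplus>\<^bsub>obj C' i\<^esub> z) = \<psi> i y \<oplus>\<^bsub>obj C i\<^esub> \<psi> i z"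
        using inv[OF add[OF x(1) w(1)]] inv[OF x(1)] inv[OF w(1)] graded_homD(2)[OF h x(1) w(1)] x(2) w(2)
        by simp
    qed (use grd' in blast)
  qed
  moreover have "\<psi> (i - 1) (diff C' i y) = diff C i (\<psi> i y)" if y: "y \<in> carrier (obj C' i)" for i y
  proof -
    obtain x where x: "x \<in> carrier (obj C i)" "y = \<phi> i x" using surj[OF y] by blast
    show ?thesis using \<phi>(2)[OF x(1)] inv[OF x(1)] inv[OF diff[OF x(1)]] x(2) by simp
  qed
  ultimately show ?thesis unfolding complex_iso_def by blast
qed

lemma single_0_mult_homogeneous:
  "p \<in> homogeneous V c \<Longrightarrow> Poly_Mapping.single 0 s * p \<in> homogeneous V c"
  using homogeneous_mult[of "Poly_Mapping.single 0 s" V "\<lambda>v. 0" p c] single_homogeneous[of 0 V "\<lambda>v. 0" s]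
  by simp

text \<open>Constants have degree zero and \<open>\<beta>\<close> preserves degrees, so relabelling
  coordinates and multiplying them by units respects the grading in both directions.\<close>

lemma rescaled_free_iso:
  fixes s :: "'c \<Rightarrow> 'k::field" and g :: "'b \<Rightarrow> 'v \<Rightarrow> int"
  assumes fin: "finite A" "finite A'" and bij: "bij_betw \<beta> A' A"
    and deg: "\<And>D. D \<in> A' \<Longrightarrow> g (\<beta> D) = g' D" and s: "\<And>D. D \<in> A' \<Longrightarrow> s D \<noteq> 0"
  shows "graded_iso V (direct_sum A (\<lambda>b. shifted_ring V (g b))) (direct_sum A' (\<lambda>D. shifted_ring V (g' D)))
    (\<lambda>x. \<lambda>D\<in>A'. Poly_Mapping.single 0 (s D) * x (\<beta> D))"
    (is "graded_iso V ?M ?N ?f")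
proof (rule graded_isoI)
  have M: "x \<in> carrier ?M \<longleftrightarrow> x \<in> (\<Pi>\<^sub>E b\<in>A. carrier (poly_ring V))" for x
    using fin by (simp add: direct_sum_simps shifted_ring_simps)
  have N: "y \<in> carrier ?N \<longleftrightarrow> y \<in> (\<Pi>\<^sub>E D\<in>A'. carrier (poly_ring V))" for y
    using fin by (simp add: direct_sum_simps shifted_ring_simps)
  have \<beta>: "\<beta> D \<in> A" if "D \<in> A'" for D using bij that by (auto simp: bij_betw_def)
  have c0: "Poly_Mapping.single 0 k \<in> carrier (poly_ring V)" for k :: 'k
    by (simp add: in_carrier_poly_ring)
  have closed: "?f x \<in> carrier ?N" if "x \<in> carrier ?M" for x
    using that \<beta> by (auto simp: M N intro!: poly_ring_closed(5) c0 dest: PiE_mem)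
  have inv0: "Poly_Mapping.single 0 (inverse k) * (Poly_Mapping.single 0 k * p) = p"
    "Poly_Mapping.single 0 k * (Poly_Mapping.single 0 (inverse k) * p) = p"
    if "k \<noteq> 0" for k and p :: "('v, 'k) mpoly"
    using that by (simp_all add: mult.assoc[symmetric] mult_single)
  show "graded_hom V ?M ?N ?f"
    unfolding graded_hom_def
  proof (intro conjI ballI allI)
    show "?f \<in> carrier ?M \<rightarrow> carrier ?N" using closed by blast
    fix x assume x: "x \<in> carrier ?M"
    show "?f (x \<oplus>\<^bsub>?M\<^esub> y) = ?f x \<oplus>\<^bsub>?N\<^esub> ?f y" for y
      using \<beta> by (auto simp: direct_sum_simps shifted_ring_simps fun_eq_iff algebra_simps)
    show "?f (p \<odot>\<^bsub>?M\<^esub> x) = p \<odot>\<^bsub>?N\<^esub> ?f x" for p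
      using \<beta> by (auto simp: direct_sum_simps shifted_ring_simps fun_eq_iff algebra_simps)
  next
    show "?f ` grd ?M c \<subseteq> grd ?N c" for c
    proof (rule image_subsetI)
      fix x assume x: "x \<in> grd ?M c"
      then have "x \<in> carrier ?M" by (simp add: direct_sum_simps(5))
      then show "?f x \<in> grd ?N c"
        using x closed \<beta>
        by (auto simp: direct_sum_simps(5) shifted_ring_simps(5) deg[symmetric]
            intro!: single_0_mult_homogeneous)
    qed
  qed
  define \<gamma> where "\<gamma> = inv_into A' \<beta>"
  have \<gamma>: "\<gamma> b \<in> A'" "\<beta> (\<gamma> b) = b" if "b \<in> A" for b
    using bij that inv_into_into[of b \<beta> A'] f_inv_into_f[of b \<beta> A'] by (auto simp: \<gamma>_def bij_betw_def)
  have \<gamma>\<beta>: "\<gamma> (\<beta> D) = D" if "D \<in> A'" for D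
    using bij that by (simp add: \<gamma>_def bij_betw_def)
  let ?h = "\<lambda>y. \<lambda>b\<in>A. Poly_Mapping.single 0 (inverse (s (\<gamma> b))) * y (\<gamma> b)"
  have closed': "?h y \<in> carrier ?M" if "y \<in> carrier ?N" for y
    using that \<gamma> by (auto simp: M N PiE_iff intro!: poly_ring_closed(5) c0)
  show "bij_betw ?f (carrier ?M) (carrier ?N)"
  proof (rule bij_betwI[where g = ?h])
    show "?f \<in> carrier ?M \<rightarrow> carrier ?N" using closed by blast
    show "?h \<in> carrier ?N \<rightarrow> carrier ?M"
      using closed' by blast
    show "?h (?f x) = x" if "x \<in> carrier ?M" for x
    proof (rule PiE_ext)
      show "x \<in> (\<Pi>\<^sub>E b\<in>A. carrier (poly_ring V))" using that M by blast
      show "?h (?f x) \<in> (\<Pi>\<^sub>E b\<in>A. carrier (poly_ring V))"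
        using closed'[OF closed[OF that]] unfolding M .
    qed (use \<gamma> s in \<open>simp add: inv0\<close>)
    show "?f (?h y) = y" if "y \<in> carrier ?N" for y
    proof (rule PiE_ext)
      show "y \<in> (\<Pi>\<^sub>E D\<in>A'. carrier (poly_ring V))" using that N by blast
      show "?f (?h y) \<in> (\<Pi>\<^sub>E D\<in>A'. carrier (poly_ring V))"
        using closed[OF closed'[OF that]] unfolding N .
    qed (use \<beta> \<gamma>\<beta> s in \<open>simp add: inv0\<close>)
  qed
  fix x c assume x: "x \<in> carrier ?M" and fx: "?f x \<in> grd ?N c"
  have "x b \<in> homogeneous V (\<lambda>v. c v - g b v)" if b: "b \<in> A" for b
  proof -
    have "Poly_Mapping.single 0 (s (\<gamma> b)) * x b \<in> homogeneous V (\<lambda>v. c v - g' (\<gamma> b) v)"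
      using fx \<gamma>[OF b] by (auto simp: direct_sum_simps(5) shifted_ring_simps(5))
    then have "Poly_Mapping.single 0 (inverse (s (\<gamma> b))) * (Poly_Mapping.single 0 (s (\<gamma> b)) * x b)
        \<in> homogeneous V (\<lambda>v. c v - g' (\<gamma> b) v)"
      by (rule single_0_mult_homogeneous)
    then show ?thesis using s[OF \<gamma>(1)[OF b]] deg[OF \<gamma>(1)[OF b]] \<gamma>(2)[OF b] by (simp add: inv0)
  qed
  then show "x \<in> grd ?M c" using x by (simp add: direct_sum_simps(5) shifted_ring_simps(5))
next
  show "grd ?N c \<subseteq> carrier ?N" for c by (auto simp: direct_sum_simps(5))
qed

context squarefree_quotient_complex
begin

lemma quot_complex_sym:
  assumes "complex_iso V (underlying_complex V (quot_complex :: (('v, 'k::field) mpoly, 'v set, 'v) free_complex)) C"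
  shows "complex_iso V C (underlying_complex V (quot_complex :: (('v, 'k::field) mpoly, 'v set, 'v) free_complex))"
proof (rule complex_iso_sym[OF assms], unfold underlying_complex_def gcomplex.simps)
  let ?Q = "quot_complex :: (('v, 'k::field) mpoly, 'v set, 'v) free_complex"
  fix i c p and x y :: "'v set \<Rightarrow> ('v, 'k) mpoly"
  show "grd (free_obj V ?Q i) c \<subseteq> carrier (free_obj V ?Q i)" by (auto simp: quot_obj_simps(3))
  assume x: "x \<in> carrier (free_obj V ?Q i)"
  show "x \<oplus>\<^bsub>free_obj V ?Q i\<^esub> y \<in> carrier (free_obj V ?Q i)" if "y \<in> carrier (free_obj V ?Q i)"
    using quot_objD[OF x] quot_objD[OF that] by (auto simp: quot_obj_carrier quot_obj_simps poly_ring_closed)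
  show "p \<odot>\<^bsub>free_obj V ?Q i\<^esub> x \<in> carrier (free_obj V ?Q i)" if "p \<in> carrier (poly_ring V)"
    using quot_objD[OF x] that by (auto simp: quot_obj_carrier quot_obj_simps poly_ring_closed)
  have "(\<Sum>v\<in>D'. if D' - {v} \<in> qgens i then (- 1) ^ alpha r v (D' - {v}) * var v * x (D' - {v}) else 0)
      \<in> carrier (poly_ring V)" if D': "D' \<in> qgens (i - 1)" for D'
  proof (rule sum_closed)
    fix v assume "v \<in> D'"
    then have "v \<in> V" using qidx_subset[OF qgens_qidx[OF D']] WV by blast
    then show "(if D' - {v} \<in> qgens i then (- 1) ^ alpha r v (D' - {v}) * var v * x (D' - {v}) else 0)
      \<in> carrier (poly_ring V)"
      using quot_objD[OF x] unfolding monomial_var_mult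
      by (auto intro!: poly_ring_closed simp: in_carrier_poly_ring[of "Poly_Mapping.single _ _"])
  qed (simp_all add: poly_ring_closed)
  then show "fdiff ?Q i x \<in> carrier (free_obj V ?Q (i - 1))"
    by (auto simp: quot_obj_carrier quot_complex_simps)
qed

text \<open>A pair \<open>(D, v)\<close> with \<open>D' = insert v D\<close> is determined by
  \<open>v\<close>, with \<open>D = D' - {v}\<close>. The condition on
  \<open>vars_prod (insert v D)\<close> holds for these pairs because \<open>D'\<close> is itself a
  generator.\<close>

lemma explicit_complex_eq:
  assumes K: "\<And>D. vertex_cover W K D \<longleftrightarrow> D \<subseteq> W \<and> D \<in> JJ"
    and A: "\<And>D. D \<subseteq> W \<Longrightarrow> vars_prod D \<in> A \<longleftrightarrow> D \<in> PP" and d: "d = int k"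
  shows "explicit_complex r W K A k = (quot_complex :: (('v, 'k::field) mpoly, 'v set, 'v) free_complex)"
proof -
  have card: "int (card D) = int (card W) - i - int k \<longleftrightarrow> int (card (W - D)) = i + d" if "D \<subseteq> W" for D i
    using card_Diff_subset[OF finite_subsets_W[OF that] that] card_mono[OF finW that] d by auto
  have G: "{D. vertex_cover W K D \<and> int (card D) = int (card W) - i - int k \<and> vars_prod D \<notin> A} = qgens i" for i
    using K A card by (auto simp: qgens_def qidx_def)
  have "(\<Sum>D\<in>qgens i. x D * (\<Sum>v | v \<in> W - D \<and> vars_prod (insert v D) \<notin> A.
      (- 1) ^ alpha r v D * var v * (if D' = insert v D then 1 else 0))) =
    (\<Sum>v\<in>D'. if D' - {v} \<in> qgens i then (- 1) ^ alpha r v (D' - {v}) * var v * x (D' - {v}) else 0)"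
    if D': "D' \<in> qgens (i - 1)" for i D' and x :: "'v set \<Rightarrow> ('v, 'k) mpoly"
  proof -
    have sub: "D' \<subseteq> W" "D' \<notin> PP" using D' by (auto simp: qgens_def qidx_def)
    have fin: "finite {v. v \<in> W - D \<and> vars_prod (insert v D) \<notin> A}" for D using finW by simp
    let ?S = "SIGMA D:qgens i. {v. v \<in> W - D \<and> vars_prod (insert v D) \<notin> A}"
    let ?g = "\<lambda>D v. x D * ((- 1) ^ alpha r v D * var v)"
    have "(\<Sum>D\<in>qgens i. x D * (\<Sum>v | v \<in> W - D \<and> vars_prod (insert v D) \<notin> A.
        (- 1) ^ alpha r v D * var v * (if D' = insert v D then 1 else 0))) =
      (\<Sum>D\<in>qgens i. \<Sum>v | v \<in> W - D \<and> vars_prod (insert v D) \<notin> A. if D' = insert v D then ?g D v else 0)"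
      by (simp add: sum_distrib_left if_distrib[of "\<lambda>z. _ * z"] cong: if_cong)
    also have "\<dots> = (\<Sum>p\<in>?S. if D' = insert (snd p) (fst p) then ?g (fst p) (snd p) else 0)"
      using fin finite_qgens by (simp add: sum.Sigma case_prod_unfold)
    also have "\<dots> = (\<Sum>p\<in>{p\<in>?S. D' = insert (snd p) (fst p)}. ?g (fst p) (snd p))"
      using fin finite_qgens by (intro sum.inter_filter[symmetric] finite_SigmaI)
    also have "\<dots> = (\<Sum>v\<in>{v\<in>D'. D' - {v} \<in> qgens i}. ?g (D' - {v}) v)"
    proof (rule sum.reindex_bij_witness[of _ "\<lambda>v. (D' - {v}, v)" snd])
      fix p assume p: "p \<in> {p\<in>?S. D' = insert (snd p) (fst p)}"
      then obtain D v where Dv: "p = (D, v)" "D \<in> qgens i" "v \<in> W - D" "D' = insert v D" by auto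
      then have "D' - {v} = D" by auto
      then show "(D' - {snd p}, snd p) = p" "snd p \<in> {v\<in>D'. D' - {v} \<in> qgens i}"
        "?g (D' - {snd p}) (snd p) = ?g (fst p) (snd p)"
        using Dv by auto
    next
      fix v assume v: "v \<in> {v\<in>D'. D' - {v} \<in> qgens i}"
      then have "insert v (D' - {v}) = D'" by auto
      then show "(D' - {v}, v) \<in> {p\<in>?S. D' = insert (snd p) (fst p)}"
        using v sub A by auto
    qed simp
    also have "\<dots> = (\<Sum>v\<in>D'. if D' - {v} \<in> qgens i then ?g (D' - {v}) v else 0)"
      using finite_subsets_W[OF sub(1)] by (simp add: sum.inter_filter)
    finally show ?thesis by (simp add: mult.commute mult.left_commute cong: if_cong)
  qed
  then show ?thesis
    unfolding explicit_complex_def quot_complex_def Let_def G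
    by (simp add: fun_eq_iff restrict_def)
qed

end

context monomial_resolution
begin

text \<open>The chain map relabels along \<open>D \<mapsto> W - D\<close> and rescales by
  \<open>lam\<close>; the differentials then agree entry by entry through
  \<open>step_matched\<close>. The assumption \<open>ne\<close> places the first strand at
  \<open>d\<close>.\<close>

lemma strand_iso_quot_complex:
  assumes lin: "linear_resolution V sB sdg smt coeff_aug ideal_degrees W d pt Q r"
    and quot: "squarefree_quotient_complex W JJ PP V"
    and corr: "\<And>D. D \<subseteq> W \<Longrightarrow> D \<in> JJ \<and> D \<notin> PP \<longleftrightarrow> transversal_clutter.adm W d pt Q (W - D)"
    and ne: "transversal_clutter.lgens W d pt Q 0 \<noteq> {}"
  shows "complex_iso V (underlying_complex V (first_linear_strand V F))
    (underlying_complex V (squarefree_quotient_complex.quot_complex W JJ PP r (int d)))"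
proof -
  interpret L: linear_resolution V sB sdg smt coeff_aug ideal_degrees W d pt Q r by (rule lin)
  interpret C: squarefree_quotient_complex W JJ PP V r "int d" by (rule quot)
  obtain lam where gm: "\<And>n. L.gens_matched n" and lam: "\<And>n U. U \<in> L.lgens n \<Longrightarrow> lam n U \<noteq> 0"
    and step: "\<And>n. L.step_matched n (lam n) (lam (Suc n))"
    using L.linear_part_matched by blast
  have strand_nat: "strand_gens V F (int d) (int n) = L.linear_part n" for n
    by (auto simp: strand_gens_def L.linear_part_def)
  have strand_neg: "strand_gens V F k i = {}" if "i < 0" for k i
    using gens_neg[OF that] by (simp add: strand_gens_def)
  \<comment> \<open>The lower bound on total degrees excludes smaller values, and a generator
    matched with an element of \<open>lgens 0\<close> attains \<open>d\<close> in homological degree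
    0.\<close>
  have least: "(LEAST k. \<exists>i. strand_gens V F k i \<noteq> {}) = int d"
  proof (rule Least_equality)
    obtain U where "U \<in> L.lgens 0" using ne by blast
    then have "L.gen_at 0 U \<in> strand_gens V F (int d) 0"
      using L.gen_at(3)[OF gm] strand_nat[of 0] by auto
    then show "\<exists>i. strand_gens V F (int d) i \<noteq> {}" by blast
    fix k assume "\<exists>i. strand_gens V F k i \<noteq> {}"
    then obtain i b where b: "b \<in> gens F i" "total_degree V (gdeg F i b) = i + k"
      by (auto simp: strand_gens_def)
    then have "\<not> i < 0" using gens_neg by auto
    then obtain n where "i = int n" by (metis nonneg_int_cases not_le)
    then show "int d \<le> k" using L.total_degree_ge[of b n] b by simp
  qed
  have strand: "first_linear_strand V F = linear_strand V F (int d)"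
    by (simp add: first_linear_strand_def least)
  have qgens_iff: "D \<in> C.qgens (int n) \<longleftrightarrow> D \<subseteq> W \<and> W - D \<in> L.lgens n" for D n
    using corr[of D] by (auto simp: C.qgens_def C.qidx_def L.lgens_def)
  \<comment> \<open>A set \<open>W - D\<close> meeting \<open>d\<close> different parts has at least
    \<open>d\<close> elements.\<close>
  have qgens_neg: "C.qgens i = {}" if "i < 0" for i
  proof (rule ccontr)
    assume "C.qgens i \<noteq> {}"
    then obtain D where D: "D \<subseteq> W" "int (card (W - D)) = i + int d" "L.adm (W - D)"
      using corr by (auto simp: C.qgens_def C.qidx_def)
    then have "pt ` (W - D) = {..<d}" using L.hits_image L.adm_hits by blast
    then have "d \<le> card (W - D)" using card_image_le[of "W - D" pt] L.finW by simp
    then show False using D that by simp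
  qed
  define \<beta> where "\<beta> i D = L.gen_at (nat i) (W - D)" for i D
  \<comment> \<open>\<open>lam U\<close> times the matched generator plays the role of the generator
    \<open>U\<close>, so the coordinate at \<open>U\<close> is the one at the matched generator
    divided by \<open>lam U\<close>.\<close>
  define s where "s i D = inverse (lam (nat i) (W - D))" for i D
  define \<psi> :: "int \<Rightarrow> ('b \<Rightarrow> ('v, 'k) mpoly) \<Rightarrow> 'v set \<Rightarrow> ('v, 'k) mpoly" where "\<psi> i x = (\<lambda>D\<in>C.qgens i. Poly_Mapping.single 0 (s i D) * x (\<beta> i D))" for i x
  have bij_nat: "bij_betw (\<beta> (int n)) (C.qgens (int n)) (L.linear_part n)" for n
  proof -
    have dd: "W - (W - U) = U" if "U \<in> L.lgens n" for U
      using L.lgens_D(3)[OF that] by blast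
    have "bij_betw (\<lambda>D. W - D) (C.qgens (int n)) (L.lgens n)"
      by (rule bij_betwI[where g = "\<lambda>U. W - U"])
        (auto simp: qgens_iff double_diff dd)
    moreover have "\<beta> (int n) = L.gen_at n \<circ> (\<lambda>D. W - D)"
      by (rule ext) (simp add: \<beta>_def)
    ultimately show ?thesis
      using bij_betw_trans[OF _ L.bij_gen_at[OF gm]] by metis
  qed
  have bij: "bij_betw (\<beta> i) (C.qgens i) (strand_gens V F (int d) i)" for i
  proof (cases "i < 0")
    case True
    then show ?thesis by (simp add: qgens_neg strand_neg bij_betw_def)
  next
    case False
    then obtain n where "i = int n" by (metis nonneg_int_cases not_le)
    then show ?thesis using bij_nat strand_nat by simp
  qed
  have deg: "gdeg F (int n) (\<beta> (int n) D) = ind (W - D)" and s: "s (int n) D \<noteq> 0"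
    if "D \<in> C.qgens (int n)" for D n
    using that L.gen_at(2)[OF gm] lam by (auto simp: qgens_iff \<beta>_def s_def)
  have iso: "graded_iso V (free_obj V (linear_strand V F (int d)) i) (free_obj V C.quot_complex i) (\<psi> i)" for i
  proof -
    have "graded_iso V (direct_sum (strand_gens V F (int d) i) (\<lambda>b. shifted_ring V (gdeg F i b)))
      (direct_sum (C.qgens i) (\<lambda>D. shifted_ring V (ind (W - D)))) (\<psi> i)"
      unfolding \<psi>_def
    proof (rule rescaled_free_iso[OF _ C.finite_qgens bij])
      show "finite (strand_gens V F (int d) i)" using finite_gens by (simp add: strand_gens_def)
      fix D assume D: "D \<in> C.qgens i"
      then have "\<not> i < 0" using qgens_neg by auto
      then obtain n where "i = int n" by (metis nonneg_int_cases not_le)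
      then show "gdeg F i (\<beta> i D) = ind (W - D)" "s i D \<noteq> 0" using deg s D by auto
    qed
    then show ?thesis
      by (simp add: free_obj_def linear_strand_def C.quot_complex_simps)
  qed
  have diff: "\<psi> (i - 1) (fdiff (linear_strand V F (int d)) i x) = fdiff C.quot_complex i (\<psi> i x)"
    if x: "x \<in> carrier (free_obj V (linear_strand V F (int d)) i)" for i x
  \<comment> \<open>In these degrees the target, at index \<open>i - 1\<close>, has no
    generators.\<close>
  proof (cases "i \<le> 0")
    case True
    then show ?thesis using qgens_neg[of "i - 1"] by (simp add: \<psi>_def C.quot_complex_simps fun_eq_iff)
  next
    case False
    then obtain m where i: "i = int (Suc m)" by (metis not_le zero_less_imp_eq_int gr0_implies_Suc)
    define xe where "xe = (\<lambda>b\<in>gens F i. if b \<in> strand_gens V F (int d) i then x b else 0)"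
    have x_poly: "x b \<in> carrier (poly_ring V)" if "b \<in> strand_gens V F (int d) i" for b
      using x that finite_gens
      by (auto simp: free_obj_def linear_strand_def direct_sum_simps(1) shifted_ring_simps dest: PiE_mem)
    then have xe: "xe \<in> carrier (Fobj i)"
      by (auto simp: xe_def Fobj_simps(1) poly_ring_closed)
    have eq: "Poly_Mapping.single 0 (s (int m) D') * fdiff F i xe (\<beta> (int m) D') =
      (\<Sum>v\<in>D'. if D' - {v} \<in> C.qgens i then (- 1) ^ alpha r v (D' - {v}) * var v *
        (Poly_Mapping.single 0 (s i (D' - {v})) * x (\<beta> i (D' - {v}))) else 0)"
      if D': "D' \<in> C.qgens (int m)" for D'
    proof -
      let ?U' = "W - D'" and ?b' = "\<beta> (int m) D'"
      have sub: "D' \<subseteq> W" "finite D'" and U': "?U' \<in> L.lgens m"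
        using D' qgens_iff C.finite_subsets_W by auto
      have b': "?b' \<in> gens F (int m)" "?b' \<in> L.linear_part m" "?b' = L.gen_at m ?U'"
        using L.gen_at[OF gm U'] by (auto simp: \<beta>_def)
      have m1: "i - 1 = int m" using i by simp
      \<comment> \<open>\<open>step_matched\<close> solved for the matrix entry of the
        resolution.\<close>
      have entry: "smt m (L.gen_at (Suc m) U) ?b' = L.ldiff U ?U' * lam m ?U' * inverse (lam (Suc m) U)"
        if U: "U \<in> L.lgens (Suc m)" for U
      proof -
        have "lam (Suc m) U * smt m (L.gen_at (Suc m) U) ?b' = L.ldiff U ?U' * lam m ?U'"
          using step[of m] U b'(1,2) U' unfolding L.step_matched_def
          by (simp add: L.push_def b'(3) L.set_at_gen_at[OF gm U'])
        then show ?thesis using lam[OF U] by (simp add: field_simps)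
      qed
      have cancel: "inverse (lam m ?U') * (y * lam m ?U' * z) = y * z" for y z
        using lam[OF U'] by (simp add: field_simps)
      let ?h = "\<lambda>U. x (L.gen_at (Suc m) U) *
          Poly_Mapping.single (deg_monom (\<lambda>v. ind U v - ind ?U' v)) (L.ldiff U ?U' * inverse (lam (Suc m) U))"
      have "fdiff F i xe ?b' = (\<Sum>b\<in>gens F i. xe b * fdiff F i (unit_vec i b) ?b')"
        by (rule fdiff_expansion[OF xe]) (simp add: m1 b'(1))
      also have "\<dots> = (\<Sum>b\<in>L.linear_part (Suc m). x b * fdiff F i (unit_vec i b) ?b')"
      proof (rule sum.mono_neutral_cong_right)
        show sub: "L.linear_part (Suc m) \<subseteq> gens F i" by (auto simp: L.linear_part_def i)
        have sm: "strand_gens V F (int d) i = L.linear_part (Suc m)" unfolding i by (rule strand_nat)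
        show "\<forall>b\<in>gens F i - L.linear_part (Suc m). xe b * fdiff F i (unit_vec i b) ?b' = 0"
          by (simp add: xe_def sm)
        show "xe b * fdiff F i (unit_vec i b) ?b' = x b * fdiff F i (unit_vec i b) ?b'"
          if "b \<in> L.linear_part (Suc m)" for b
          using that sub by (simp add: xe_def sm subsetD)
      qed (rule finite_gens)
      also have "\<dots> = (\<Sum>U\<in>L.lgens (Suc m). x (L.gen_at (Suc m) U) * fdiff F i (unit_vec i (L.gen_at (Suc m) U)) ?b')"
        by (rule sum.reindex_bij_betw[OF L.bij_gen_at[OF gm], symmetric])
      also have "Poly_Mapping.single 0 (s (int m) D') * \<dots> = (\<Sum>U\<in>L.lgens (Suc m). ?h U)"
        unfolding sum_distrib_left
      proof (rule sum.cong[OF refl])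
        fix U assume U: "U \<in> L.lgens (Suc m)"
        have "fdiff F i (unit_vec i (L.gen_at (Suc m) U)) ?b' =
          Poly_Mapping.single (deg_monom (\<lambda>v. ind U v - ind ?U' v)) (smt m (L.gen_at (Suc m) U) ?b')"
          using fdiff_unit_vec(1)[of "L.gen_at (Suc m) U" i ?b'] L.gen_at(1,2)[OF gm U]
            L.gen_at(2)[OF gm U'] b' by (simp add: i)
        then show "Poly_Mapping.single 0 (s (int m) D') * (x (L.gen_at (Suc m) U) *
            fdiff F i (unit_vec i (L.gen_at (Suc m) U)) ?b') = ?h U"
          unfolding mult.left_commute[of "Poly_Mapping.single 0 _"]
          by (simp add: entry[OF U] s_def mult_single cancel del: of_nat_Suc)
      qed
      \<comment> \<open>Only sets with one vertex more than \<open>W - D'\<close> contribute. That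
        vertex, recovered as the single element of \<open>U - (W - D')\<close>, becomes the new
        summation index.\<close>
      also have "\<dots> = (\<Sum>U\<in>{U\<in>L.lgens (Suc m). \<exists>v\<in>U. ?U' = U - {v}}. ?h U)"
      proof (rule sum.mono_neutral_right[OF L.finite_lgens])
        show "\<forall>U\<in>L.lgens (Suc m) - {U\<in>L.lgens (Suc m). \<exists>v\<in>U. ?U' = U - {v}}. ?h U = 0"
        proof
          fix U assume "U \<in> L.lgens (Suc m) - {U\<in>L.lgens (Suc m). \<exists>v\<in>U. ?U' = U - {v}}"
          then have "(L.ldiff U ?U' :: 'k) = 0" using L.ldiff_nonzero by blast
          then show "?h U = 0" by simp
        qed
      qed blast
      also have "\<dots> = (\<Sum>v\<in>{v\<in>D'. D' - {v} \<in> C.qgens i}. ?h (W - (D' - {v})))"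
      proof (rule sum.reindex_bij_witness[of _ "\<lambda>v. W - (D' - {v})" "\<lambda>U. the_elem (U - ?U')"])
        fix U assume "U \<in> {U\<in>L.lgens (Suc m). \<exists>v\<in>U. ?U' = U - {v}}"
        then obtain v where v: "U \<in> L.lgens (Suc m)" "v \<in> U" "?U' = U - {v}" by blast
        have "U \<subseteq> W" using L.lgens_D(3)[OF v(1)] .
        then have "U - ?U' = {v}" "v \<in> D'" "W - (D' - {v}) = U" "W - U = D' - {v}" "D' - {v} \<subseteq> W"
          using v sub by auto
        then show "W - (D' - {the_elem (U - ?U')}) = U" "the_elem (U - ?U') \<in> {v\<in>D'. D' - {v} \<in> C.qgens i}"
          "?h (W - (D' - {the_elem (U - ?U')})) = ?h U"
          using v(1) by (simp_all add: qgens_iff i del: of_nat_Suc)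
      next
        fix v assume v: "v \<in> {v\<in>D'. D' - {v} \<in> C.qgens i}"
        then have "(W - (D' - {v})) - ?U' = {v}" "?U' = W - (D' - {v}) - {v}" "v \<in> W - (D' - {v})"
          using sub by auto
        then show "the_elem (W - (D' - {v}) - ?U') = v"
          "W - (D' - {v}) \<in> {U\<in>L.lgens (Suc m). \<exists>v\<in>U. ?U' = U - {v}}"
          using v by (auto simp: qgens_iff i simp del: of_nat_Suc)
      qed
      also have "\<dots> = (\<Sum>v\<in>{v\<in>D'. D' - {v} \<in> C.qgens i}. (- 1) ^ alpha r v (D' - {v}) * var v *
        (Poly_Mapping.single 0 (s i (D' - {v})) * x (\<beta> i (D' - {v}))))"
      proof (rule sum.cong[OF refl])
        fix v assume v: "v \<in> {v\<in>D'. D' - {v} \<in> C.qgens i}"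
        let ?U = "W - (D' - {v})"
        have U: "v \<in> ?U" "?U' = ?U - {v}" "W - ?U = D' - {v}" "finite ?U" using v sub L.finW by auto
        have "L.ldiff ?U ?U' = L.sg v ?U" unfolding U(2) by (rule L.ldiff_remove[OF U(4,1)])
        then have ld: "L.ldiff ?U ?U' = (- 1 :: 'k) ^ alpha r v (D' - {v})"
          unfolding L.sg_def U(3) .
        \<comment> \<open>The degrees of source and target differ by the single variable
          \<open>v\<close>, so the monomial of the entry is \<open>v\<close>.\<close>
        have md: "(\<lambda>w. ind ?U w - ind ?U' w) = mdeg (Poly_Mapping.single v 1)"
          using U(1) unfolding mdeg_single U(2) by (auto simp: ind_def)
        have si: "s i (D' - {v}) = inverse (lam (Suc m) ?U)" "\<beta> i (D' - {v}) = L.gen_at (Suc m) ?U"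
          by (simp_all add: s_def \<beta>_def i nat_add_distrib)
        have "?h ?U = Poly_Mapping.single (Poly_Mapping.single v 1) ((- 1) ^ alpha r v (D' - {v}) * s i (D' - {v}))
          * x (\<beta> i (D' - {v}))"
          unfolding ld md deg_monom_mdeg si by (rule mult.commute)
        also have "\<dots> = (- 1) ^ alpha r v (D' - {v}) * var v *
          (Poly_Mapping.single 0 (s i (D' - {v})) * x (\<beta> i (D' - {v})))"
          unfolding C.monomial_var_mult mult.assoc[symmetric] mult_single by simp
        finally show "?h ?U = (- 1) ^ alpha r v (D' - {v}) * var v *
          (Poly_Mapping.single 0 (s i (D' - {v})) * x (\<beta> i (D' - {v})))" .
      qed
      also have "\<dots> = (\<Sum>v\<in>D'. if D' - {v} \<in> C.qgens i then (- 1) ^ alpha r v (D' - {v}) * var v *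
        (Poly_Mapping.single 0 (s i (D' - {v})) * x (\<beta> i (D' - {v}))) else 0)"
        using sub by (simp add: sum.inter_filter)
      finally show ?thesis .
    qed
    have "fdiff (linear_strand V F (int d)) i x b = fdiff F i xe b" if "b \<in> strand_gens V F (int d) (int m)" for b
      using that by (simp add: linear_strand_def xe_def i)
    moreover have "\<beta> (int m) D' \<in> strand_gens V F (int d) (int m)" if "D' \<in> C.qgens (int m)" for D'
      using bij_betwE[OF bij] that by blast
    ultimately show ?thesis
      using eq i by (auto simp: \<psi>_def C.quot_complex_simps fun_eq_iff intro!: sum.cong)
  qed
  show ?thesis
    unfolding complex_iso_def underlying_complex_def strand
    by (rule exI[of _ \<psi>]) (simp add: iso diff)
qed

end

section \<open>Clutters, initial degree and transversals\<close>

lemma minimal_generators_edge_ideal: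
  assumes "finite V" "clutter V E"
  shows "minimal_generators (edge_ideal V E :: ('v, 'k::field) mpoly set) = set_monom ` E"
proof -
  have sub: "E \<subseteq> Pow V" and min: "\<And>e e'. e \<in> E \<Longrightarrow> e' \<in> E \<Longrightarrow> e \<subseteq> e' \<Longrightarrow> e = e'"
    using assms(2) by (auto simp: clutter_def)
  have fin: "finite e" if "e \<in> E" for e using sub assms(1) that finite_subset by blast
  have mem: "(monomial t :: ('v, 'k) mpoly) \<in> edge_ideal V E \<longleftrightarrow> supp t \<subseteq> V \<and> (\<exists>e\<in>E. e \<subseteq> supp t)" for t
    by (simp add: edge_ideal_eq_span[OF assms(1) sub] monomial_in_span)
  have memE: "supp (set_monom e) \<subseteq> V \<and> (\<exists>e'\<in>E. e' \<subseteq> supp (set_monom e))" if "e \<in> E" for e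
    using that sub fin[OF that] by auto
  show ?thesis
    unfolding minimal_generators_def mem
  proof (intro equalityI subsetI)
    fix t assume "t \<in> {t. (supp t \<subseteq> V \<and> (\<exists>e\<in>E. e \<subseteq> supp t)) \<and>
      (\<forall>s. (supp s \<subseteq> V \<and> (\<exists>e\<in>E. e \<subseteq> supp s)) \<and> mdivides s t \<longrightarrow> s = t)}"
    then obtain e where e: "e \<in> E" "e \<subseteq> supp t"
      and t: "\<forall>s. (supp s \<subseteq> V \<and> (\<exists>e\<in>E. e \<subseteq> supp s)) \<and> mdivides s t \<longrightarrow> s = t" by blast
    have "mdivides (set_monom e) t"
      using e fin by (simp add: mdivides_squarefree squarefree_set_monom)
    then have "set_monom e = t" using t memE[OF e(1)] by blast
    then show "t \<in> set_monom ` E" using e by blast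
  next
    fix t assume "t \<in> set_monom ` E"
    then obtain e where e: "e \<in> E" "t = set_monom e" by blast
    \<comment> \<open>The support of a divisor \<open>s\<close> in the ideal lies between some edge
      and \<open>e\<close>; incomparability of edges makes it equal to \<open>e\<close>, and
      \<open>t\<close> is squarefree.\<close>
    have "s = t" if s: "supp s \<subseteq> V" "e' \<in> E" "e' \<subseteq> supp s" "mdivides s t" for s e'
    proof -
      have "supp s \<subseteq> e" using mdivides_supp[OF s(4)] e fin by simp
      moreover from this have "e' = e" using min[OF s(2) e(1)] s(3) by blast
      ultimately have "supp s = e" using s(3) by blast
      then have "mdivides t s" using e fin by (simp add: mdivides_squarefree squarefree_set_monom)
      then show ?thesis using s(4)
        by (intro poly_mapping_eqI) (simp add: mdivides_def le_antisym)
    qed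
    then show "t \<in> {t. (supp t \<subseteq> V \<and> (\<exists>e\<in>E. e \<subseteq> supp t)) \<and>
      (\<forall>s. (supp s \<subseteq> V \<and> (\<exists>e\<in>E. e \<subseteq> supp s)) \<and> mdivides s t \<longrightarrow> s = t)}"
      using memE[OF e(1)] e(2) by blast
  qed
qed

lemma mdegree_set_monom: "finite D \<Longrightarrow> mdegree (set_monom D) = card D"
  by (simp add: mdegree_def expo_set_monom)

lemma initial_degree_edge_ideal:
  assumes "finite V" "clutter V E" "E \<noteq> {}"
  shows "\<And>e. e \<in> E \<Longrightarrow> initial_degree (edge_ideal V E :: ('v, 'k::field) mpoly set) \<le> card e"
    and "\<exists>e\<in>E. card e = initial_degree (edge_ideal V E :: ('v, 'k::field) mpoly set)"
proof -
  have fin: "finite e" if "e \<in> E" for e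
    using assms(1,2) that finite_subset by (auto simp: clutter_def)
  have eq: "initial_degree (edge_ideal V E :: ('v, 'k) mpoly set) = (LEAST n. \<exists>e\<in>E. card e = n)"
    unfolding initial_degree_def minimal_generators_edge_ideal[OF assms(1,2)]
    using fin by (intro arg_cong[where f = Least]) (auto simp: mdegree_set_monom fun_eq_iff)
  show "initial_degree (edge_ideal V E :: ('v, 'k) mpoly set) \<le> card e" if "e \<in> E" for e
    unfolding eq by (rule Least_le) (use that in blast)
  show "\<exists>e\<in>E. card e = initial_degree (edge_ideal V E :: ('v, 'k) mpoly set)"
    unfolding eq by (rule LeastI_ex) (use assms(3) in blast)
qed

text \<open>A choice of one element of \<open>T\<close> in each \<open>S j\<close> is injective by
  disjointness, and the cardinality of \<open>T\<close> leaves no room for further elements.\<close>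

lemma transversals_eq:
  assumes disj: "\<And>i j. i < d \<Longrightarrow> j < d \<Longrightarrow> i \<noteq> j \<Longrightarrow> S i \<inter> S j = {}"
    and T: "T \<subseteq> (\<Union>j<d. S j)"
  shows "(\<forall>j<d. T \<inter> S j \<noteq> {}) \<and> card T = d \<and> finite T \<longleftrightarrow> T \<in> {f ` {..<d} | f. \<forall>j<d. f j \<in> S j}"
proof
  assume h: "(\<forall>j<d. T \<inter> S j \<noteq> {}) \<and> card T = d \<and> finite T"
  define f where "f j = (SOME v. v \<in> T \<inter> S j)" for j
  have f: "f j \<in> T \<inter> S j" if "j < d" for j
    unfolding f_def by (rule someI_ex) (use h that in blast)
  have "inj_on f {..<d}"
  proof (rule inj_onI)
    fix i j assume "i \<in> {..<d}" "j \<in> {..<d}" "f i = f j"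
    then show "i = j" using f[of i] f[of j] disj[of i j] by auto
  qed
  then have "card (f ` {..<d}) = card T" using h by (simp add: card_image)
  then have "f ` {..<d} = T" using f h by (intro card_subset_eq) auto
  then show "T \<in> {f ` {..<d} | f. \<forall>j<d. f j \<in> S j}" using f by blast
next
  assume "T \<in> {f ` {..<d} | f. \<forall>j<d. f j \<in> S j}"
  then obtain f where f: "T = f ` {..<d}" "\<forall>j<d. f j \<in> S j" by blast
  have "inj_on f {..<d}"
  proof (rule inj_onI)
    fix i j assume "i \<in> {..<d}" "j \<in> {..<d}" "f i = f j"
    then show "i = j" using f disj[of i j] by force
  qed
  then show "(\<forall>j<d. T \<inter> S j \<noteq> {}) \<and> card T = d \<and> finite T"
    using f by (auto simp: card_image)
qed

text \<open>Both isomorphisms pass through \<open>quot_complex\<close>: the strand is identified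
  with it by relabelling and rescaling, the complex of the squarefree module by \<open>qmap\<close>,
  and the explicit complex is equal to it.\<close>

theorem theorem3p7:
  fixes V W :: "'v set"
    and I :: "('v, 'k::field) mpoly set"
    and a :: "'v monom list"
    and E K :: "'v set set"
    and r :: "('v \<times> 'v) set"
    and F :: "(('v, 'k) mpoly, 'b, 'v) free_complex"
    and aug :: "('b \<Rightarrow> ('v, 'k) mpoly) \<Rightarrow> ('v, 'k) mpoly"
    and A A_W :: "('v, 'k) mpoly set"
    and M :: "(('v, 'k) mpoly, ('v, 'k) mpoly set, 'v) gmodule"
  assumes "finite V"
    and "squarefree_monomial_ideal V I"
    and "I \<noteq> {0}"
    and "I \<noteq> carrier (poly_ring V)"
    and "admissible_regular_sequence V I a"
    and "clutter V E"
    and "I = edge_ideal V E"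
    and "strict_linear_order_on V r"
    and "minimal_free_resolution V I F aug"
    and "W = (\<Union>t\<in>set a. supp t)"
    and "K = complement_edges a E"
    and "A = genideal (poly_ring V) (monomial ` set a)"
    and "A_W = genideal (poly_ring W) (monomial ` set a)"
    and "M = quotient_module (ideal_module W (alexander_dual W (edge_ideal W K))) A_W"
  shows "squarefree_module W M \<and>
    complex_iso V
      (underlying_complex V (first_linear_strand V F))
      (extend_complex W V (shift_complex (int (length a)) (L_complex r W M))) \<and>
    complex_iso V
      (extend_complex W V (shift_complex (int (length a)) (L_complex r W M)))
      (underlying_complex V (explicit_complex r W K A (length a)))"
proof -
  let ?d = "length a"
  let ?S = "\<lambda>j. supp (a ! j)"
  let ?SI = "{S. \<exists>e\<in>E. e \<subseteq> S}"
  have EV: "E \<subseteq> Pow V" using assms(6) by (simp add: clutter_def)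
  have I_span: "I = monomial_span V ?SI"
    unfolding assms(7) by (rule edge_ideal_eq_span[OF assms(1) EV])
  have E_ne: "E \<noteq> {}"
  proof
    assume "E = {}"
    then have "I = {p. Poly_Mapping.keys p = {}}" by (auto simp: I_span monomial_span_def)
    then show False using assms(3) by simp
  qed
  have finE: "finite e" if "e \<in> E" for e using that EV assms(1) finite_subset by blast
  have d: "?d = initial_degree I" and sq: "\<And>t. t \<in> set a \<Longrightarrow> squarefree_monom t"
    and aV: "\<And>t. t \<in> set a \<Longrightarrow> supp t \<subseteq> V"
    and dual: "\<And>t. t \<in> set a \<Longrightarrow> monomial t \<in> alexander_dual V I"
    and cop: "\<And>i j. i < j \<Longrightarrow> j < ?d \<Longrightarrow> coprime_monom (a ! i) (a ! j)"
    using assms(5) by (auto simp: admissible_regular_sequence_def)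
  have disj: "?S i \<inter> ?S j = {}" if "i < ?d" "j < ?d" "i \<noteq> j" for i j
    using cop[of i j] cop[of j i] that by (cases "i < j") (auto simp: coprime_monom_iff)
  \<comment> \<open>The support of a monomial in the dual ideal meets the support of each monomial
    of \<open>I\<close>, in particular each edge.\<close>
  have meets: "e \<inter> ?S j \<noteq> {}" if "e \<in> E" "j < ?d" for e j
  proof -
    have "\<forall>D'\<in>?SI. D' \<subseteq> V \<longrightarrow> D' \<inter> ?S j \<noteq> {}"
      using dual[of "a ! j"] that(2) unfolding I_span alexander_dual_span[OF assms(1)]
      by (simp add: monomial_in_span)
    then show ?thesis using that(1) EV by blast
  qed
  have card_ge: "?d \<le> card e" if "e \<in> E" for e
    unfolding d assms(7) by (rule initial_degree_edge_ideal(1)[OF assms(1,6) E_ne that])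
  obtain e0 where e0: "e0 \<in> E" "card e0 = ?d"
    using initial_degree_edge_ideal(2)[OF assms(1,6) E_ne] unfolding d assms(7) by blast
  have W_eq: "W = (\<Union>j<?d. ?S j)"
    unfolding assms(10) set_conv_nth by blast
  have WV: "W \<subseteq> V" using aV unfolding assms(10) by blast
  have finW: "finite W" using WV assms(1) finite_subset by blast
  \<comment> \<open>The supports are pairwise disjoint, so there is at most one such index.\<close>
  define pt where "pt v = (LEAST j. j < ?d \<and> v \<in> ?S j)" for v
  have pt: "pt v = j" if "j < ?d" "v \<in> ?S j" for v j
    unfolding pt_def
  proof (rule Least_equality)
    fix k assume "k < ?d \<and> v \<in> ?S k"
    then show "j \<le> k" using disj[of j k] that by (cases "j = k") auto
  qed (use that in blast)
  interpret T: transversal_clutter V W ?d pt E r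
  proof
    show "finite V" by fact
    show "W \<subseteq> V" by (rule WV)
    show "pt v < ?d" if "v \<in> W" for v
      using that pt unfolding W_eq by blast
    have r: "trans r" "irrefl r" "total_on V r"
      using assms(8) by (auto simp: strict_linear_order_on_def)
    show "(v, v) \<notin> r" for v using r(2) by (simp add: irrefl_def)
    show "(v, u) \<notin> r" if "(u, v) \<in> r" for u v
      using r(1,2) that by (meson irrefl_def transD)
    show "(u, v) \<in> r \<or> (v, u) \<in> r" if "u \<in> V" "v \<in> V" "u \<noteq> v" for u v
      using r(3) that by (auto simp: total_on_def)
  qed
  have hits_iff: "T.hits U \<longleftrightarrow> U \<subseteq> W \<and> (\<forall>j<?d. U \<inter> ?S j \<noteq> {})" for U
  proof -
    have "(\<exists>u\<in>U. pt u = j) \<longleftrightarrow> U \<inter> ?S j \<noteq> {}" if UW: "U \<subseteq> W" and j: "j < ?d" for j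
    proof
      assume "\<exists>u\<in>U. pt u = j"
      then obtain u where u: "u \<in> U" "pt u = j" by blast
      then have "u \<in> (\<Union>j<?d. ?S j)" using UW unfolding W_eq by blast
      then obtain k where k: "k < ?d" "u \<in> ?S k" by blast
      then have "k = j" using pt[OF k] u by simp
      then show "U \<inter> ?S j \<noteq> {}" using u k by blast
    next
      assume "U \<inter> ?S j \<noteq> {}"
      then obtain u where u: "u \<in> U" "u \<in> ?S j" by blast
      then have "pt u = j" using pt[OF j] by blast
      then show "\<exists>u\<in>U. pt u = j" using u by blast
    qed
    then show ?thesis by (auto simp: T.hits_def)
  qed
  have transversal_iff: "T.hits U \<and> card U = ?d \<longleftrightarrow> U \<in> {f ` {..<?d} | f. \<forall>j<?d. f j \<in> ?S j}" for U
  proof (cases "U \<subseteq> W")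
    case True
    then have "finite U" using finW finite_subset by blast
    then have "T.hits U \<and> card U = ?d \<longleftrightarrow> (\<forall>j<?d. U \<inter> ?S j \<noteq> {}) \<and> card U = ?d \<and> finite U"
      using True hits_iff[of U] by blast
    also have "\<dots> \<longleftrightarrow> U \<in> {f ` {..<?d} | f. \<forall>j<?d. f j \<in> ?S j}"
      by (rule transversals_eq[of ?d ?S U, OF disj]) (assumption | rule True[unfolded W_eq])+
    finally show ?thesis .
  next
    case False
    have "f ` {..<?d} \<subseteq> W" if "\<forall>j<?d. f j \<in> ?S j" for f
      using that unfolding W_eq by blast
    then have "U \<notin> {f ` {..<?d} | f. \<forall>j<?d. f j \<in> ?S j}" using False by blast
    then show ?thesis using False T.hits_subset[of U] by blast
  qed
  have K_iff: "e \<in> K \<longleftrightarrow> T.hits e \<and> card e = ?d \<and> e \<notin> E" for e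
    using transversal_iff[of e] unfolding assms(11) complement_edges_def by blast
  have KW: "K \<subseteq> Pow W" using K_iff hits_iff by blast
  \<comment> \<open>For subsets of \<open>W\<close> these are the vertex covers of \<open>K\<close>,
    the supports occurring in the dual ideal.\<close>
  define JJ where "JJ = {D. \<forall>e\<in>K. e \<inter> D \<noteq> {}}"
  define PP where "PP = {D. \<exists>t\<in>set a. supp t \<subseteq> D}"
  have aW: "supp t \<subseteq> W" if "t \<in> set a" for t using that unfolding assms(10) by blast
  have PP_iff: "D \<in> PP \<longleftrightarrow> (\<exists>j<?d. ?S j \<subseteq> D)" for D
    unfolding PP_def set_conv_nth by blast
  have quot: "squarefree_quotient_complex W JJ PP V"
  proof
    show "finite W" by (rule finW)
    show "W \<subseteq> V" by (rule WV)
    show "D' \<in> JJ" if "D \<in> JJ" "D \<subseteq> D'" for D D' using that unfolding JJ_def by blast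
    show "D' \<in> PP" if "D \<in> PP" "D \<subseteq> D'" for D D' using that unfolding PP_def by blast
    show "D \<in> JJ" if D: "D \<in> PP" for D
    proof -
      obtain j where j: "j < ?d" "?S j \<subseteq> D" using D PP_iff[of D] by blast
      show ?thesis unfolding JJ_def
      proof (intro CollectI ballI)
        fix e assume "e \<in> K"
        then have "T.hits e" using K_iff[of e] by blast
        then have "e \<inter> ?S j \<noteq> {}" using hits_iff[of e] j(1) by blast
        then show "e \<inter> D \<noteq> {}" using j(2) by blast
      qed
    qed
  qed
  interpret Q: squarefree_quotient_complex W JJ PP V r "int ?d" by (rule quot)
  have M: "M = Q.M"
  proof -
    have "edge_ideal W K = (monomial_span W {S. \<exists>e\<in>K. e \<subseteq> S} :: ('v, 'k) mpoly set)"
      by (rule edge_ideal_eq_span[OF finW KW])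
    then have "alexander_dual W (edge_ideal W K) = (monomial_span W
      {D. \<forall>D'\<in>{S. \<exists>e\<in>K. e \<subseteq> S}. D' \<subseteq> W \<longrightarrow> D' \<inter> D \<noteq> {}} :: ('v, 'k) mpoly set)"
      by (simp only: alexander_dual_span[OF finW])
    also have "{D. \<forall>D'\<in>{S. \<exists>e\<in>K. e \<subseteq> S}. D' \<subseteq> W \<longrightarrow> D' \<inter> D \<noteq> {}} = JJ"
    proof (intro equalityI subsetI)
      fix D assume D: "D \<in> {D. \<forall>D'\<in>{S. \<exists>e\<in>K. e \<subseteq> S}. D' \<subseteq> W \<longrightarrow> D' \<inter> D \<noteq> {}}"
      have "e \<inter> D \<noteq> {}" if "e \<in> K" for e
      proof -
        have "e \<in> {S. \<exists>e\<in>K. e \<subseteq> S}" "e \<subseteq> W" using that KW by auto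
        then show ?thesis using D by simp
      qed
      then show "D \<in> JJ" by (simp add: JJ_def)
    next
      fix D assume "D \<in> JJ"
      then show "D \<in> {D. \<forall>D'\<in>{S. \<exists>e\<in>K. e \<subseteq> S}. D' \<subseteq> W \<longrightarrow> D' \<inter> D \<noteq> {}}"
        unfolding JJ_def by fastforce
    qed
    finally have "alexander_dual W (edge_ideal W K) = (monomial_span W JJ :: ('v, 'k) mpoly set)" .
    moreover have "A_W = monomial_span W PP"
      unfolding assms(13) PP_def by (rule genideal_squarefree) (use aW sq in auto)
    ultimately show ?thesis by (simp only: assms(14) Q.M_def)
  qed
  \<comment> \<open>Complements translate both conditions: \<open>D\<close> contains no support of
    the sequence iff \<open>W - D\<close> meets them all, and \<open>D\<close> covers
    \<open>K\<close> iff no transversal outside E fits into \<open>W - D\<close>.\<close>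
  have corr: "D \<in> JJ \<and> D \<notin> PP \<longleftrightarrow> T.adm (W - D)" if D: "D \<subseteq> W" for D
  proof -
    have "(W - D) \<inter> ?S j \<noteq> {} \<longleftrightarrow> \<not> ?S j \<subseteq> D" if "j < ?d" for j
      using that unfolding W_eq by blast
    then have 1: "D \<notin> PP \<longleftrightarrow> T.hits (W - D)"
      unfolding hits_iff PP_iff by blast
    have "D \<in> JJ \<longleftrightarrow> (\<forall>T\<subseteq>W - D. T.hits T \<and> card T = ?d \<longrightarrow> T \<in> E)"
    proof
      assume J: "D \<in> JJ"
      show "\<forall>T\<subseteq>W - D. T.hits T \<and> card T = ?d \<longrightarrow> T \<in> E"
      proof (intro allI impI, rule ccontr)
        fix T assume "T \<subseteq> W - D" "T.hits T \<and> card T = ?d" "T \<notin> E"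
        then have "T \<in> K" "T \<inter> D = {}" using K_iff[of T] by auto
        then show False using J unfolding JJ_def by blast
      qed
    next
      assume h: "\<forall>T\<subseteq>W - D. T.hits T \<and> card T = ?d \<longrightarrow> T \<in> E"
      show "D \<in> JJ" unfolding JJ_def
      proof (intro CollectI ballI notI)
        fix e assume e: "e \<in> K" "e \<inter> D = {}"
        then have "e \<subseteq> W - D" using KW by blast
        then show False using h e K_iff[of e] by blast
      qed
    qed
    then show ?thesis unfolding T.adm_def using 1 by blast
  qed
  interpret R: monomial_resolution V ?SI F aug
    by unfold_locales (use assms(1,9) I_span in auto)
  have ideal_degreesD: "\<exists>e\<in>E. e \<subseteq> V \<and> ind e \<le> c \<and> c \<in> degrees V" if c: "c \<in> R.ideal_degrees" for c
  proof -
    obtain t e where t: "c = mdeg t" "supp t \<subseteq> V" "e \<in> E" "e \<subseteq> supp t"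
      using c unfolding R.ideal_degrees_def by blast
    have "ind e v \<le> c v" for v
      using t by (auto simp: ind_def mdeg_def in_keys_iff)
    then show ?thesis using t mdeg_degrees[of t V] by (auto simp: le_fun_def)
  qed
  have edge_lgens: "e \<in> T.lgens 0" if e: "e \<in> E" "card e = ?d" for e
  proof -
    \<comment> \<open>An edge with \<open>d\<close> elements meets \<open>d\<close> disjoint
      supports, so it is exhausted by them: it lies in \<open>W\<close> and is a
      transversal.\<close>
    have "pt ` (e \<inter> W) = {..<?d}"
    proof (intro equalityI subsetI)
      fix j assume "j \<in> {..<?d}"
      then obtain v where v: "v \<in> e" "v \<in> ?S j" "j < ?d" using meets[OF e(1)] by blast
      then have "v \<in> W" unfolding W_eq by blast
      then show "j \<in> pt ` (e \<inter> W)" using v pt by blast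
    qed (use T.pt_less in auto)
    then have "?d \<le> card (e \<inter> W)"
      using card_image_le[of "e \<inter> W" pt] finE[OF e(1)] by simp
    then have "e \<inter> W = e" using e finE by (intro card_seteq) auto
    then have "e \<subseteq> W" by blast
    then have h: "T.hits e" using hits_iff meets[OF e(1)] by blast
    have "T = e" if "T \<subseteq> e" "card T = ?d" for T
      using that e finE card_subset_eq by metis
    then have "T.adm e" using h e(1) unfolding T.adm_def by blast
    then show ?thesis using e by (simp add: T.lgens_def)
  qed
  have lin: "linear_resolution V R.sB R.sdg R.smt R.coeff_aug R.ideal_degrees W ?d pt E r"
  proof
    \<comment> \<open>A monomial of \<open>I\<close> is divisible by an edge monomial, and
      \<open>d\<close> is the smallest size of an edge.\<close>
    show "int ?d \<le> total_degree V c" if c: "c \<in> R.ideal_degrees" for c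
    proof -
      obtain e where "e \<in> E" "e \<subseteq> V" "ind e \<le> c" using ideal_degreesD[OF c] by blast
      then show ?thesis
        using total_degree_mono[of "ind e" c V] total_degree_ind[OF assms(1), of e] card_ge by fastforce
    qed
    show "\<exists>U\<in>T.lgens 0. c = ind U" if c: "c \<in> R.ideal_degrees" "total_degree V c = int ?d" for c
    proof -
      obtain e where e: "e \<in> E" "e \<subseteq> V" "ind e \<le> c" "c \<in> degrees V" using ideal_degreesD[OF c(1)] by blast
      have "total_degree V c \<le> total_degree V (ind e)"
        using total_degree_ind[OF assms(1) e(2)] card_ge[OF e(1)] c(2) by simp
      then have eq: "ind e = c"
        using total_degree_eqD[OF assms(1) ind_degrees[OF e(2)] e(4,3)] by blast
      then have "card e = ?d" using total_degree_ind[OF assms(1) e(2)] c(2) by simp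
      then show ?thesis using edge_lgens[OF e(1)] eq by blast
    qed
    show "ind U \<in> R.ideal_degrees" if U: "U \<in> T.lgens 0" for U
    proof -
      have "U \<in> E" using U unfolding T.lgens_def T.adm_def by auto
      moreover have "ind U = mdeg (set_monom U)" using T.lgens_D(4)[OF U] by simp
      moreover have "supp (set_monom U) = U" using T.lgens_D(4)[OF U] by simp
      ultimately show ?thesis using EV unfolding R.ideal_degrees_def by blast
    qed
  qed
  have ne: "T.lgens 0 \<noteq> {}" using edge_lgens[OF e0] by blast
  have strand: "complex_iso V (underlying_complex V (first_linear_strand V F))
      (underlying_complex V Q.quot_complex)"
    by (rule R.strand_iso_quot_complex[OF lin quot corr ne])
  have LC: "extend_complex W V (shift_complex (int ?d) (L_complex r W M)) = Q.LC"
    unfolding Q.LC_def M ..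
  have explicit: "explicit_complex r W K A ?d = Q.quot_complex"
  proof (rule Q.explicit_complex_eq)
    show "vertex_cover W K D \<longleftrightarrow> D \<subseteq> W \<and> D \<in> JJ" for D by (simp add: vertex_cover_def JJ_def)
    have "A = monomial_span V PP"
      unfolding assms(12) PP_def by (rule genideal_squarefree) (use aV sq in auto)
    then show "vars_prod D \<in> A \<longleftrightarrow> D \<in> PP" if "D \<subseteq> W" for D
      using that WV vars_prod_in_span[OF Q.finite_subsets_W[OF that]] by blast
  qed simp
  show ?thesis
    unfolding LC explicit
    using Q.squarefree_module_M complex_iso_trans[OF strand Q.quot_complex_iso_LC]
      Q.quot_complex_sym[OF Q.quot_complex_iso_LC] M by simp
qed


end
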